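(* Let $D$ be a positive integer and let $(X,\mathbb{Z}^k,T)$ be a dynamical system (compact metric space with continuous $\mathbb{Z}^k$-action) having the marker property. If $\mathrm{mdim}(X)<D/2^{k+1}$, then there exists an equivariant topological embedding of $X$ into the $\mathbb{Z}^k$-shift $([0,1]^{2D})^{\mathbb{Z}^k}$.
   Context: The $\mathbb{Z}^k$-shift on $K^{\mathbb{Z}^k}$ is the action $(a,(x_n)_{n\in\mathbb{Z}^k})\mapsto(x_{n+a})_{n\in\mathbb{Z}^k}$. Marker property: for every finite $F\subset\mathbb{Z}^k$ there is an open $U\subset X$ with $X=\bigcup_nT^nU$ and $U\cap T^nU=\emptyset$ for all nonzero $n\in F$. Mean dimension: with $[N]=\{0,\dots,N-1\}^k$, $d_\Omega(x,y)=\sup_{n\in\Omega}d(T^nx,T^ny)$, a continuous $f:(X,d)\to Y$ is an $\varepsilon$-embedding if $\mathrm{diam}\,f^{-1}(y)<\varepsilon$ for all $y$, $\mathrm{widim}_\varepsilon(X,d)$ is the minimal dimension of a finite simplicial complex admitting an $\varepsilon$-embedding, and $\mathrm{mdim}(X)=\lim_{\varepsilon\to0}\lim_{N\to\infty}N^{-k}\mathrm{widim}_\varepsilon(X,d_{[N]})$. *)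

theory Defs
  imports "HOL-Analysis.Analysis"
begin

definition Zk_system :: "'a::metric_space set \<Rightarrow> (int^'k \<Rightarrow> 'a \<Rightarrow> 'a) \<Rightarrow> bool" where
  "Zk_system X T \<longleftrightarrow> compact X \<and>
     (\<forall>n. continuous_on X (T n) \<and> T n ` X \<subseteq> X) \<and>
     (\<forall>x\<in>X. T 0 x = x) \<and>
     (\<forall>m n. \<forall>x\<in>X. T (m + n) x = T m (T n x))"

definition marker_property :: "'a::metric_space set \<Rightarrow> (int^'k \<Rightarrow> 'a \<Rightarrow> 'a) \<Rightarrow> bool" where
  "marker_property X T \<longleftrightarrow>
     (\<forall>F::(int^'k) set. finite F \<longrightarrow>
        (\<exists>U. openin (top_of_set X) U \<and> X = (\<Union>n. T n ` U) \<and>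
             (\<forall>n\<in>F. n \<noteq> 0 \<longrightarrow> U \<inter> T n ` U = {})))"

definition cube :: "nat \<Rightarrow> (int^'k) set" where
  "cube N = {n. \<forall>i. 0 \<le> n $ i \<and> n $ i < int N}"

definition dN :: "(int^'k \<Rightarrow> 'a \<Rightarrow> 'a) \<Rightarrow> nat \<Rightarrow> 'a \<Rightarrow> 'a::metric_space \<Rightarrow> real" where
  "dN T N x y = (SUP n\<in>(cube N :: (int^'k) set). dist (T n x) (T n y))"

text \<open>Finite (abstract) simplicial complexes with vertices in nat, and their
geometric realisation (barycentric coordinates) as a subspace of R^nat with the
product topology (on the finitely many coordinates involved this is the Euclidean
topology).\<close>
definition simplicial_cx :: "nat set set \<Rightarrow> bool" where
  "simplicial_cx K \<longleftrightarrow> finite (\<Union>K) \<and> {} \<notin> K \<and>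
     (\<forall>\<sigma>\<in>K. \<forall>\<tau>. \<tau> \<subseteq> \<sigma> \<and> \<tau> \<noteq> {} \<longrightarrow> \<tau> \<in> K)"

definition realization :: "nat set set \<Rightarrow> (nat \<Rightarrow> real) set" where
  "realization K = {p. (\<forall>v. 0 \<le> p v) \<and> {v. p v \<noteq> 0} \<in> K \<and> sum p {v. p v \<noteq> 0} = 1}"

definition realization_top :: "nat set set \<Rightarrow> (nat \<Rightarrow> real) topology" where
  "realization_top K = subtopology (product_topology (\<lambda>_. euclideanreal) UNIV) (realization K)"

definition cx_dim :: "nat set set \<Rightarrow> nat" where
  "cx_dim K = (if K = {} then 0 else Max (card ` K) - 1)"

definition diamN :: "(int^'k \<Rightarrow> 'a \<Rightarrow> 'a) \<Rightarrow> nat \<Rightarrow> 'a::metric_space set \<Rightarrow> real" where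
  "diamN T N A = (if A = {} then 0 else (SUP p\<in>A \<times> A. dN T N (fst p) (snd p)))"

definition eps_embedding ::
  "'a::metric_space set \<Rightarrow> (int^'k \<Rightarrow> 'a \<Rightarrow> 'a) \<Rightarrow> nat \<Rightarrow> real \<Rightarrow> nat set set \<Rightarrow> ('a \<Rightarrow> nat \<Rightarrow> real) \<Rightarrow> bool" where
  "eps_embedding X T N \<epsilon> K f \<longleftrightarrow>
     continuous_map (top_of_set X) (realization_top K) f \<and>
     (\<forall>y. diamN T N {x\<in>X. f x = y} < \<epsilon>)"

definition widim :: "'a::metric_space set \<Rightarrow> (int^'k \<Rightarrow> 'a \<Rightarrow> 'a) \<Rightarrow> nat \<Rightarrow> real \<Rightarrow> nat" where
  "widim X T N \<epsilon> = (LEAST d. \<exists>K f. simplicial_cx K \<and> eps_embedding X T N \<epsilon> K f \<and> cx_dim K = d)"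

definition mdim :: "'a::metric_space set \<Rightarrow> (int^'k::finite \<Rightarrow> 'a \<Rightarrow> 'a) \<Rightarrow> ereal" where
  "mdim X T = Lim (at_right 0)
     (\<lambda>\<epsilon>::real. ereal (lim (\<lambda>N. real (widim X T N \<epsilon>) / real N ^ CARD('k))))"

definition shift_top :: "nat \<Rightarrow> (int^'k \<Rightarrow> nat \<Rightarrow> real) topology" where
  "shift_top M = product_topology (\<lambda>_. product_topology (\<lambda>_. top_of_set {0..1}) {..<M}) UNIV"

definition shift :: "int^'k \<Rightarrow> (int^'k \<Rightarrow> nat \<Rightarrow> real) \<Rightarrow> (int^'k \<Rightarrow> nat \<Rightarrow> real)" where
  "shift a x = (\<lambda>n. x (n + a))"

end

theory Submission
  imports Defs
begin

text \<open>
  The embedding is \<open>x \<mapsto> (h (T n x), g (T n x))\<close>, where one coordinate \<open>h\<close> carries a tiling of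
  the group and \<open>D\<close> coordinates \<open>g\<close> carry the point.

  The function \<open>h\<close> superposes marker functions of rapidly growing scales. The marker of scale \<open>j\<close> is
  written along a line as a ramp of length \<open>5 ^ j\<close> and tiny height; since markers are sparse, some
  site of the ramp is free of all lower layers, so the orbit of \<open>h\<close> determines markers of every
  scale. They give power diagrams, depending continuously on the point, whose cells are filled by
  pixels of side \<open>N - 1\<close>; the pixel at \<open>(N - 1) a\<close> encodes the window of side \<open>N\<close> at \<open>N a\<close>.
  As cells are fat, every site lies in a window that is encoded with full weight.

  For \<open>g\<close> a category argument is used. A given function is approximated over each pixel by a linear
  image of a fine partition of unity of order about \<open>widim\<close>, taken both at the pixel and at its
  window. General position of the vertices needs four times the order to be at most
  \<open>D (N - 1) ^ k\<close>, so that the bound \<open>mdim < D / 4\<close> suffices.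
\<close>

section \<open>General position and partitions of intervals\<close>

text \<open>The category argument varies \<open>g\<close> through infinitely many precisions, and
  each precision needs markers of its own scale. All of them must be read from a function fixed
  beforehand; this is why \<open>h\<close> has to carry every scale. The obstacle to an economical
  encoding is the boundary of the cells: the tiling must vary continuously, so pixels fade out there
  and what they would encode is lost. Shrinking by (N - 1) / N moves pixels into the interior, where
  they have full weight, while the windows of side N that they encode still fill the whole cell. The
  price is the volume ratio (N / (N - 1)) ^ k, which tends to 1, so the rank k does not enter the
  bound. The factor 4 is 2 * 2: two points are compared, and each is read at two places. The reading
  at the window recovers the point, the reading at the pixel keeps \<open>g\<close> close to the
  given function.\<close>

lemma homogeneous_system_nontrivial_solution:
  fixes s :: "'v \<Rightarrow> 'i \<Rightarrow> real"
  assumes "finite S" "finite I" "card S < card I"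
  shows "\<exists>l. (\<exists>i\<in>I. l i \<noteq> 0) \<and> (\<forall>v\<in>S. (\<Sum>i\<in>I. l i * s v i) = 0)"
  using assms
proof (induction S arbitrary: I s rule: finite_induct)
  case empty
  then have "I \<noteq> {}" by auto
  then show ?case by (intro exI[of _ "\<lambda>_. 1"]) auto
next
  case (insert v S)
  show ?case
  proof (cases "\<forall>i\<in>I. s v i = 0")
    case True
    have "card S < card I" using insert by simp
    then obtain l where l: "\<exists>i\<in>I. l i \<noteq> 0" "\<forall>u\<in>S. (\<Sum>i\<in>I. l i * s u i) = 0"
      using insert.IH[of I s] insert.prems by blast
    have "(\<Sum>i\<in>I. l i * s v i) = 0" using True by simp
    with l show ?thesis by (intro exI[of _ l]) auto
  next
    case False
    then obtain i0 where i0: "i0 \<in> I" "s v i0 \<noteq> 0" by blast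
    let ?I = "I - {i0}"
    have "card S < card ?I" using insert i0 by simp
    then obtain l where l: "\<exists>i\<in>?I. l i \<noteq> 0"
        "\<forall>u\<in>S. (\<Sum>i\<in>?I. l i * (s u i - s u i0 * s v i / s v i0)) = 0"
      using insert.IH[of ?I "\<lambda>u i. s u i - s u i0 * s v i / s v i0"] insert.prems by auto
    define t where "t = (\<Sum>i\<in>?I. l i * s v i)"
    \<comment> \<open>Gaussian elimination: the other unknowns solve the system from which the pivot
      unknown \<open>i0\<close> was eliminated, and its value is then read off from equation
      \<open>v\<close>.\<close>
    define l' where "l' = l(i0 := - t / s v i0)"
    have split: "(\<Sum>i\<in>I. l' i * s u i) = (\<Sum>i\<in>?I. l i * s u i) - t * s u i0 / s v i0" for u
    proof -
      have "(\<Sum>i\<in>I. l' i * s u i) = l' i0 * s u i0 + (\<Sum>i\<in>?I. l' i * s u i)"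
        using i0 insert.prems by (simp add: sum.remove)
      also have "(\<Sum>i\<in>?I. l' i * s u i) = (\<Sum>i\<in>?I. l i * s u i)"
        by (intro sum.cong) (auto simp: l'_def)
      finally show ?thesis by (simp add: l'_def)
    qed
    have "(\<Sum>i\<in>I. l' i * s u i) = 0" if "u \<in> insert v S" for u
    proof (cases "u = v")
      case True
      then show ?thesis using split[of v] i0 by (simp add: t_def)
    next
      case False
      then have "0 = (\<Sum>i\<in>?I. l i * (s u i - s u i0 * s v i / s v i0))" using l that by auto
      also have "\<dots> = (\<Sum>i\<in>?I. l i * s u i) - t * s u i0 / s v i0"
        unfolding t_def sum_distrib_right sum_divide_distrib sum_subtractf[symmetric]
        by (intro sum.cong) (auto simp: field_simps)
      finally show ?thesis using split by simp
    qed
    moreover have "\<exists>i\<in>I. l' i \<noteq> 0" using l(1) by (auto simp: l'_def)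
    ultimately show ?thesis by blast
  qed
qed

text \<open>Proper hyperplanes have empty interior, and so does a finite union of them. The
  induction adds one functional \<open>l\<close> and moves along a coordinate on which
  \<open>l\<close> does not vanish.\<close>

lemma avoid_finitely_many_functionals:
  fixes b :: "'i \<Rightarrow> real" and \<Lambda> :: "('i \<Rightarrow> real) set"
  assumes "finite \<Lambda>" "finite I" "e > 0" "\<And>l. l \<in> \<Lambda> \<Longrightarrow> \<exists>i\<in>I. l i \<noteq> 0"
  shows "\<exists>y. (\<forall>i\<in>I. \<bar>y i - b i\<bar> < e) \<and> (\<forall>l\<in>\<Lambda>. (\<Sum>i\<in>I. l i * y i) \<noteq> 0)"
  using assms
proof (induction \<Lambda> arbitrary: e rule: finite_induct)
  case empty
  then show ?case by (intro exI[of _ b]) auto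
next
  case (insert l \<Lambda>)
  obtain y where y: "\<forall>i\<in>I. \<bar>y i - b i\<bar> < e/2" "\<forall>l\<in>\<Lambda>. (\<Sum>i\<in>I. l i * y i) \<noteq> 0"
    using insert.IH[of "e/2"] insert.prems by auto
  obtain i0 where i0: "i0 \<in> I" "l i0 \<noteq> 0" using insert.prems by blast
  \<comment> \<open>Each functional with nonzero coefficient at \<open>i0\<close> excludes one value
    of \<open>t\<close>. A zero coefficient only adds the harmless value 0, as division by zero
    gives 0, and such a functional keeps its nonzero value under the move.\<close>
  define bad where "bad = (\<lambda>l. - (\<Sum>i\<in>I. l i * y i) / l i0) ` insert l \<Lambda>"
  have "infinite {0<..<e/2}" using insert.prems by (simp add: infinite_Ioo)
  moreover have "finite bad" using insert by (simp add: bad_def)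
  ultimately have "infinite ({0<..<e/2} - bad)" by simp
  then obtain t where t: "0 < t" "t < e/2" "t \<notin> bad"
    by (metis DiffE ex_in_conv finite.emptyI greaterThanLessThan_iff)
  define z where "z = y(i0 := y i0 + t)"
  have zsum: "(\<Sum>i\<in>I. g i * z i) = (\<Sum>i\<in>I. g i * y i) + t * g i0" for g
  proof -
    have "(\<Sum>i\<in>I. g i * z i) = (\<Sum>i\<in>I. g i * y i + (if i = i0 then t * g i0 else 0))"
      by (intro sum.cong) (auto simp: z_def algebra_simps)
    then show ?thesis using i0 insert.prems by (simp add: sum.distrib)
  qed
  have "(\<Sum>i\<in>I. g i * z i) \<noteq> 0" if g: "g \<in> insert l \<Lambda>" for g
  proof (cases "g i0 = 0")
    case True
    then show ?thesis using zsum[of g] g y i0 by auto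
  next
    case False
    have "t \<noteq> - (\<Sum>i\<in>I. g i * y i) / g i0" using t(3) g by (auto simp: bad_def)
    then show ?thesis using zsum[of g] False by (simp add: field_simps)
  qed
  moreover have "\<bar>z i - b i\<bar> < e" if "i \<in> I" for i
    using y(1) that t i0 unfolding z_def by (smt (verit) fun_upd_apply field_sum_of_halves)
  ultimately show ?case by blast
qed

text \<open>Vectors are perturbed one at a time. The new vector \<open>w\<close> has to leave the
  span of every set of fewer than \<open>card I\<close> earlier vectors; each such span lies in a
  hyperplane, given by a nontrivial solution of a homogeneous system, and finitely many hyperplanes
  can be avoided.\<close>

lemma general_position:
  fixes b :: "'v \<Rightarrow> 'i \<Rightarrow> real"
  assumes "finite V" "finite I" "e > 0"
  shows "\<exists>a. (\<forall>v\<in>V. \<forall>i\<in>I. \<bar>a v i - b v i\<bar> < e) \<and>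
    (\<forall>k S. S \<subseteq> V \<longrightarrow> card S \<le> card I \<longrightarrow> (\<forall>i\<in>I. (\<Sum>v\<in>S. k v * a v i) = 0) \<longrightarrow> (\<forall>v\<in>S. k v = 0))"
  using assms(1)
proof (induction V rule: finite_induct)
  case empty
  then show ?case by auto
next
  case (insert w V)
  obtain a where a: "\<forall>v\<in>V. \<forall>i\<in>I. \<bar>a v i - b v i\<bar> < e"
    and ind: "\<And>k S. S \<subseteq> V \<Longrightarrow> card S \<le> card I \<Longrightarrow> (\<forall>i\<in>I. (\<Sum>v\<in>S. k v * a v i) = 0) \<Longrightarrow> (\<forall>v\<in>S. k v = 0)"
    using insert.IH by blast
  define \<S> where "\<S> = {S. S \<subseteq> V \<and> card S < card I}"
  have finS: "finite \<S>" using insert by (simp add: \<S>_def)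
  have "\<forall>S\<in>\<S>. \<exists>l. (\<exists>i\<in>I. l i \<noteq> 0) \<and> (\<forall>v\<in>S. (\<Sum>i\<in>I. l i * a v i) = 0)"
    using homogeneous_system_nontrivial_solution[OF _ assms(2)] insert.hyps(1) finite_subset
    unfolding \<S>_def by blast
  then obtain l where l: "\<And>S. S \<in> \<S> \<Longrightarrow> \<exists>i\<in>I. l S i \<noteq> 0"
     "\<And>S v. S \<in> \<S> \<Longrightarrow> v \<in> S \<Longrightarrow> (\<Sum>i\<in>I. l S i * a v i) = 0" by metis
  obtain y where y: "\<forall>i\<in>I. \<bar>y i - b w i\<bar> < e" "\<forall>g\<in>l ` \<S>. (\<Sum>i\<in>I. g i * y i) \<noteq> 0"
    using avoid_finitely_many_functionals[of "l ` \<S>" I e "b w"] assms finS l(1) by auto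
  define a' where "a' = a(w := y)"
  have a'V: "(\<Sum>v\<in>S. k v * a' v i) = (\<Sum>v\<in>S. k v * a v i)" if "S \<subseteq> V" for S k i
    using that insert.hyps by (intro sum.cong) (auto simp: a'_def)
  have "\<forall>v\<in>S. k v = 0" if S: "S \<subseteq> insert w V" "card S \<le> card I" "\<forall>i\<in>I. (\<Sum>v\<in>S. k v * a' v i) = 0" for k S
  proof (cases "w \<in> S")
    case False
    then have "S \<subseteq> V" using S by auto
    then show ?thesis using ind[of S k] S a'V by auto
  next
    case True
    let ?S = "S - {w}"
    have fS: "finite S" using S insert.hyps(1) finite_subset by blast
    have SV: "?S \<subseteq> V" using S by auto
    have cardS: "card ?S < card S" using True fS by (intro card_Diff1_less)
    then have inS: "?S \<in> \<S>" using SV S by (simp add: \<S>_def)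
    have eq: "k w * y i + (\<Sum>v\<in>?S. k v * a v i) = 0" if "i \<in> I" for i
    proof -
      have "(\<Sum>v\<in>S. k v * a' v i) = k w * a' w i + (\<Sum>v\<in>?S. k v * a' v i)"
        using True fS by (simp add: sum.remove)
      then show ?thesis using S(3) that a'V[OF SV] by (simp add: a'_def)
    qed
    have "0 = (\<Sum>i\<in>I. l ?S i * (k w * y i + (\<Sum>v\<in>?S. k v * a v i)))" using eq by simp
    also have "\<dots> = k w * (\<Sum>i\<in>I. l ?S i * y i) + (\<Sum>i\<in>I. \<Sum>v\<in>?S. k v * (l ?S i * a v i))"
      by (simp add: distrib_left sum.distrib sum_distrib_left mult_ac)
    also have "(\<Sum>i\<in>I. \<Sum>v\<in>?S. k v * (l ?S i * a v i)) = (\<Sum>v\<in>?S. k v * (\<Sum>i\<in>I. l ?S i * a v i))"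
      by (subst sum.swap) (simp add: sum_distrib_left)
    also have "\<dots> = 0" using l(2)[OF inS] by simp
    finally have kw: "k w = 0" using y(2) inS by auto
    then have "\<forall>i\<in>I. (\<Sum>v\<in>?S. k v * a v i) = 0" using eq by auto
    then have "\<forall>v\<in>?S. k v = 0" using ind[OF SV] cardS S(2) by auto
    with kw show ?thesis by blast
  qed
  moreover have "\<forall>v\<in>insert w V. \<forall>i\<in>I. \<bar>a' v i - b v i\<bar> < e" using a y insert.hyps by (auto simp: a'_def)
  ultimately show ?case by blast
qed

text \<open>Additivity of Lebesgue measure over half-open intervals, some of which may be empty. The
  marginals of \<open>coupling\<close> and the total of the edgewise weights are both sums of this
  kind.\<close>

lemma sum_interval_lengths:
  fixes lo hi :: "'c \<Rightarrow> real"
  assumes "finite C" "a \<le> b"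
    and ex: "\<And>t. a \<le> t \<Longrightarrow> t < b \<Longrightarrow> \<exists>c\<in>C. lo c \<le> t \<and> t < hi c"
    and uniq: "\<And>t c c'. c \<in> C \<Longrightarrow> c' \<in> C \<Longrightarrow> lo c \<le> t \<Longrightarrow> t < hi c \<Longrightarrow> lo c' \<le> t \<Longrightarrow> t < hi c' \<Longrightarrow> c = c'"
    and sub: "\<And>c. c \<in> C \<Longrightarrow> lo c < hi c \<Longrightarrow> a \<le> lo c \<and> hi c \<le> b"
  shows "(\<Sum>c\<in>C. max 0 (hi c - lo c)) = b - a"
proof -
  have "{a..<b} = (\<Union>c\<in>C. {lo c..<hi c})"
    using ex sub by (fastforce simp: set_eq_iff)
  moreover have "measure lborel (\<Union>c\<in>C. {lo c..<hi c}) = (\<Sum>c\<in>C. measure lborel {lo c..<hi c})"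
  proof (intro measure_finite_Union)
    show "disjoint_family_on (\<lambda>c. {lo c..<hi c}) C"
      unfolding disjoint_family_on_def using uniq by (auto simp del: disjoint_iff simp: set_eq_iff)
    show "emeasure lborel {lo c..<hi c} \<noteq> \<infinity>" for c
      by (cases "lo c \<le> hi c") auto
  qed (use assms in auto)
  moreover have "measure lborel {lo c..<hi c} = max 0 (hi c - lo c)" for c
    by (cases "lo c \<le> hi c") (auto simp: max_def)
  moreover have "measure lborel {a..<b} = b - a" using assms(2) by simp
  ultimately show ?thesis by simp
qed

section \<open>Product triangulation and edgewise subdivision\<close>

lemma continuous_on_Max_image:
  fixes F :: "'i \<Rightarrow> 'a::topological_space \<Rightarrow> real"
  assumes "finite I" "I \<noteq> {}" "\<And>i. i \<in> I \<Longrightarrow> continuous_on S (F i)"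
  shows "continuous_on S (\<lambda>x. Max ((\<lambda>i. F i x) ` I))"
  using assms
proof (induction I rule: finite_ne_induct)
  case (singleton i)
  then show ?case by simp
next
  case (insert i I)
  then have "continuous_on S (\<lambda>x. max (F i x) (Max ((\<lambda>i. F i x) ` I)))"
    by (intro continuous_on_max) auto
  then show ?case using insert by simp
qed

lemma continuous_on_Min_image:
  fixes F :: "'i \<Rightarrow> 'a::topological_space \<Rightarrow> real"
  assumes "finite I" "I \<noteq> {}" "\<And>i. i \<in> I \<Longrightarrow> continuous_on S (F i)"
  shows "continuous_on S (\<lambda>x. Min ((\<lambda>i. F i x) ` I))"
  using assms
proof (induction I rule: finite_ne_induct)
  case (singleton i)
  then show ?case by simp
next
  case (insert i I)
  then have "continuous_on S (\<lambda>x. min (F i x) (Min ((\<lambda>i. F i x) ` I)))"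
    by (intro continuous_on_min) auto
  then show ?case using insert by simp
qed

section \<open>Points of a simplex as partitions of the unit interval\<close>

definition cum :: "(nat \<Rightarrow> real) \<Rightarrow> nat \<Rightarrow> real" where
  "cum p i = (\<Sum>v<i. p v)"

definition simplex_point :: "nat \<Rightarrow> (nat \<Rightarrow> real) \<Rightarrow> bool" where
  "simplex_point m p \<longleftrightarrow> (\<forall>v. 0 \<le> p v) \<and> (\<forall>v. p v \<noteq> 0 \<longrightarrow> v < m) \<and> (\<Sum>v<m. p v) = 1"

lemma cum_0 [simp]: "cum p 0 = 0" and cum_Suc: "cum p (Suc i) = cum p i + p i"
  by (simp_all add: cum_def)

lemma continuous_on_cum:
  "(\<And>v. continuous_on S (\<lambda>x. f x v)) \<Longrightarrow> continuous_on S (\<lambda>x. cum (f x) i)"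
  unfolding cum_def by (intro continuous_on_sum) auto

lemma simplex_point_finite_support: "simplex_point m p \<Longrightarrow> finite {v. p v \<noteq> 0}"
  by (rule finite_subset[of _ "{..<m}"]) (auto simp: simplex_point_def)

lemma cum_mono: "simplex_point m p \<Longrightarrow> i \<le> j \<Longrightarrow> cum p i \<le> cum p j"
  unfolding cum_def simplex_point_def by (intro sum_mono2) auto

lemma cum_bounds:
  assumes "simplex_point m p" shows "0 \<le> cum p i" "cum p i \<le> 1"
proof -
  show "0 \<le> cum p i" using assms by (auto simp: cum_def simplex_point_def intro: sum_nonneg)
  have "cum p i \<le> cum p (max i m)" using cum_mono[OF assms] by simp
  also have "cum p (max i m) = cum p m"
    unfolding cum_def using assms
    by (intro sum.mono_neutral_right) (auto simp: simplex_point_def)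
  also have "\<dots> = 1" using assms by (simp add: cum_def simplex_point_def)
  finally show "cum p i \<le> 1" .
qed

lemma cum_top: "simplex_point m p \<Longrightarrow> cum p m = 1"
  by (simp add: cum_def simplex_point_def)

text \<open>Cumulative sums change only at support vertices, so their nonzero values are indexed by
  the support. This later bounds the number of vertices of a subdivided simplex.\<close>

lemma cum_value: "cum p i = 0 \<or> (\<exists>v<i. p v \<noteq> 0 \<and> cum p i = cum p (Suc v))"
proof (induction i)
  case (Suc i)
  then show ?case by (cases "p i = 0") (auto simp: cum_Suc less_Suc_eq)
qed simp

lemma cum_locate:
  assumes "simplex_point m p" "0 \<le> t" "t < 1"
  shows "\<exists>v<m. cum p v \<le> t \<and> t < cum p (Suc v)"
proof -
  define v where "v = (LEAST i. t < cum p i)"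
  have ex: "t < cum p m" using cum_top assms by simp
  have v: "t < cum p v" unfolding v_def by (rule LeastI[of _ m]) (rule ex)
  have "v \<noteq> 0" using v assms by (intro notI) simp
  then obtain u where u: "v = Suc u" using not0_implies_Suc by blast
  have "\<not> t < cum p u" using not_less_Least[of u "\<lambda>i. t < cum p i"] u v_def by auto
  moreover have "v \<le> m" unfolding v_def by (rule Least_le) (rule ex)
  ultimately show ?thesis using u v by (intro exI[of _ u]) auto
qed

lemma cum_locate_unique:
  assumes "simplex_point m p" "cum p v \<le> t" "t < cum p (Suc v)" "cum p w \<le> t" "t < cum p (Suc w)"
  shows "v = w"
proof (rule ccontr)
  assume "v \<noteq> w"
  then consider "Suc v \<le> w" | "Suc w \<le> v" by linarith
  then show False using cum_mono[OF assms(1)] assms by cases fastforce+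
qed

text \<open>The common refinement of the partitions of the unit interval with cell lengths
  \<open>p\<close> and \<open>q\<close>; as a map on simplices this is the staircase triangulation
  of a product.\<close>

definition coupling :: "(nat \<Rightarrow> real) \<Rightarrow> (nat \<Rightarrow> real) \<Rightarrow> nat \<times> nat \<Rightarrow> real" where
  "coupling p q = (\<lambda>(v, w). max 0 (min (cum p (Suc v)) (cum q (Suc w)) - max (cum p v) (cum q w)))"

lemma continuous_on_coupling:
  assumes "\<And>v. continuous_on S (\<lambda>x. f x v)" "\<And>v. continuous_on S (\<lambda>x. g x v)"
  shows "continuous_on S (\<lambda>x. coupling (f x) (g x) c)"
  unfolding coupling_def case_prod_beta using assms
  by (intro continuous_intros continuous_on_max continuous_on_min continuous_on_cum) auto

lemma coupling_nonneg: "0 \<le> coupling p q c"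
  by (simp add: coupling_def case_prod_beta)

lemma coupling_pos_imp:
  assumes "simplex_point m p" "simplex_point n q" "coupling p q (v, w) \<noteq> 0"
  shows "p v \<noteq> 0" "q w \<noteq> 0"
  using assms cum_Suc[of p v] cum_Suc[of q w]
  by (auto simp: coupling_def max_def min_def split: if_splits)

lemma coupling_marginals:
  assumes "simplex_point m p" "simplex_point n q"
  shows "v < m \<Longrightarrow> (\<Sum>w<n. coupling p q (v, w)) = p v"
    and "w < n \<Longrightarrow> (\<Sum>v<m. coupling p q (v, w)) = q w"
proof -
  have gen: "(\<Sum>w<n. max 0 (min (cum p (Suc v)) (cum q (Suc w)) - max (cum p v) (cum q w))) = p v"
    if pq: "simplex_point m p" "simplex_point n q" for m n p q v
  proof -
    have "(\<Sum>w<n. max 0 (min (cum p (Suc v)) (cum q (Suc w)) - max (cum p v) (cum q w)))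
        = cum p (Suc v) - cum p v"
    proof (rule sum_interval_lengths)
      show "cum p v \<le> cum p (Suc v)" using cum_mono pq by simp
      fix t assume t: "cum p v \<le> t" "t < cum p (Suc v)"
      then have "0 \<le> t" "t < 1" using cum_bounds[OF pq(1)] by (meson order_trans less_le_trans)+
      then show "\<exists>w\<in>{..<n}. max (cum p v) (cum q w) \<le> t \<and> t < min (cum p (Suc v)) (cum q (Suc w))"
        using cum_locate[OF pq(2)] t by fastforce
    next
      fix t w w' assume "max (cum p v) (cum q w) \<le> t" "t < min (cum p (Suc v)) (cum q (Suc w))"
        "max (cum p v) (cum q w') \<le> t" "t < min (cum p (Suc v)) (cum q (Suc w'))"
      then show "w = w'" by (intro cum_locate_unique[OF pq(2), of w t w']) auto
    qed auto
    then show ?thesis by (simp add: cum_Suc)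
  qed
  show "v < m \<Longrightarrow> (\<Sum>w<n. coupling p q (v, w)) = p v"
    using gen[OF assms] by (simp add: coupling_def)
  show "w < n \<Longrightarrow> (\<Sum>v<m. coupling p q (v, w)) = q w"
    using gen[OF assms(2,1)] by (simp add: coupling_def max.commute min.commute)
qed

text \<open>Every cell of the common refinement starts where a cell of \<open>p\<close> or of
  \<open>q\<close> starts, and distinct cells start at distinct points. The starting point 0 belongs
  to both partitions, which saves one. In terms of dimension: simplices of dimensions d and e have a
  product triangulated in dimension d + e.\<close>

lemma coupling_support_card:
  assumes p: "simplex_point m p" and q: "simplex_point n q"
  shows "card {c. coupling p q c \<noteq> 0} + 1 \<le> card {v. p v \<noteq> 0} + card {w. q w \<noteq> 0}"
    and "finite {c. coupling p q c \<noteq> 0}"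
proof -
  let ?C = "{c. coupling p q c \<noteq> 0}"
  let ?A = "cum p ` {v. p v \<noteq> 0}" and ?B = "cum q ` {w. q w \<noteq> 0}"
  define left where "left = (\<lambda>(v, w). max (cum p v) (cum q w))"
  note fin = simplex_point_finite_support[OF p] simplex_point_finite_support[OF q]
  have sub: "?C \<subseteq> {v. p v \<noteq> 0} \<times> {w. q w \<noteq> 0}"
    using coupling_pos_imp[OF p q] by auto
  then show finC: "finite ?C" using fin finite_subset by blast
  have im: "left ` ?C \<subseteq> ?A \<union> ?B"
  proof
    fix t assume "t \<in> left ` ?C"
    then obtain v w where c: "coupling p q (v, w) \<noteq> 0" "t = max (cum p v) (cum q w)"
      by (auto simp: left_def)
    have "cum p v \<in> ?A" "cum q w \<in> ?B"
      using coupling_pos_imp[OF p q c(1)] by (intro imageI; simp)+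
    moreover have "t = cum p v \<or> t = cum q w" using c(2) by linarith
    ultimately show "t \<in> ?A \<union> ?B" by fast
  qed
  have inj: "inj_on left ?C"
  proof (rule inj_onI)
    fix c c' assume c: "c \<in> ?C" "c' \<in> ?C" "left c = left c'"
    obtain v w v' w' where e: "c = (v, w)" "c' = (v', w')" by (metis surj_pair)
    have *: "cum p v \<le> left c" "left c < cum p (Suc v)" "cum q w \<le> left c" "left c < cum q (Suc w)"
      using c(1) e by (auto simp: left_def coupling_def max_def min_def split: if_splits)
    have **: "cum p v' \<le> left c'" "left c' < cum p (Suc v')" "cum q w' \<le> left c'" "left c' < cum q (Suc w')"
      using c(2) e by (auto simp: left_def coupling_def max_def min_def split: if_splits)
    show "c = c'" using cum_locate_unique[OF p, of v "left c" v'] cum_locate_unique[OF q, of w "left c" w'] * ** c(3) e by simp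
  qed
  have zero: "0 \<in> cum p' ` {v. p' v \<noteq> 0}" if p': "simplex_point m' p'" for p' m'
  proof -
    obtain v where v: "cum p' v \<le> 0" "0 < cum p' (Suc v)" using cum_locate[OF p', of 0] by auto
    then have "cum p' v = 0" using cum_bounds[OF p', of v] by simp
    moreover have "p' v \<noteq> 0" using v by (auto simp: cum_Suc)
    ultimately show ?thesis by (metis (mono_tags, lifting) imageI mem_Collect_eq)
  qed
  have "card ?C = card (left ` ?C)" using inj by (simp add: card_image)
  also have "\<dots> \<le> card (?A \<union> ?B)" using im fin by (intro card_mono) auto
  finally have "card ?C \<le> card (?A \<union> ?B)" .
  moreover have "card (?A \<union> ?B) + card (?A \<inter> ?B) = card ?A + card ?B"
    using fin by (intro card_Un_Int[symmetric] finite_imageI)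
  moreover have "card (?A \<inter> ?B) \<ge> 1"
  proof -
    have "0 \<in> ?A \<inter> ?B" using zero[OF p] zero[OF q] by (rule IntI)
    moreover have "finite (?A \<inter> ?B)" using fin by (intro finite_Int disjI1 finite_imageI)
    ultimately have "card (?A \<inter> ?B) \<noteq> 0" by (metis card_0_eq empty_iff)
    then show ?thesis by linarith
  qed
  moreover have "card ?A \<le> card {v. p v \<noteq> 0}" "card ?B \<le> card {w. q w \<noteq> 0}"
    using fin by (simp_all add: card_image_le)
  ultimately show "card ?C + 1 \<le> card {v. p v \<noteq> 0} + card {w. q w \<noteq> 0}" by linarith
qed

text \<open>Edgewise subdivision: a vertex is the integer cumulative vector
  \<open>\<lambda>i. \<lfloor>r * cum p i + t\<rfloor>\<close>, and its barycentric weight at \<open>p\<close> is the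
  length of the interval of those \<open>t \<in> [0, 1)\<close> that produce it.\<close>

definition edge_lo :: "nat \<Rightarrow> nat \<Rightarrow> (nat \<Rightarrow> int) \<Rightarrow> (nat \<Rightarrow> real) \<Rightarrow> real" where
  "edge_lo m r c p = max 0 (Max ((\<lambda>i. of_int (c i) - real r * cum p i) ` {..m}))"

definition edge_hi :: "nat \<Rightarrow> nat \<Rightarrow> (nat \<Rightarrow> int) \<Rightarrow> (nat \<Rightarrow> real) \<Rightarrow> real" where
  "edge_hi m r c p = min 1 (Min ((\<lambda>i. of_int (c i) + 1 - real r * cum p i) ` {..m}))"

definition edge_weight :: "nat \<Rightarrow> nat \<Rightarrow> (nat \<Rightarrow> int) \<Rightarrow> (nat \<Rightarrow> real) \<Rightarrow> real" where
  "edge_weight m r c p = max 0 (edge_hi m r c p - edge_lo m r c p)"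

definition edge_vertices :: "nat \<Rightarrow> nat \<Rightarrow> (nat \<Rightarrow> int) set" where
  "edge_vertices m r = PiE {..m} (\<lambda>_. {0..int r})"

definition edge_label :: "nat \<Rightarrow> nat \<Rightarrow> (nat \<Rightarrow> real) \<Rightarrow> real \<Rightarrow> nat \<Rightarrow> int" where
  "edge_label m r p t = (\<lambda>i\<in>{..m}. \<lfloor>real r * cum p i + t\<rfloor>)"

lemma finite_edge_vertices: "finite (edge_vertices m r)"
  unfolding edge_vertices_def by (intro finite_PiE) auto

lemma continuous_on_edge_weight:
  assumes "\<And>v. continuous_on S (\<lambda>x. f x v)"
  shows "continuous_on S (\<lambda>x. edge_weight m r c (f x))"
  unfolding edge_weight_def edge_lo_def edge_hi_def using assms
  by (intro continuous_intros continuous_on_max continuous_on_min continuous_on_Max_image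
        continuous_on_Min_image continuous_on_cum) auto

lemma edge_interval_iff:
  "edge_lo m r c p \<le> t \<and> t < edge_hi m r c p \<longleftrightarrow>
     0 \<le> t \<and> t < 1 \<and> (\<forall>i\<le>m. c i = \<lfloor>real r * cum p i + t\<rfloor>)"
proof -
  have "edge_lo m r c p \<le> t \<longleftrightarrow> 0 \<le> t \<and> (\<forall>i\<le>m. of_int (c i) \<le> real r * cum p i + t)"
    by (auto simp: edge_lo_def algebra_simps)
  moreover have "t < edge_hi m r c p \<longleftrightarrow> t < 1 \<and> (\<forall>i\<le>m. real r * cum p i + t < of_int (c i) + 1)"
    by (auto simp: edge_hi_def algebra_simps)
  ultimately show ?thesis by (metis floor_eq_iff)
qed

lemma edge_interval_label:
  assumes "c \<in> edge_vertices m r"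
  shows "edge_lo m r c p \<le> t \<and> t < edge_hi m r c p \<longleftrightarrow> 0 \<le> t \<and> t < 1 \<and> c = edge_label m r p t"
proof -
  have "(\<forall>i\<le>m. c i = \<lfloor>real r * cum p i + t\<rfloor>) \<longleftrightarrow> c = edge_label m r p t"
    using assms unfolding edge_vertices_def edge_label_def
    by (auto simp: fun_eq_iff restrict_def PiE_def extensional_def)
  then show ?thesis using edge_interval_iff by metis
qed

lemma edge_label_in:
  assumes "simplex_point m p" "0 \<le> t" "t < 1"
  shows "edge_label m r p t \<in> edge_vertices m r"
proof -
  have "0 \<le> \<lfloor>real r * cum p i + t\<rfloor> \<and> \<lfloor>real r * cum p i + t\<rfloor> \<le> int r" for i
  proof -
    have "real r * cum p i \<le> real r * 1" using cum_bounds[OF assms(1)] by (intro mult_left_mono) auto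
    moreover have "0 \<le> real r * cum p i" using cum_bounds[OF assms(1)] by auto
    ultimately have "0 \<le> real r * cum p i + t" "real r * cum p i + t < real_of_int (int r + 1)"
      using assms by auto
    then have "\<lfloor>real r * cum p i + t\<rfloor> < int r + 1" by (simp only: floor_less_iff)
    then show ?thesis using \<open>0 \<le> real r * cum p i + t\<close> by simp
  qed
  then show ?thesis by (auto simp: edge_label_def edge_vertices_def)
qed

lemma edge_weight_sum:
  assumes "simplex_point m p"
  shows "(\<Sum>c\<in>edge_vertices m r. edge_weight m r c p) = 1"
proof -
  have "(\<Sum>c\<in>edge_vertices m r. max 0 (edge_hi m r c p - edge_lo m r c p)) = 1 - 0"
  proof (rule sum_interval_lengths)
    fix t :: real assume "0 \<le> t" "t < 1"
    then show "\<exists>c\<in>edge_vertices m r. edge_lo m r c p \<le> t \<and> t < edge_hi m r c p"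
      using edge_label_in[OF assms] edge_interval_label by blast
  next
    fix t c c' assume "c \<in> edge_vertices m r" "c' \<in> edge_vertices m r"
      "edge_lo m r c p \<le> t" "t < edge_hi m r c p" "edge_lo m r c' p \<le> t" "t < edge_hi m r c' p"
    then show "c = c'" using edge_interval_label by metis
  qed (auto simp: finite_edge_vertices edge_lo_def edge_hi_def)
  then show ?thesis by (simp add: edge_weight_def)
qed

lemma edge_weight_pos_label:
  assumes "edge_weight m r c p \<noteq> 0"
  shows "\<exists>t. t = edge_lo m r c p \<and> 0 \<le> t \<and> t < 1 \<and> (\<forall>i\<le>m. c i = \<lfloor>real r * cum p i + t\<rfloor>)"
  using assms edge_interval_iff[of m r c p "edge_lo m r c p"]
  by (auto simp: edge_weight_def max_def split: if_splits)

text \<open>While \<open>t\<close> grows from 0 to 1 the label changes only where some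
  \<open>r * cum p i + t\<close> reaches an integer, that is at \<open>t = g (cum p i)\<close>. The
  cumulative values are indexed by the support, hence so are the starts of the intervals:
  subdividing does not raise the dimension.\<close>

lemma edge_weight_support_card:
  assumes "simplex_point m p"
  shows "card {c \<in> edge_vertices m r. edge_weight m r c p \<noteq> 0} \<le> card {v. p v \<noteq> 0}"
proof -
  let ?S = "{v. p v \<noteq> 0}"
  define g where "g = (\<lambda>s. of_int \<lceil>real r * s\<rceil> - real r * s)"
  have fin: "finite ?S" using simplex_point_finite_support[OF assms] .
  have "{c \<in> edge_vertices m r. edge_weight m r c p \<noteq> 0} \<subseteq>
        (\<lambda>v. edge_label m r p (g (cum p (Suc v)))) ` ?S"
  proof
    fix c assume c: "c \<in> {c \<in> edge_vertices m r. edge_weight m r c p \<noteq> 0}"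
    then obtain t where t: "t = edge_lo m r c p" "0 \<le> t" "t < 1" "\<forall>i\<le>m. c i = \<lfloor>real r * cum p i + t\<rfloor>"
      using edge_weight_pos_label by blast
    have ct: "c = edge_label m r p t"
      using edge_interval_label[of c m r p t] edge_interval_iff[of m r c p t] t c by auto
    have "\<exists>v\<in>?S. t = g (cum p (Suc v))"
    proof -
      have "Max ((\<lambda>i. of_int (c i) - real r * cum p i) ` {..m}) \<in> (\<lambda>i. of_int (c i) - real r * cum p i) ` {..m}"
        by (intro Max_in) auto
      then obtain i where i: "i \<le> m" "t = 0 \<or> t = of_int (c i) - real r * cum p i"
        using t(1) unfolding edge_lo_def max_def by (metis (no_types, lifting) atMost_iff imageE)
      have *: "t = 0 \<or> t = g (cum p i)"
      proof (cases "t = 0")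
        case False
        then have "t = of_int (c i) - real r * cum p i" using i by simp
        then have "\<lceil>real r * cum p i\<rceil> = c i" using t(2,3) by (intro ceiling_unique) auto
        then show ?thesis using \<open>t = of_int (c i) - _\<close> by (simp add: g_def)
      qed simp
      have "t = 0 \<or> (\<exists>v\<in>?S. t = g (cum p (Suc v)))"
        using * cum_value[of p i] by (auto simp: g_def)
      \<comment> \<open>The start 0 needs no extra vertex: some support vertex has cumulative value
        1, and \<open>r\<close> is an integer, so \<open>g 1 = 0\<close>.\<close>
      moreover have "\<exists>v\<in>?S. 0 = g (cum p (Suc v))"
      proof -
        obtain v where v: "p v \<noteq> 0" "cum p (Suc v) = 1"
          using cum_value[of p m] cum_top[OF assms] by (metis zero_neq_one)
        have "0 = g (cum p (Suc v))" unfolding v(2) g_def by simp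
        then show ?thesis using v(1) by blast
      qed
      ultimately show ?thesis by auto
    qed
    then show "c \<in> (\<lambda>v. edge_label m r p (g (cum p (Suc v)))) ` ?S" using ct by auto
  qed
  then have "card {c \<in> edge_vertices m r. edge_weight m r c p \<noteq> 0} \<le>
        card ((\<lambda>v. edge_label m r p (g (cum p (Suc v)))) ` ?S)"
    using fin by (intro card_mono) auto
  also have "\<dots> \<le> card ?S" using fin by (rule card_image_le)
  finally show ?thesis .
qed

text \<open>For both points all values \<open>r * cum\<close> are within 1 of the label
  \<open>c\<close>. An entry is a difference of two cumulative values, so two points and two values
  each give the constant 4. Stars become small as \<open>r\<close> grows.\<close>

lemma edge_weight_star_small:
  assumes "edge_weight m r c p \<noteq> 0" "edge_weight m r c q \<noteq> 0" "v < m" "0 < r"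
  shows "\<bar>p v - q v\<bar> \<le> 4 / real r"
proof -
  have near: "\<bar>real r * cum p' i - of_int (c i)\<bar> \<le> 1" if p': "edge_weight m r c p' \<noteq> 0" and "i \<le> m" for p' i
  proof -
    obtain t where "0 \<le> t" "t < 1" "c i = \<lfloor>real r * cum p' i + t\<rfloor>"
      using edge_weight_pos_label[OF p'] \<open>i \<le> m\<close> by blast
    then show ?thesis by linarith
  qed
  have cl: "\<bar>real r * cum p i - of_int (c i)\<bar> \<le> 1 \<and> \<bar>real r * cum q i - of_int (c i)\<bar> \<le> 1" if "i \<le> m" for i
    using near assms(1,2) that by blast
  have "\<bar>real r * (p v - q v)\<bar> \<le> 4"
    using cl[of v] cl[of "Suc v"] assms(3) by (auto simp: cum_Suc algebra_simps)
  then have "real r * \<bar>p v - q v\<bar> \<le> 4" by (simp add: abs_mult del: right_diff_distrib)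
  then show ?thesis using assms(4) by (simp add: field_simps)
qed

section \<open>Subadditivity of the widths\<close>

text \<open>Nonemptiness gives a nonempty complex in \<open>widim_le\<close> and a proper subset in
  \<open>exists_marker\<close>; the empty space is split off in the final theorem.\<close>

locale zk_system =
  fixes X :: "'a::metric_space set" and T :: "int^'k \<Rightarrow> 'a \<Rightarrow> 'a"
  assumes system: "Zk_system X T" and nonempty: "X \<noteq> {}"
begin

lemma compact_X: "compact X"
  and continuous_on_T: "continuous_on X (T n)"
  and T_in: "x \<in> X \<Longrightarrow> T n x \<in> X"
  and T_0: "x \<in> X \<Longrightarrow> T 0 x = x"
  and T_add: "x \<in> X \<Longrightarrow> T (m + n) x = T m (T n x)"
  using system unfolding Zk_system_def by blast+

lemma continuous_on_T_comp:
  assumes "continuous_on X g" shows "continuous_on X (\<lambda>x. g (T n x))"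
  using continuous_on_compose2[OF assms continuous_on_T] T_in by blast

lemma T_inverse: "x \<in> X \<Longrightarrow> T n (T (- n) x) = x" "x \<in> X \<Longrightarrow> T (- n) (T n x) = x"
  using T_add[of x n "- n"] T_add[of x "- n" n] T_0 by simp_all

text \<open>An eps-embedding for an arbitrary set \<open>W\<close> of sites, so that windows can be
  translated and united. The diameter of a fibre is replaced by one bound
  \<open>e < \<epsilon>\<close> on the whole fibre, which is what a supremum below
  \<open>\<epsilon>\<close> amounts to, and \<open>d\<close> is only an upper bound of the
  dimension.\<close>

definition window_embedding :: "(int^'k) set \<Rightarrow> real \<Rightarrow> nat \<Rightarrow> bool" where
  "window_embedding W \<epsilon> d \<longleftrightarrow> (\<exists>K f. simplicial_cx K \<and> (\<forall>\<sigma>\<in>K. card \<sigma> \<le> d + 1) \<and>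
     (\<forall>v. continuous_on X (\<lambda>x. f x v)) \<and> (\<forall>x\<in>X. f x \<in> realization K) \<and>
     (\<forall>z\<in>X. \<exists>e<\<epsilon>. \<forall>x\<in>X. \<forall>y\<in>X. f x = f z \<longrightarrow> f y = f z \<longrightarrow> (\<forall>n\<in>W. dist (T n x) (T n y) \<le> e)))"

end

lemma realization_simplex_point:
  assumes "simplicial_cx K"
  obtains m where "\<And>p. p \<in> realization K \<Longrightarrow> simplex_point m p"
proof -
  obtain m where m: "\<Union>K \<subseteq> {..<m}"
    using assms finite_nat_bounded[of "\<Union>K"] by (auto simp: simplicial_cx_def)
  have "simplex_point m p" if p: "p \<in> realization K" for p
  proof -
    have "{v. p v \<noteq> 0} \<subseteq> {..<m}" using p m unfolding realization_def by blast
    then have "sum p {..<m} = sum p {v. p v \<noteq> 0}" by (intro sum.mono_neutral_right) auto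
    then show ?thesis using p \<open>{v. p v \<noteq> 0} \<subseteq> {..<m}\<close> unfolding simplex_point_def realization_def by auto
  qed
  then show thesis by (rule that)
qed

lemma coupling_determines:
  assumes "simplex_point m p" "simplex_point m p'" "simplex_point n q" "simplex_point n q'"
    and "coupling p q = coupling p' q'"
  shows "p = p'" "q = q'"
proof -
  show "p = p'"
  proof
    fix v show "p v = p' v"
    proof (cases "v < m")
      case True
      then show ?thesis using coupling_marginals(1)[OF assms(1,3)] coupling_marginals(1)[OF assms(2,4)] assms(5) by metis
    next
      case False
      then show ?thesis using assms(1,2) unfolding simplex_point_def by metis
    qed
  qed
  show "q = q'"
  proof
    fix v show "q v = q' v"
    proof (cases "v < n")
      case True
      then show ?thesis using coupling_marginals(2)[OF assms(1,3)] coupling_marginals(2)[OF assms(2,4)] assms(5) by metis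
    next
      case False
      then show ?thesis using assms(3,4) unfolding simplex_point_def by metis
    qed
  qed
qed

context zk_system
begin

text \<open>The pair of the two maps goes to a product of complexes, and \<open>coupling\<close>
  sends it on to the staircase triangulation. The marginals recover both maps, so fibres are
  intersections of fibres, and the support count makes the dimensions add.\<close>

lemma window_embedding_Un:
  assumes "window_embedding W1 \<epsilon> d1" "window_embedding W2 \<epsilon> d2"
  shows "window_embedding (W1 \<union> W2) \<epsilon> (d1 + d2)"
proof -
  obtain K1 f1 where K1: "simplicial_cx K1" "\<And>\<sigma>. \<sigma> \<in> K1 \<Longrightarrow> card \<sigma> \<le> d1 + 1"
     "\<And>v. continuous_on X (\<lambda>x. f1 x v)" "\<And>x. x \<in> X \<Longrightarrow> f1 x \<in> realization K1"
     and fib1: "\<And>z. z \<in> X \<Longrightarrow> \<exists>e<\<epsilon>. \<forall>x\<in>X. \<forall>y\<in>X. f1 x = f1 z \<longrightarrow> f1 y = f1 z \<longrightarrow> (\<forall>n\<in>W1. dist (T n x) (T n y) \<le> e)"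
    using assms(1) unfolding window_embedding_def by blast
  obtain K2 f2 where K2: "simplicial_cx K2" "\<And>\<sigma>. \<sigma> \<in> K2 \<Longrightarrow> card \<sigma> \<le> d2 + 1"
     "\<And>v. continuous_on X (\<lambda>x. f2 x v)" "\<And>x. x \<in> X \<Longrightarrow> f2 x \<in> realization K2"
     and fib2: "\<And>z. z \<in> X \<Longrightarrow> \<exists>e<\<epsilon>. \<forall>x\<in>X. \<forall>y\<in>X. f2 x = f2 z \<longrightarrow> f2 y = f2 z \<longrightarrow> (\<forall>n\<in>W2. dist (T n x) (T n y) \<le> e)"
    using assms(2) unfolding window_embedding_def by blast
  obtain m where m: "\<And>p. p \<in> realization K1 \<Longrightarrow> simplex_point m p"
    using realization_simplex_point[OF K1(1)] by blast
  obtain n where n: "\<And>p. p \<in> realization K2 \<Longrightarrow> simplex_point n p"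
    using realization_simplex_point[OF K2(1)] by blast
  define \<pi>1 where "\<pi>1 = fst \<circ> prod_decode"
  define \<pi>2 where "\<pi>2 = snd \<circ> prod_decode"
  \<comment> \<open>Pairs are coded as numbers. Of a staircase simplex only the cardinality is
    recorded, not its order structure; this already gives a complex of the right dimension.\<close>
  define K where "K = {\<sigma>. \<sigma> \<noteq> {} \<and> \<pi>1 ` \<sigma> \<in> K1 \<and> \<pi>2 ` \<sigma> \<in> K2 \<and> card \<sigma> \<le> d1 + d2 + 1}"
  define f where "f = (\<lambda>x c. coupling (f1 x) (f2 x) (prod_decode c))"
  have down1: "\<tau> \<in> K1" if "\<sigma> \<in> K1" "\<tau> \<subseteq> \<sigma>" "\<tau> \<noteq> {}" for \<sigma> \<tau>
    using K1(1) that unfolding simplicial_cx_def by blast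
  have down2: "\<tau> \<in> K2" if "\<sigma> \<in> K2" "\<tau> \<subseteq> \<sigma>" "\<tau> \<noteq> {}" for \<sigma> \<tau>
    using K2(1) that unfolding simplicial_cx_def by blast
  have UK: "\<Union>K \<subseteq> prod_encode ` (\<Union>K1 \<times> \<Union>K2)"
  proof
    fix c assume "c \<in> \<Union>K"
    then obtain \<sigma> where "\<sigma> \<in> K" "c \<in> \<sigma>" by blast
    then have "prod_decode c \<in> \<Union>K1 \<times> \<Union>K2"
      unfolding K_def \<pi>1_def \<pi>2_def by (auto simp: mem_Times_iff)
    then show "c \<in> prod_encode ` (\<Union>K1 \<times> \<Union>K2)" by (metis imageI prod_decode_inverse)
  qed
  have fin: "finite (\<Union>K)"
  proof (rule finite_subset[OF UK])
    have "finite (\<Union>K1)" "finite (\<Union>K2)" using K1(1) K2(1) by (simp_all add: simplicial_cx_def)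
    then show "finite (prod_encode ` (\<Union>K1 \<times> \<Union>K2))" by simp
  qed
  have "\<tau> \<in> K" if "\<sigma> \<in> K" "\<tau> \<subseteq> \<sigma>" "\<tau> \<noteq> {}" for \<sigma> \<tau>
  proof -
    have "finite \<sigma>" using fin that(1) by (meson Union_upper finite_subset)
    then have "card \<tau> \<le> card \<sigma>" using that by (simp add: card_mono)
    moreover have "\<pi>1 ` \<tau> \<in> K1" using that down1[of "\<pi>1 ` \<sigma>" "\<pi>1 ` \<tau>"] by (auto simp: K_def)
    moreover have "\<pi>2 ` \<tau> \<in> K2" using that down2[of "\<pi>2 ` \<sigma>" "\<pi>2 ` \<tau>"] by (auto simp: K_def)
    ultimately show ?thesis using that by (simp add: K_def)
  qed
  moreover have "{} \<notin> K" by (simp add: K_def)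
  ultimately have "simplicial_cx K" using fin unfolding simplicial_cx_def by simp
  moreover have "\<forall>\<sigma>\<in>K. card \<sigma> \<le> d1 + d2 + 1" by (simp add: K_def)
  moreover have "\<forall>v. continuous_on X (\<lambda>x. f x v)"
    unfolding f_def using K1(3) K2(3) by (intro allI continuous_on_coupling) auto
  moreover have "f x \<in> realization K" if x: "x \<in> X" for x
  proof -
    have p: "simplex_point m (f1 x)" and q: "simplex_point n (f2 x)" using m n K1(4) K2(4) x by auto
    let ?C = "{c. coupling (f1 x) (f2 x) c \<noteq> 0}"
    have supp: "{c. f x c \<noteq> 0} = prod_encode ` ?C"
      unfolding f_def by (auto simp: image_iff) (metis prod.collapse prod_decode_inverse)
    have finC: "finite ?C" using coupling_support_card(2)[OF p q] .
    have sub: "?C \<subseteq> {..<m} \<times> {..<n}"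
      using coupling_pos_imp[OF p q] p q unfolding simplex_point_def by fastforce
    have "sum (f x) {c. f x c \<noteq> 0} = sum (coupling (f1 x) (f2 x)) ?C"
      unfolding supp by (subst sum.reindex) (auto simp: inj_prod_encode f_def)
    also have "\<dots> = sum (coupling (f1 x) (f2 x)) ({..<m} \<times> {..<n})"
      using sub by (intro sum.mono_neutral_left) auto
    also have "\<dots> = (\<Sum>v<m. \<Sum>w<n. coupling (f1 x) (f2 x) (v, w))"
      by (simp add: sum.cartesian_product)
    also have "\<dots> = (\<Sum>v<m. f1 x v)" using coupling_marginals(1)[OF p q] by simp
    also have "\<dots> = 1" using p by (simp add: simplex_point_def)
    finally have s1: "sum (f x) {c. f x c \<noteq> 0} = 1" .
    then have ne: "{c. f x c \<noteq> 0} \<noteq> {}" by (metis sum.empty zero_neq_one)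
    have r1: "{v. f1 x v \<noteq> 0} \<in> K1" and r2: "{v. f2 x v \<noteq> 0} \<in> K2"
      using K1(4) K2(4) x unfolding realization_def by auto
    have i1: "\<pi>1 ` {c. f x c \<noteq> 0} \<subseteq> {v. f1 x v \<noteq> 0}" and i2: "\<pi>2 ` {c. f x c \<noteq> 0} \<subseteq> {v. f2 x v \<noteq> 0}"
      unfolding supp \<pi>1_def \<pi>2_def using coupling_pos_imp[OF p q] by auto
    have "card {c. f x c \<noteq> 0} + 1 \<le> (d1 + 1) + (d2 + 1)"
      using coupling_support_card(1)[OF p q] K1(2)[OF r1] K2(2)[OF r2]
      unfolding supp by (simp add: card_image inj_prod_encode)
    then have "{c. f x c \<noteq> 0} \<in> K"
      using ne down1[OF r1 i1] down2[OF r2 i2] by (simp add: K_def)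
    then show ?thesis using s1 by (simp add: realization_def f_def coupling_nonneg)
  qed
  moreover have "\<exists>e<\<epsilon>. \<forall>x\<in>X. \<forall>y\<in>X. f x = f z \<longrightarrow> f y = f z \<longrightarrow> (\<forall>n\<in>W1 \<union> W2. dist (T n x) (T n y) \<le> e)"
    if z: "z \<in> X" for z
  proof -
    obtain e1 where e1: "e1 < \<epsilon>" "\<forall>x\<in>X. \<forall>y\<in>X. f1 x = f1 z \<longrightarrow> f1 y = f1 z \<longrightarrow> (\<forall>n\<in>W1. dist (T n x) (T n y) \<le> e1)"
      using fib1[OF z] by blast
    obtain e2 where e2: "e2 < \<epsilon>" "\<forall>x\<in>X. \<forall>y\<in>X. f2 x = f2 z \<longrightarrow> f2 y = f2 z \<longrightarrow> (\<forall>n\<in>W2. dist (T n x) (T n y) \<le> e2)"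
      using fib2[OF z] by blast
    have eq: "f1 x = f1 z \<and> f2 x = f2 z" if "x \<in> X" "f x = f z" for x
    proof -
      have "coupling (f1 x) (f2 x) c = coupling (f1 z) (f2 z) c" for c
        using fun_cong[OF that(2), of "prod_encode c"] by (simp add: f_def)
      then have "coupling (f1 x) (f2 x) = coupling (f1 z) (f2 z)" by (rule ext)
      then show ?thesis using coupling_determines m n K1(4) K2(4) z that(1) by metis
    qed
    show ?thesis
    proof (intro exI[of _ "max e1 e2"] conjI ballI impI)
      show "max e1 e2 < \<epsilon>" using e1 e2 by simp
      fix x y n assume "x \<in> X" "y \<in> X" "f x = f z" "f y = f z" "n \<in> W1 \<union> W2"
      then show "dist (T n x) (T n y) \<le> max e1 e2" using e1(2) e2(2) eq[of x] eq[of y]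
        by (metis Un_iff le_max_iff_disj)
    qed
  qed
  ultimately show ?thesis unfolding window_embedding_def by (intro exI[of _ K] exI[of _ f] conjI) simp_all
qed

lemma window_embedding_empty: "window_embedding {} \<epsilon> 0"
proof -
  let ?f = "\<lambda>(x::'a) v::nat. if v = 0 then 1 else 0 :: real"
  have supp: "{v::nat. (if v = 0 then 1 else 0 :: real) \<noteq> 0} = {0}" by auto
  have "simplicial_cx {{0}}" by (auto simp: simplicial_cx_def)
  moreover have "?f x \<in> realization {{0}}" for x unfolding realization_def supp by simp
  moreover have "\<exists>e. e < \<epsilon>" by (rule exI[of _ "\<epsilon> - 1"]) simp
  ultimately show ?thesis
    unfolding window_embedding_def
    by (intro exI[of _ "{{0}}"] exI[of _ ?f]) simp
qed

lemma window_embedding_mono: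
  "window_embedding W \<epsilon> d \<Longrightarrow> W' \<subseteq> W \<Longrightarrow> \<epsilon> \<le> \<epsilon>' \<Longrightarrow> window_embedding W' \<epsilon>' d"
proof -
  assume W: "W' \<subseteq> W" "\<epsilon> \<le> \<epsilon>'" and "window_embedding W \<epsilon> d"
  then obtain K f where K: "simplicial_cx K" "\<forall>\<sigma>\<in>K. card \<sigma> \<le> d + 1"
     "\<forall>v. continuous_on X (\<lambda>x. f x v)" "\<forall>x\<in>X. f x \<in> realization K"
     and fib: "\<And>z. z \<in> X \<Longrightarrow> \<exists>e<\<epsilon>. \<forall>x\<in>X. \<forall>y\<in>X. f x = f z \<longrightarrow> f y = f z \<longrightarrow> (\<forall>n\<in>W. dist (T n x) (T n y) \<le> e)"
    unfolding window_embedding_def by blast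
  have "\<exists>e<\<epsilon>'. \<forall>x\<in>X. \<forall>y\<in>X. f x = f z \<longrightarrow> f y = f z \<longrightarrow> (\<forall>n\<in>W'. dist (T n x) (T n y) \<le> e)"
    if "z \<in> X" for z
  proof -
    obtain e where "e < \<epsilon>" "\<forall>x\<in>X. \<forall>y\<in>X. f x = f z \<longrightarrow> f y = f z \<longrightarrow> (\<forall>n\<in>W. dist (T n x) (T n y) \<le> e)"
      using fib[of z] \<open>z \<in> X\<close> by blast
    then show ?thesis using W by (intro exI[of _ e]) auto
  qed
  with K show "window_embedding W' \<epsilon>' d" unfolding window_embedding_def by blast
qed

lemma window_embedding_shift:
  assumes "window_embedding W \<epsilon> d"
  shows "window_embedding ((\<lambda>n. n + a) ` W) \<epsilon> d"
proof -
  obtain K f where K: "simplicial_cx K" "\<forall>\<sigma>\<in>K. card \<sigma> \<le> d + 1"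
     "\<And>v. continuous_on X (\<lambda>x. f x v)" "\<And>x. x \<in> X \<Longrightarrow> f x \<in> realization K"
     and fib: "\<And>z. z \<in> X \<Longrightarrow> \<exists>e<\<epsilon>. \<forall>x\<in>X. \<forall>y\<in>X. f x = f z \<longrightarrow> f y = f z \<longrightarrow> (\<forall>n\<in>W. dist (T n x) (T n y) \<le> e)"
    using assms unfolding window_embedding_def by blast
  have "\<exists>e<\<epsilon>. \<forall>x\<in>X. \<forall>y\<in>X. f (T a x) = f (T a z) \<longrightarrow> f (T a y) = f (T a z) \<longrightarrow>
      (\<forall>n\<in>(\<lambda>n. n + a) ` W. dist (T n x) (T n y) \<le> e)" if z: "z \<in> X" for z
    using fib[OF T_in[OF z, of a]] T_in T_add by (auto; blast)
  then show ?thesis unfolding window_embedding_def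
    using K T_in continuous_on_T_comp[where n = a, OF K(3)]
    by (intro exI[of _ K] exI[of _ "\<lambda>x. f (T a x)"]) auto
qed

lemma window_embedding_UN:
  assumes "finite I" "\<And>i. i \<in> I \<Longrightarrow> window_embedding (W i) \<epsilon> d"
  shows "window_embedding (\<Union>i\<in>I. W i) \<epsilon> (card I * d)"
  using assms
proof (induction I rule: finite_induct)
  case empty
  then show ?case using window_embedding_empty by simp
next
  case (insert i I)
  then have "window_embedding (W i \<union> (\<Union>i\<in>I. W i)) \<epsilon> (d + card I * d)"
    by (intro window_embedding_Un) auto
  then show ?case using insert by simp
qed

lemma finite_window_modulus:
  assumes "finite W" "e > 0"
  shows "\<exists>\<delta>>0. \<forall>x\<in>X. \<forall>y\<in>X. dist x y < \<delta> \<longrightarrow> (\<forall>n\<in>W. dist (T n x) (T n y) < e)"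
  using assms(1)
proof (induction W rule: finite_induct)
  case empty
  then show ?case by (intro exI[of _ 1]) auto
next
  case (insert n W)
  then obtain \<delta> where \<delta>: "\<delta> > 0" "\<forall>x\<in>X. \<forall>y\<in>X. dist x y < \<delta> \<longrightarrow> (\<forall>n\<in>W. dist (T n x) (T n y) < e)" by blast
  have "uniformly_continuous_on X (T n)"
    using compact_uniformly_continuous continuous_on_T compact_X by blast
  then obtain \<delta>' where \<delta>': "\<delta>' > 0" "\<forall>x\<in>X. \<forall>y\<in>X. dist x y < \<delta>' \<longrightarrow> dist (T n x) (T n y) < e"
    using uniformly_continuous_onE[of X "T n" e] assms(2) dist_commute by metis
  show ?case using \<delta> \<delta>' by (intro exI[of _ "min \<delta> \<delta>'"]) auto
qed

text \<open>Normalised bump functions of a finite cover by small balls give a map to a full simplex.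
  Its purpose is that the \<open>LEAST\<close> in \<open>widim\<close> is attained.\<close>

lemma window_embedding_exists:
  assumes "finite W" "\<epsilon> > 0"
  shows "\<exists>d. window_embedding W \<epsilon> d"
proof -
  obtain \<delta> where \<delta>: "\<delta> > 0" "\<forall>x\<in>X. \<forall>y\<in>X. dist x y < \<delta> \<longrightarrow> (\<forall>n\<in>W. dist (T n x) (T n y) < \<epsilon> / 2)"
    using finite_window_modulus[OF assms(1), of "\<epsilon> / 2"] assms(2) by auto
  obtain C where C: "finite C" "X \<subseteq> (\<Union>c\<in>C. ball c (\<delta> / 2))"
    using compact_X \<delta>(1) unfolding compact_eq_totally_bounded by (meson half_gt_zero)
  define m where "m = card C"
  obtain c where c: "bij_betw c {0..<m} C" using ex_bij_betw_nat_finite[OF C(1)] m_def by blast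
  define g where "g = (\<lambda>x v. if v < m then max 0 (\<delta> / 2 - dist x (c v)) else 0)"
  define f where "f = (\<lambda>x v. g x v / (\<Sum>u<m. g x u))"
  have g0: "0 \<le> g x v" for x v by (simp add: g_def)
  have pos: "0 < (\<Sum>u<m. g x u)" if x: "x \<in> X" for x
  proof -
    obtain v where v: "v < m" "dist x (c v) < \<delta> / 2"
    proof -
      have "x \<in> (\<Union>c\<in>C. ball c (\<delta> / 2))" using C(2) x by (rule subsetD)
      then obtain a where a: "a \<in> C" "dist a x < \<delta> / 2" by auto
      then have "a \<in> c ` {0..<m}" using c by (simp add: bij_betw_def)
      then obtain v where "v < m" "a = c v" by auto
      with a that show thesis by (simp add: dist_commute)
    qed
    then show ?thesis using g0 by (intro sum_pos2[of _ v]) (auto simp: g_def)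
  qed
  define K where "K = {\<sigma>. \<sigma> \<noteq> {} \<and> \<sigma> \<subseteq> {..<m}}"
  have "simplicial_cx K" unfolding simplicial_cx_def K_def
    using finite_subset[of "\<Union>{\<sigma>. \<sigma> \<noteq> {} \<and> \<sigma> \<subseteq> {..<m}}" "{..<m}"] by auto
  moreover have "\<forall>\<sigma>\<in>K. card \<sigma> \<le> m + 1"
  proof
    fix \<sigma> assume "\<sigma> \<in> K"
    then have "card \<sigma> \<le> card {..<m}" by (intro card_mono) (auto simp: K_def)
    then show "card \<sigma> \<le> m + 1" by simp
  qed
  moreover have "continuous_on X (\<lambda>x. f x v)" for v
  proof -
    have "continuous_on X (\<lambda>x. g x u)" for u
      unfolding g_def by (cases "u < m") (auto intro!: continuous_intros continuous_on_max)
    then show ?thesis unfolding f_def using pos by (intro continuous_intros) fastforce+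
  qed
  moreover have "f x \<in> realization K" if x: "x \<in> X" for x
  proof -
    have supp: "{v. f x v \<noteq> 0} \<subseteq> {..<m}" by (auto simp: f_def g_def split: if_splits)
    then have "sum (f x) {v. f x v \<noteq> 0} = sum (f x) {..<m}" by (intro sum.mono_neutral_left) auto
    also have "\<dots> = 1" using pos[OF x] by (simp add: f_def flip: sum_divide_distrib)
    finally have s: "sum (f x) {v. f x v \<noteq> 0} = 1" .
    then have "{v. f x v \<noteq> 0} \<noteq> {}" by (metis sum.empty zero_neq_one)
    then show ?thesis using s supp g0 pos[OF x] by (simp add: realization_def K_def) (simp add: f_def)
  qed
  moreover have "\<exists>e<\<epsilon>. \<forall>x\<in>X. \<forall>y\<in>X. f x = f z \<longrightarrow> f y = f z \<longrightarrow> (\<forall>n\<in>W. dist (T n x) (T n y) \<le> e)"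
    if z: "z \<in> X" for z
  proof (intro exI[of _ "\<epsilon> / 2"] conjI ballI impI)
    show "\<epsilon> / 2 < \<epsilon>" using assms by simp
    fix x y n assume xy: "x \<in> X" "y \<in> X" "f x = f z" "f y = f z" "n \<in> W"
    obtain v where v: "f z v \<noteq> 0"
      using pos[OF z] by (metis (no_types, lifting) divide_eq_0_iff f_def less_irrefl sum.neutral)
    have "dist u (c v) < \<delta> / 2" if "f u v \<noteq> 0" for u
      using that by (auto simp: f_def g_def max_def split: if_splits)
    then have "dist x (c v) < \<delta> / 2" "dist y (c v) < \<delta> / 2" using v xy by metis+
    then have "dist x y < \<delta>" by (rule dist_triangle_half_l)
    then show "dist (T n x) (T n y) \<le> \<epsilon> / 2" using \<delta>(2) xy by (meson less_imp_le)
  qed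
  ultimately show ?thesis unfolding window_embedding_def by blast
qed

end

section \<open>Cubes, and sequences subadditive along coverings by cubes\<close>

lemma bij_betw_cube:
  "bij_betw vec_nth (cube N :: (int^'k) set) (PiE UNIV (\<lambda>_. {0..<int N}))"
  by (rule bij_betw_byWitness[where f' = vec_lambda])
     (auto simp: cube_def PiE_def extensional_def)

lemma finite_cube: "finite (cube N :: (int^'k) set)"
proof -
  have "finite (PiE UNIV (\<lambda>_::'k. {0..<int N}))" by (intro finite_PiE) auto
  then show ?thesis using bij_betw_finite[OF bij_betw_cube[where 'k = 'k, of N]] by simp
qed

lemma card_cube: "card (cube N :: (int^'k) set) = N ^ CARD('k)"
  using bij_betw_same_card[OF bij_betw_cube[where 'k = 'k, of N]] by (simp add: card_PiE)

lemma cube_nonempty: "1 \<le> N \<Longrightarrow> cube N \<noteq> {}"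
  by (auto simp: cube_def intro!: exI[of _ "0 :: int^'k"])

lemma cube_subset_translates:
  assumes "1 \<le> N" "M \<le> q * N"
  shows "cube M \<subseteq> (\<Union>b\<in>cube q. (\<lambda>n. n + int N *s b) ` cube N)"
proof
  fix n :: "int^'k" assume n: "n \<in> cube M"
  define b :: "int^'k" where "b = (\<chi> i. n $ i div int N)"
  define c :: "int^'k" where "c = (\<chi> i. n $ i mod int N)"
  have "n $ i < int q * int N" for i
  proof -
    have "n $ i < int M" using n by (simp add: cube_def)
    also have "int M \<le> int q * int N" using assms(2) by (metis of_nat_le_iff of_nat_mult)
    finally show ?thesis .
  qed
  moreover have "n $ i div int N * int N \<le> n $ i" for i
    using assms(1) by (simp flip: minus_mod_eq_div_mult)
  ultimately have "n $ i div int N * int N < int q * int N" for i by (rule le_less_trans[rotated])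
  then have "n $ i div int N < int q" for i
    by (meson mult_less_cancel_right_disj of_nat_less_0_iff order.asym)
  then have "b \<in> cube q" using n assms(1)
    by (auto simp: b_def cube_def pos_imp_zdiv_nonneg_iff)
  moreover have "c \<in> cube N" using assms(1) by (simp add: c_def cube_def)
  moreover have "n = c + int N *s b" by (simp add: vec_eq_iff b_def c_def)
  ultimately show "n \<in> (\<Union>b\<in>cube q. (\<lambda>n. n + int N *s b) ` cube N)" by blast
qed

text \<open>Fekete's argument, with the infimum as limit: a cube of side \<open>M\<close> is covered
  by \<open>(M div N + 1) ^ k\<close> cubes of side \<open>N\<close>, so the normalised value at
  \<open>M\<close> is at most \<open>(1 + N / M) ^ k\<close> times the one at \<open>N\<close>, and
  this factor tends to 1.\<close>

lemma convergent_normalised_of_cube_subadditive: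
  fixes a :: "nat \<Rightarrow> nat"
  assumes sub: "\<And>M N q. 1 \<le> N \<Longrightarrow> 1 \<le> M \<Longrightarrow> M \<le> q * N \<Longrightarrow> a M \<le> q ^ k * a N"
  shows "convergent (\<lambda>N. real (a N) / real N ^ k)"
proof -
  define x where "x = (\<lambda>N. real (a N) / real N ^ k)"
  define I where "I = Inf (x ` {1..})"
  have bdd: "bdd_below (x ` {1..})" by (intro bdd_belowI[of _ 0]) (auto simp: x_def)
  have ge: "I \<le> x N" if "1 \<le> N" for N unfolding I_def using bdd that by (intro cInf_lower) auto
  have le: "x M \<le> (1 + real N / real M) ^ k * x N" if "1 \<le> N" "1 \<le> M" for M N
  proof -
    define q where "q = M div N + 1"
    have "M \<le> q * N" using that by (simp add: q_def) (metis add.commute div_mult_mod_eq mod_less_divisor less_imp_le nat_add_left_cancel_le less_eq_Suc_le One_nat_def)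
    then have "real (a M) \<le> real (q ^ k * a N)" using sub that by (metis of_nat_le_iff)
    also have "\<dots> \<le> (real M / real N + 1) ^ k * real (a N)"
      using that of_nat_div_le_of_nat[of M N] by (auto simp: q_def intro!: mult_right_mono power_mono)
    finally have "x M \<le> (real M / real N + 1) ^ k * real (a N) / real M ^ k"
      unfolding x_def by (intro divide_right_mono) auto
    also have "\<dots> = ((real M / real N + 1) * (real N / real M)) ^ k * x N"
      using that unfolding x_def by (simp only: power_mult_distrib power_divide) simp
    also have "(real M / real N + 1) * (real N / real M) = 1 + real N / real M"
      using that by (simp add: field_simps)
    finally show ?thesis .
  qed
  have "x \<longlonglongrightarrow> I"
  proof (rule order_tendstoI)
    fix c assume "c < I"
    show "\<forall>\<^sub>F N in sequentially. c < x N"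
    proof (rule eventually_sequentiallyI)
      fix N :: nat assume "1 \<le> N"
      then show "c < x N" using ge \<open>c < I\<close> by (meson less_le_trans)
    qed
  next
    fix c assume "I < c"
    then obtain N where N: "1 \<le> N" "x N < c"
      unfolding I_def using cInf_lessD[of "x ` {1..}" c] by auto
    have "(\<lambda>M. (1 + real N / real M) ^ k * x N) \<longlonglongrightarrow> (1 + 0) ^ k * x N"
      by (intro tendsto_intros lim_const_over_n)
    then have "\<forall>\<^sub>F M in sequentially. (1 + real N / real M) ^ k * x N < c"
      using N(2) by (intro order_tendstoD) auto
    then show "\<forall>\<^sub>F M in sequentially. x M < c"
      using eventually_ge_at_top[of 1] by eventually_elim (use le N(1) in fastforce)
  qed
  then show ?thesis unfolding x_def by (rule convergentI)
qed

context zk_system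
begin

lemma dist_le_dN:
  assumes "n \<in> cube N"
  shows "dist (T n x) (T n y) \<le> dN T N x y"
  unfolding dN_def using assms finite_cube by (intro cSUP_upper) (auto intro!: bdd_above_finite)

lemma dN_le:
  assumes "1 \<le> N" "\<And>n. n \<in> cube N \<Longrightarrow> dist (T n x) (T n y) \<le> e"
  shows "dN T N x y \<le> e"
  unfolding dN_def using assms cube_nonempty by (intro cSUP_least) auto

lemma dN_le_diamN:
  assumes "1 \<le> N" "A \<subseteq> X" "x \<in> A" "y \<in> A"
  shows "dN T N x y \<le> diamN T N A"
proof -
  obtain B where B: "\<And>x y. x \<in> X \<Longrightarrow> y \<in> X \<Longrightarrow> dist x y \<le> B"
    using compact_imp_bounded[OF compact_X] unfolding bounded_any_center bounded_def
    by (metis bounded_two_points bounded_def compact_X compact_imp_bounded)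
  have "dN T N (fst p) (snd p) \<le> B" if "p \<in> A \<times> A" for p
    using that assms(1,2) T_in B by (intro dN_le) (auto simp: mem_Times_iff subset_iff)
  then have "bdd_above ((\<lambda>p. dN T N (fst p) (snd p)) ` (A \<times> A))" by (intro bdd_aboveI2)
  then have "dN T N (fst (x, y)) (snd (x, y)) \<le> (SUP p\<in>A \<times> A. dN T N (fst p) (snd p))"
    using assms by (intro cSUP_upper) auto
  then show ?thesis using assms by (auto simp: diamN_def)
qed

lemma eps_embedding_iff:
  assumes "1 \<le> N" "\<epsilon> > 0"
  shows "eps_embedding X T N \<epsilon> K f \<longleftrightarrow>
    (\<forall>v. continuous_on X (\<lambda>x. f x v)) \<and> (\<forall>x\<in>X. f x \<in> realization K) \<and>
     (\<forall>z\<in>X. \<exists>e<\<epsilon>. \<forall>x\<in>X. \<forall>y\<in>X. f x = f z \<longrightarrow> f y = f z \<longrightarrow> (\<forall>n\<in>cube N. dist (T n x) (T n y) \<le> e))"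
proof -
  have "continuous_map (top_of_set X) (realization_top K) f \<longleftrightarrow>
      (\<forall>v. continuous_on X (\<lambda>x. f x v)) \<and> (\<forall>x\<in>X. f x \<in> realization K)"
    unfolding realization_top_def continuous_map_in_subtopology continuous_map_componentwise_UNIV
    by (auto simp: continuous_map_iff_continuous)
  moreover have "(\<forall>y. diamN T N {x\<in>X. f x = y} < \<epsilon>) \<longleftrightarrow>
     (\<forall>z\<in>X. \<exists>e<\<epsilon>. \<forall>x\<in>X. \<forall>y\<in>X. f x = f z \<longrightarrow> f y = f z \<longrightarrow> (\<forall>n\<in>cube N. dist (T n x) (T n y) \<le> e))"
    (is "?L \<longleftrightarrow> ?R")
  proof
    assume L: ?L
    show ?R
    proof
      fix z assume "z \<in> X"
      let ?A = "{x\<in>X. f x = f z}"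
      have "dist (T n x) (T n y) \<le> diamN T N ?A" if "x \<in> ?A" "y \<in> ?A" "n \<in> cube N" for x y n
        using dist_le_dN[OF that(3)] dN_le_diamN[OF assms(1) _ that(1,2)]
        by (metis (no_types, lifting) mem_Collect_eq order_trans subsetI)
      then show "\<exists>e<\<epsilon>. \<forall>x\<in>X. \<forall>y\<in>X. f x = f z \<longrightarrow> f y = f z \<longrightarrow> (\<forall>n\<in>cube N. dist (T n x) (T n y) \<le> e)"
        using L by (intro exI[of _ "diamN T N ?A"]) auto
    qed
  next
    assume R: ?R
    show ?L
    proof
      fix p
      let ?A = "{x\<in>X. f x = p}"
      show "diamN T N ?A < \<epsilon>"
      proof (cases "?A = {}")
        case True
        then show ?thesis using assms by (simp only: diamN_def) simp
      next
        case False
        then obtain z where z: "z \<in> X" "f z = p" by blast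
        obtain e where e: "e < \<epsilon>" "\<forall>x\<in>X. \<forall>y\<in>X. f x = f z \<longrightarrow> f y = f z \<longrightarrow> (\<forall>n\<in>cube N. dist (T n x) (T n y) \<le> e)"
          using R z by blast
        have "(SUP p\<in>?A \<times> ?A. dN T N (fst p) (snd p)) \<le> e"
        proof (rule cSUP_least)
          show "?A \<times> ?A \<noteq> {}" using False by blast
          show "dN T N (fst u) (snd u) \<le> e" if "u \<in> ?A \<times> ?A" for u
            using that e(2) z assms(1) by (intro dN_le) (auto simp: mem_Times_iff)
        qed
        then show ?thesis using e(1) False unfolding diamN_def by (simp only: if_False)
      qed
    qed
  qed
  ultimately show ?thesis unfolding eps_embedding_def by blast
qed

lemma widim_le:
  assumes "1 \<le> N" "\<epsilon> > 0" "window_embedding (cube N) \<epsilon> d"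
  shows "widim X T N \<epsilon> \<le> d"
proof -
  obtain K f where K: "simplicial_cx K" "\<forall>\<sigma>\<in>K. card \<sigma> \<le> d + 1" "eps_embedding X T N \<epsilon> K f"
    using assms(3) unfolding window_embedding_def eps_embedding_iff[OF assms(1,2)] by blast
  have "K \<noteq> {}" using K(3) nonempty unfolding eps_embedding_iff[OF assms(1,2)] realization_def by blast
  moreover have "finite K" using K(1) unfolding simplicial_cx_def by (meson finite_UnionD)
  ultimately have "cx_dim K \<le> d" using K(2) by (simp add: cx_dim_def le_diff_conv)
  moreover have "widim X T N \<epsilon> \<le> cx_dim K" unfolding widim_def using K by (intro Least_le) blast
  ultimately show ?thesis by simp
qed

lemma window_embedding_widim:
  assumes "1 \<le> N" "\<epsilon> > 0"
  shows "window_embedding (cube N) \<epsilon> (widim X T N \<epsilon>)"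
proof -
  obtain d where "window_embedding (cube N) \<epsilon> d"
    using window_embedding_exists[OF finite_cube assms(2)] by blast
  then have "\<exists>d K f. simplicial_cx K \<and> eps_embedding X T N \<epsilon> K f \<and> cx_dim K = d"
    unfolding window_embedding_def eps_embedding_iff[OF assms] by blast
  from LeastI_ex[OF this] obtain K f where K: "simplicial_cx K" "eps_embedding X T N \<epsilon> K f"
      "cx_dim K = widim X T N \<epsilon>"
    unfolding widim_def by blast
  have "finite K" using K(1) unfolding simplicial_cx_def by (meson finite_UnionD)
  then have "card \<sigma> \<le> widim X T N \<epsilon> + 1" if "\<sigma> \<in> K" for \<sigma>
  proof -
    have "card \<sigma> \<le> Max (card ` K)" using \<open>finite K\<close> that by simp
    then show ?thesis using K(3) that by (auto simp: cx_dim_def split: if_splits)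
  qed
  then show ?thesis
    using K(1,2) unfolding window_embedding_def eps_embedding_iff[OF assms] by blast
qed

lemma widim_subadditive:
  assumes "1 \<le> N" "1 \<le> M" "M \<le> q * N" "\<epsilon> > 0"
  shows "widim X T M \<epsilon> \<le> q ^ CARD('k) * widim X T N \<epsilon>"
proof -
  have "window_embedding (\<Union>b\<in>cube q. (\<lambda>n. n + int N *s b) ` cube N) \<epsilon> (card (cube q :: (int^'k) set) * widim X T N \<epsilon>)"
    using window_embedding_widim[OF assms(1,4)]
    by (intro window_embedding_UN window_embedding_shift finite_cube) auto
  then have "window_embedding (cube M) \<epsilon> (q ^ CARD('k) * widim X T N \<epsilon>)"
    unfolding card_cube using window_embedding_mono[OF _ cube_subset_translates[OF assms(1,3)] order_refl] by blast
  then show ?thesis by (rule widim_le[OF assms(2,4)])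
qed

lemma widim_antimono:
  assumes "1 \<le> N" "0 < \<epsilon>" "\<epsilon> \<le> \<epsilon>'"
  shows "widim X T N \<epsilon>' \<le> widim X T N \<epsilon>"
  using window_embedding_mono[OF window_embedding_widim[OF assms(1,2)] order_refl assms(3)] assms
  by (intro widim_le) auto

lemma widim_limit:
  assumes "\<epsilon> > 0"
  shows "(\<lambda>N. real (widim X T N \<epsilon>) / real N ^ CARD('k)) \<longlonglongrightarrow> lim (\<lambda>N. real (widim X T N \<epsilon>) / real N ^ CARD('k))"
  using convergent_normalised_of_cube_subadditive[of "\<lambda>N. widim X T N \<epsilon>"] widim_subadditive assms
  by (simp add: convergent_LIMSEQ_iff)

text \<open>\<open>Lim\<close> is meaningful only where the limit exists. The inner limits do not
  decrease as \<open>\<epsilon>\<close> decreases, so the limit from the right at 0 is their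
  supremum.\<close>

lemma widim_limit_le_mdim:
  assumes "\<epsilon> > 0"
  shows "ereal (lim (\<lambda>N. real (widim X T N \<epsilon>) / real N ^ CARD('k))) \<le> mdim X T"
proof -
  define g where "g = (\<lambda>\<epsilon>::real. ereal (lim (\<lambda>N. real (widim X T N \<epsilon>) / real N ^ CARD('k))))"
  have mono: "g e' \<le> g e" if "0 < e" "e \<le> e'" for e e'
  proof -
    have "lim (\<lambda>N. real (widim X T N e') / real N ^ CARD('k)) \<le> lim (\<lambda>N. real (widim X T N e) / real N ^ CARD('k))"
      by (rule LIMSEQ_le[OF widim_limit widim_limit])
         (use that widim_antimono in \<open>auto intro!: exI[of _ 1] divide_right_mono\<close>)
    then show ?thesis by (simp add: g_def)
  qed
  define s where "s = (SUP e\<in>{0<..}. g e)"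
  have "(g \<longlongrightarrow> s) (at_right 0)"
  proof (rule order_tendstoI)
    fix a assume "a < s"
    then obtain e where e: "e > 0" "a < g e" unfolding s_def less_SUP_iff by auto
    then have "a < g e'" if "0 < e'" "e' < e" for e' using mono[of e' e] that by (simp add: order_less_le_trans)
    then show "\<forall>\<^sub>F e in at_right 0. a < g e" using e(1) unfolding eventually_at_right_field by auto
  next
    fix a assume "s < a"
    moreover have "g e \<le> s" if "e > 0" for e unfolding s_def using that by (intro SUP_upper) auto
    ultimately have "g e < a" if "e > 0" for e using that by (meson order_le_less_trans)
    then show "\<forall>\<^sub>F e in at_right 0. g e < a" unfolding eventually_at_right_field by (auto intro!: exI[of _ 1])
  qed
  then have "mdim X T = s" unfolding mdim_def g_def by (intro tendsto_Lim) auto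
  moreover have "g \<epsilon> \<le> s" unfolding s_def using assms by (intro SUP_upper) auto
  ultimately show ?thesis by (simp add: g_def)
qed

text \<open>After division by \<open>N ^ k\<close> the extra 1 and the loss of \<open>N - 1\<close>
  against \<open>N\<close> vanish in the limit, so the strict inequality leaves room for both. The
  condition \<open>N \<ge> 2\<close> keeps the pixel side positive.\<close>

lemma widim_small:
  assumes "mdim X T < ereal (real D / 4)" "\<epsilon> > 0"
  shows "\<exists>N\<ge>2. 4 * (widim X T N \<epsilon> + 1) \<le> D * (N - 1) ^ CARD('k)"
proof -
  let ?k = "CARD('k)"
  define l where "l = lim (\<lambda>N. real (widim X T N \<epsilon>) / real N ^ ?k)"
  have "ereal l < ereal (real D / 4)"
    using order_le_less_trans[OF widim_limit_le_mdim[OF assms(2)] assms(1)] unfolding l_def .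
  then have l: "4 * l < real D" by simp
  have "(\<lambda>N. 4 * (real (widim X T N \<epsilon>) / real N ^ ?k) + 4 * (1 / real N) ^ ?k - real D * (1 - 1 / real N) ^ ?k)
      \<longlonglongrightarrow> 4 * l + 4 * 0 ^ ?k - real D * (1 - 0) ^ ?k"
    unfolding l_def using assms(2) by (intro tendsto_intros widim_limit lim_1_over_n)
  then have "\<forall>\<^sub>F N in sequentially. 4 * (real (widim X T N \<epsilon>) / real N ^ ?k) + 4 * (1 / real N) ^ ?k - real D * (1 - 1 / real N) ^ ?k < 0"
    using l by (intro order_tendstoD(2)) (auto simp: power_0_left)
  then have "\<forall>\<^sub>F N in sequentially. 2 \<le> N \<and> 4 * (real (widim X T N \<epsilon>) / real N ^ ?k) + 4 * (1 / real N) ^ ?k - real D * (1 - 1 / real N) ^ ?k < 0"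
    using eventually_ge_at_top[of 2] by eventually_elim auto
  then obtain N where N: "2 \<le> N" "4 * (real (widim X T N \<epsilon>) / real N ^ ?k) + 4 * (1 / real N) ^ ?k - real D * (1 - 1 / real N) ^ ?k < 0"
    by (metis (mono_tags, lifting) eventually_happens' sequentially_bot)
  have "1 - 1 / real N = real (N - 1) / real N" using N(1) by (simp add: of_nat_diff field_simps)
  then have "(4 * real (widim X T N \<epsilon>) + 4 - real D * real (N - 1) ^ ?k) / real N ^ ?k < 0"
    using N(2) by (simp add: power_divide diff_divide_distrib add_divide_distrib)
  then have "4 * real (widim X T N \<epsilon>) + 4 < real D * real (N - 1) ^ ?k"
    using N(1) by (simp add: divide_less_0_iff)
  then have "real (4 * (widim X T N \<epsilon> + 1)) < real (D * (N - 1) ^ ?k)" by simp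
  then show ?thesis using N(1) by (metis less_imp_le of_nat_less_iff)
qed

end

section \<open>A single function whose orbit determines markers of every scale\<close>

definition int_box :: "nat \<Rightarrow> (int^'k) set" where
  "int_box r = {n. \<forall>i. \<bar>n $ i\<bar> \<le> int r}"

lemma finite_int_box: "finite (int_box r :: (int^'k) set)"
proof -
  have "inj_on vec_nth (int_box r :: (int^'k) set)" by (auto simp: inj_on_def vec_nth_inject)
  moreover have "vec_nth ` (int_box r :: (int^'k) set) \<subseteq> PiE UNIV (\<lambda>_. {- int r..int r})"
    by (auto simp: int_box_def abs_le_iff minus_le_iff)
  moreover have "finite (PiE UNIV (\<lambda>_::'k. {- int r..int r}))" by (intro finite_PiE) auto
  ultimately show ?thesis by (meson finite_imageD finite_subset)
qed

lemma int_box_mono: "r \<le> s \<Longrightarrow> int_box r \<subseteq> int_box s"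
proof
  fix n :: "int^'k" assume "r \<le> s" "n \<in> int_box r"
  then have "\<bar>n $ i\<bar> \<le> int r" "int r \<le> int s" for i by (simp_all add: int_box_def)
  then have "\<bar>n $ i\<bar> \<le> int s" for i by (rule order_trans)
  then show "n \<in> int_box s" by (simp add: int_box_def)
qed

lemma int_box_diff: "m \<in> int_box r \<Longrightarrow> n \<in> int_box s \<Longrightarrow> m - n \<in> int_box (r + s)"
proof -
  assume "m \<in> int_box r" "n \<in> int_box s"
  then have "\<bar>m $ i - n $ i\<bar> \<le> int r + int s" for i
    unfolding int_box_def by (intro order_trans[OF abs_triangle_ineq4] add_mono) simp_all
  then show ?thesis by (simp add: int_box_def)
qed

lemma int_box_UNIV: "\<exists>r. (n :: int^'k) \<in> int_box r"
proof (intro exI)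
  have "\<bar>n $ i\<bar> \<le> (\<Sum>i\<in>UNIV. \<bar>n $ i\<bar>)" for i by (intro member_le_sum) auto
  then show "n \<in> int_box (nat (\<Sum>i\<in>UNIV. \<bar>n $ i\<bar>))" by (auto simp: int_box_def sum_nonneg)
qed

lemma compact_increasing_open_cover:
  fixes A :: "nat \<Rightarrow> 'b::metric_space set"
  assumes "compact S" "\<And>m. openin (top_of_set S) (A m)" "\<And>m m'. m \<le> m' \<Longrightarrow> A m \<subseteq> A m'" "S \<subseteq> (\<Union>m. A m)"
  shows "\<exists>m. S \<subseteq> A m"
proof -
  have "\<exists>D\<subseteq>range A. finite D \<and> S \<subseteq> \<Union>D"
    using assms(1,2,4) unfolding compact_eq_openin_cover by (metis (no_types, lifting) imageE)
  then obtain I where I: "finite I" "S \<subseteq> \<Union>(A ` I)" by (metis finite_subset_image)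
  have "A i \<subseteq> A (Max (insert 0 I))" if "i \<in> I" for i using I(1) that by (intro assms(3)) simp
  with I(2) show ?thesis by (intro exI[of _ "Max (insert 0 I)"]) blast
qed

text \<open>One number \<open>m\<close> serves as the radius of the box and, inverted, as the lower
  bound; the resulting open sets increase with \<open>m\<close>. This is the tool that turns
  separation somewhere on an orbit into separation by a definite amount on a finite window.\<close>

lemma compact_uniformly_positive:
  fixes G :: "int^'k \<Rightarrow> 'b::metric_space \<Rightarrow> real"
  assumes "compact S" "\<And>n. continuous_on S (G n)" "\<And>x. x \<in> S \<Longrightarrow> \<exists>n. G n x > 0"
  shows "\<exists>m. \<forall>x\<in>S. \<exists>n\<in>int_box m. G n x > 1 / (real m + 1)"
proof -
  define A where "A = (\<lambda>m. \<Union>n\<in>int_box m. S \<inter> G n -` {1 / (real m + 1)<..})"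
  have "\<exists>m. S \<subseteq> A m"
  proof (rule compact_increasing_open_cover[OF assms(1)])
    show "openin (top_of_set S) (A m)" for m
      unfolding A_def using assms(2)
      by (intro openin_Union) (auto simp del: vimage_UN intro!: continuous_openin_preimage_gen)
    show "A m \<subseteq> A m'" if "m \<le> m'" for m m'
    proof
      fix x assume "x \<in> A m"
      then obtain n where n: "n \<in> int_box m" "x \<in> S" "G n x > 1 / (real m + 1)" by (auto simp: A_def)
      have "1 / (real m' + 1) \<le> 1 / (real m + 1)" using that by (intro divide_left_mono) auto
      then show "x \<in> A m'" using n int_box_mono[OF that] unfolding A_def by fastforce
    qed
    show "S \<subseteq> (\<Union>m. A m)"
    proof
      fix x assume x: "x \<in> S"
      then obtain n where n: "G n x > 0" using assms(3) by blast
      obtain r where r: "n \<in> int_box r" using int_box_UNIV by blast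
      obtain p :: nat where p: "1 / G n x < real p" using reals_Archimedean2 by blast
      have "1 / G n x < real (max r p) + 1" using p by linarith
      then have "1 / (real (max r p) + 1) < G n x" using n by (simp add: field_simps)
      moreover have "n \<in> int_box (max r p)" using r int_box_mono[of r "max r p"] by auto
      ultimately have "x \<in> A (max r p)" using x by (auto simp: A_def)
      then show "x \<in> (\<Union>m. A m)" by blast
    qed
  qed
  then show ?thesis unfolding A_def by blast
qed

context zk_system
begin

text \<open>Separation is asked of the support, density of the level set 1. The range between the
  two is what allows markers to fade out continuously.\<close>

definition marker :: "nat \<Rightarrow> nat \<Rightarrow> ('a \<Rightarrow> real) \<Rightarrow> bool" where
  "marker R M \<phi> \<longleftrightarrow> continuous_on X \<phi> \<and> (\<forall>x\<in>X. 0 \<le> \<phi> x \<and> \<phi> x \<le> 1) \<and>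
     (\<forall>x\<in>X. \<forall>n\<in>int_box R. \<phi> x \<noteq> 0 \<longrightarrow> \<phi> (T n x) \<noteq> 0 \<longrightarrow> n = 0) \<and>
     (\<forall>x\<in>X. \<exists>n\<in>int_box M. \<phi> (T n x) = 1)"

lemma marker_separated:
  assumes "marker R M \<phi>" "x \<in> X" "\<phi> (T m x) \<noteq> 0" "\<phi> (T n x) \<noteq> 0" "n - m \<in> int_box R"
  shows "n = m"
proof -
  have "T n x = T (n - m) (T m x)" using T_add[OF assms(2), of "n - m" m] by simp
  then have "n - m = 0" using assms T_in unfolding marker_def by metis
  then show ?thesis by simp
qed

lemma exists_marker:
  assumes "marker_property X T"
  shows "\<exists>M \<phi>. marker R M \<phi>"
proof -
  obtain U where U: "openin (top_of_set X) U" "X = (\<Union>n. T n ` U)"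
     and sep: "\<And>n. n \<in> int_box (R + 1) \<Longrightarrow> n \<noteq> 0 \<Longrightarrow> U \<inter> T n ` U = {}"
  proof -
    have "finite (int_box (R + 1) :: (int^'k) set)" by (rule finite_int_box)
    then have "\<exists>U. openin (top_of_set X) U \<and> X = (\<Union>n. T n ` U) \<and> (\<forall>n\<in>int_box (R + 1). n \<noteq> 0 \<longrightarrow> U \<inter> T n ` U = {})"
      using assms unfolding marker_property_def by metis
    then show thesis using that by metis
  qed
  have UX: "U \<subseteq> X" using U(1) by (simp add: openin_imp_subset)
  \<comment> \<open>The radius \<open>R + 1\<close> guarantees a nonzero vector in the box even for
    \<open>R = 0\<close>, and this vector shows \<open>U \<noteq> X\<close>. Otherwise the distance
    to the empty complement would be 0 everywhere by convention.\<close>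
  have one: "(1 :: int^'k) \<in> int_box (R + 1)" "(1 :: int^'k) \<noteq> 0" by (auto simp: int_box_def)
  have "X - U \<noteq> {}"
  proof
    assume "X - U = {}"
    then have "U = X" using UX by blast
    moreover obtain x where "x \<in> X" using nonempty by blast
    ultimately show False using sep[OF one] T_in by blast
  qed
  moreover have "closed (X - U)"
    using U(1) compact_imp_closed[OF compact_X] closedin_closed_trans
    by (metis closedin_diff closedin_topspace topspace_euclidean_subtopology)
  ultimately have inf0: "infdist x (X - U) = 0 \<longleftrightarrow> x \<in> X - U" for x
    using in_closed_iff_infdist_zero by metis
  define depth where "depth = (\<lambda>x. infdist x (X - U))"
  have depth_nonneg: "depth x \<ge> 0" for x by (simp add: depth_def infdist_nonneg)
  have depth_iff: "depth x \<noteq> 0 \<Longrightarrow> x \<in> X \<Longrightarrow> x \<in> U" "x \<in> U \<Longrightarrow> depth x > 0" for x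
    using inf0[of x] depth_nonneg[of x] by (auto simp: depth_def)
  have cont: "continuous_on X depth" unfolding depth_def by (intro continuous_intros)
  have "\<exists>m. \<forall>x\<in>X. \<exists>n\<in>int_box m. depth (T n x) > 1 / (real m + 1)"
  proof (rule compact_uniformly_positive[OF compact_X])
    show "continuous_on X (\<lambda>x. depth (T n x))" for n using continuous_on_T_comp[OF cont] .
    fix x assume "x \<in> X"
    then obtain n u where u: "u \<in> U" "x = T n u" using U(2) by blast
    then have "T (- n) x = u" using T_inverse UX by auto
    then show "\<exists>n. 0 < depth (T n x)" using depth_iff u by metis
  qed
  then obtain m where m: "\<forall>x\<in>X. \<exists>n\<in>int_box m. depth (T n x) > 1 / (real m + 1)" by blast
  \<comment> \<open>The factor \<open>m + 1\<close> lifts a depth above \<open>1 / (m + 1)\<close>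
    to the level 1, and truncation leaves the support inside \<open>U\<close>.\<close>
  define \<phi> where "\<phi> = (\<lambda>x. min 1 ((real m + 1) * depth x))"
  have \<phi>U: "x \<in> U" if "\<phi> x \<noteq> 0" "x \<in> X" for x    using that depth_iff(1) by (cases "depth x = 0") (simp_all add: \<phi>_def)
  have "marker R m \<phi>"
    unfolding marker_def
  proof (intro conjI ballI impI)
    show "continuous_on X \<phi>" unfolding \<phi>_def using cont by (intro continuous_intros continuous_on_min)
    show "0 \<le> \<phi> x" "\<phi> x \<le> 1" for x using depth_nonneg by (auto simp: \<phi>_def)
    show "n = 0" if "x \<in> X" "n \<in> int_box R" "\<phi> x \<noteq> 0" "\<phi> (T n x) \<noteq> 0" for x n
      using sep[of n] \<phi>U[of x] \<phi>U[of "T n x"] that T_in int_box_mono[of R "R + 1"] by auto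
    fix x assume "x \<in> X"
    then obtain n where "n \<in> int_box m" "depth (T n x) > 1 / (real m + 1)" using m by blast
    then show "\<exists>n\<in>int_box m. \<phi> (T n x) = 1"
      by (intro bexI[of _ n]) (auto simp: \<phi>_def field_simps)
  qed
  then show ?thesis by blast
qed

end

section \<open>Ramps of all scales superposed in one function\<close>

lemma suminf_dominant_term_nonzero:
  fixes a :: "nat \<Rightarrow> real"
  assumes "\<And>l. l < j \<Longrightarrow> a l = 0" "\<bar>a j\<bar> \<ge> B" "B > 0"
    and tail: "\<And>t. \<bar>a (t + Suc j)\<bar> \<le> B * (1 / 5) ^ Suc t"
  shows "suminf a \<noteq> 0"
proof -
  have geo: "(\<lambda>t. B * (1 / 5 :: real) ^ Suc t) sums (B / 4)"
    using sums_mult[OF geometric_sums[of "1 / 5 :: real"], of "B / 5"] by simp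
  have "summable (\<lambda>t. a (t + Suc j))"
    by (rule summable_comparison_test'[OF sums_summable[OF geo], of 0]) (simp only: real_norm_def tail)
  then have sm: "summable a" using summable_iff_shift by blast
  have "suminf a = (\<Sum>t. a (t + Suc j)) + (\<Sum>l<Suc j. a l)" by (rule suminf_split_initial_segment[OF sm])
  also have "(\<Sum>l<Suc j. a l) = a j" using assms(1) by simp
  finally have eq: "suminf a = (\<Sum>t. a (t + Suc j)) + a j" .
  have "norm (\<Sum>t. a (t + Suc j)) \<le> B / 4"
    using norm_suminf_le[of "\<lambda>t. a (t + Suc j)", OF _ sums_summable[OF geo]] tail
    unfolding sums_unique[OF geo, symmetric] by (simp only: real_norm_def)
  then show ?thesis using eq assms(2,3) by (auto simp: abs_if split: if_splits)
qed

text \<open>\<open>undefined\<close> is an arbitrary but fixed coordinate: all ramps are written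
  along the same axis.\<close>

definition ray :: "int \<Rightarrow> int^'k" where "ray s = axis undefined s"

lemma ray_add: "ray (s + t) = ray s + ray t" and ray_0 [simp]: "ray 0 = 0"
  and ray_diff: "ray (s - t) = ray s - ray t"
  and ray_inj: "ray s = ray t \<longleftrightarrow> s = t"
  by (auto simp: ray_def axis_def vec_eq_iff)

lemma ray_in_box: "\<bar>s\<bar> \<le> int r \<Longrightarrow> ray s \<in> int_box r"
  by (auto simp: ray_def axis_def int_box_def)

text \<open>With separation \<open>25 * 5 ^ j\<close>, an interval of the ray of length
  \<open>6 * 5 ^ j\<close> contains at most one marker of scale \<open>j\<close>: five blocks of
  length \<open>5 ^ j\<close>, and one more for ramps that begin before them.\<close>

locale marker_tower = zk_system X T for X :: "'a::metric_space set" and T :: "int^'k \<Rightarrow> 'a \<Rightarrow> 'a" +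
  fixes \<phi> :: "nat \<Rightarrow> 'a \<Rightarrow> real" and M :: "nat \<Rightarrow> nat"
  assumes marker: "marker (5 ^ (j + 2)) (M j) (\<phi> j)"
begin

text \<open>Behind a marker of value 1 the heights \<open>(s + 1) / 5 ^ j\<close> are positive and
  pairwise distinct, so the value at a site reveals the distance to the marker.\<close>

definition layer :: "nat \<Rightarrow> 'a \<Rightarrow> real" where
  "layer j x = (\<Sum>s<5 ^ j. (real s + 1) / 5 ^ j * \<phi> j (T (ray (- int s)) x))"

text \<open>Heights in a ramp of scale \<open>j\<close> differ by at least \<open>5 ^ -j\<close>,
  which the weight turns into \<open>5 ^ -(j^2 + 2j + 1)\<close>. Layer \<open>j + 1\<close> is
  bounded by \<open>5 ^ (j + 1)\<close> and contributes at most \<open>5 ^ -(j^2 + 2j + 2)\<close>.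
  The quadratic exponent keeps all later layers together below one such difference.\<close>

definition code :: "'a \<Rightarrow> real" where
  "code x = (\<Sum>j. (1 / 5) ^ (j * j + j + 1) * layer j x)"

lemma marker_bounds: "x \<in> X \<Longrightarrow> 0 \<le> \<phi> j x" "x \<in> X \<Longrightarrow> \<phi> j x \<le> 1"
  using marker unfolding marker_def by blast+

lemma layer_bounds:
  assumes "x \<in> X" shows "0 \<le> layer j x" "layer j x \<le> 5 ^ j"
proof -
  show "0 \<le> layer j x" unfolding layer_def
    using assms T_in marker_bounds by (intro sum_nonneg mult_nonneg_nonneg) auto
  have "layer j x \<le> (\<Sum>s<(5::nat) ^ j. 1)" unfolding layer_def
  proof (intro sum_mono mult_le_one)
    fix s assume "s \<in> {..<(5::nat) ^ j}"
    then have "Suc s \<le> 5 ^ j" by simp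
    then have "real s + 1 \<le> 5 ^ j" by (metis of_nat_Suc of_nat_le_iff of_nat_numeral of_nat_power add.commute)
    then show "(real s + 1) / 5 ^ j \<le> 1" by simp
  qed (use assms T_in marker_bounds in auto)
  then show "layer j x \<le> 5 ^ j" by simp
qed

lemma layer_term_bound:
  assumes "x \<in> X"
  shows "\<bar>(1 / 5) ^ (j * j + j + 1) * layer j x\<bar> \<le> (1 / 5) ^ Suc j"
proof -
  have "\<bar>(1 / 5) ^ (j * j + j + 1) * layer j x\<bar> \<le> (1 / 5) ^ (j * j + j + 1) * 5 ^ j"
    using layer_bounds[OF assms, of j] by (simp add: abs_mult)
  also have "\<dots> = (1 / 5) ^ (j * j + 1)" by (simp add: power_add power_divide)
  also have "\<dots> \<le> (1 / 5) ^ Suc j" by (intro power_decreasing) auto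
  finally show ?thesis .
qed

lemma geometric_fifth: "(\<lambda>j. (1 / 5 :: real) ^ Suc j) sums (1 / 4)"
  using sums_mult[OF geometric_sums[of "1 / 5 :: real"], of "1 / 5"] by simp

lemma summable_layers:
  assumes "x \<in> X" shows "summable (\<lambda>j. (1 / 5) ^ (j * j + j + 1) * layer j x)"
  by (rule summable_comparison_test'[OF sums_summable[OF geometric_fifth], of 0])
     (simp only: real_norm_def layer_term_bound[OF assms])

lemma continuous_on_layer: "continuous_on X (layer j)"
proof -
  have "continuous_on X (\<phi> j)" using marker unfolding marker_def by blast
  then show ?thesis unfolding layer_def by (intro continuous_intros continuous_on_T_comp)
qed

lemma continuous_on_code: "continuous_on X code"
proof -
  have "uniform_limit X (\<lambda>n x. \<Sum>j<n. (1 / 5) ^ (j * j + j + 1) * layer j x) code sequentially"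
    unfolding code_def
    by (rule Weierstrass_m_test[OF _ sums_summable[OF geometric_fifth]])
       (simp only: real_norm_def layer_term_bound)
  then show ?thesis
    by (rule uniform_limit_theorem[rotated])
       (auto intro!: always_eventually continuous_intros continuous_on_layer)
qed

lemma code_bounds:
  assumes "x \<in> X" shows "0 \<le> code x" "code x \<le> 1"
proof -
  show "0 \<le> code x" unfolding code_def using layer_bounds[OF assms]
    by (intro suminf_nonneg summable_layers[OF assms]) auto
  have "code x \<le> (\<Sum>j. (1 / 5) ^ Suc j)" unfolding code_def
    by (rule suminf_le[OF _ summable_layers[OF assms] sums_summable[OF geometric_fifth]])
       (rule order_trans[OF abs_ge_self layer_term_bound[OF assms]])
  then show "code x \<le> 1" unfolding sums_unique[OF geometric_fifth, symmetric] by linarith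
qed

lemma layer_nonzero:
  assumes "x \<in> X" "layer j (T (ray s) x) \<noteq> 0"
  shows "\<exists>t. t \<le> s \<and> s < t + 5 ^ j \<and> \<phi> j (T (ray t) x) \<noteq> 0"
proof -
  obtain s' where s': "s' < 5 ^ j" "\<phi> j (T (ray (- int s')) (T (ray s) x)) \<noteq> 0"
    using assms(2) unfolding layer_def by (metis (no_types, lifting) lessThan_iff mult_zero_right sum.neutral)
  have "T (ray (- int s')) (T (ray s) x) = T (ray (s - int s')) x"
    using T_add[OF assms(1), of "ray (- int s')" "ray s"] by (simp flip: ray_add)
  moreover have "int s' < 5 ^ j" using s'(1) by (metis of_nat_less_iff of_nat_numeral of_nat_power)
  ultimately show ?thesis using s'(2) by (intro exI[of _ "s - int s'"]) auto
qed

lemma markers_on_ray_sparse: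
  assumes "x \<in> X"
  shows "\<exists>t0. \<forall>t. a - 5 ^ j < t \<and> t < a + 5 * 5 ^ j \<and> \<phi> j (T (ray t) x) \<noteq> 0 \<longrightarrow> t = t0"
proof (cases "\<exists>t. a - 5 ^ j < t \<and> t < a + 5 * 5 ^ j \<and> \<phi> j (T (ray t) x) \<noteq> 0")
  case True
  then obtain t0 where t0: "a - 5 ^ j < t0" "t0 < a + 5 * 5 ^ j" "\<phi> j (T (ray t0) x) \<noteq> 0" by blast
  have "t = t0" if t: "a - 5 ^ j < t" "t < a + 5 * 5 ^ j" "\<phi> j (T (ray t) x) \<noteq> 0" for t
  proof -
    have "\<bar>t - t0\<bar> \<le> int (5 ^ (j + 2))" using t t0 by simp
    then have "ray t - ray t0 \<in> (int_box (5 ^ (j + 2)) :: (int^'k) set)" using ray_in_box ray_diff by metis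
    then show ?thesis using marker_separated[OF marker assms t0(3) t(3)] by (simp add: ray_inj)
  qed
  then show ?thesis by blast
qed blast

text \<open>This is the origin of the base 5. Of five consecutive blocks of length
  \<open>5 ^ j\<close>, the first, third and fifth are so far apart that a ramp of scale
  \<open>j\<close> meets at most one of them. Each of the two points has at most one such ramp
  nearby, so one of the three blocks is free for both, and the induction continues inside
  it.\<close>

lemma free_site:
  assumes "x \<in> X" "y \<in> X"
  shows "\<exists>s\<ge>a. s < a + 5 ^ j \<and> (\<forall>l<j. layer l (T (ray s) x) = 0 \<and> layer l (T (ray s) y) = 0)"
proof (induction j arbitrary: a)
  case 0
  then show ?case by (intro exI[of _ a]) auto
next
  case (Suc j)
  define w :: int where "w = 5 ^ j"
  have w: "w > 0" by (simp add: w_def)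
  obtain t1 where t1: "\<And>t. a - w < t \<Longrightarrow> t < a + 5 * w \<Longrightarrow> \<phi> j (T (ray t) x) \<noteq> 0 \<Longrightarrow> t = t1"
    using markers_on_ray_sparse[OF assms(1), of a j] unfolding w_def by blast
  obtain t2 where t2: "\<And>t. a - w < t \<Longrightarrow> t < a + 5 * w \<Longrightarrow> \<phi> j (T (ray t) y) \<noteq> 0 \<Longrightarrow> t = t2"
    using markers_on_ray_sparse[OF assms(2), of a j] unfolding w_def by blast
  have "\<exists>b. a \<le> b \<and> b + w \<le> a + 5 * w \<and> \<bar>t1 - b\<bar> \<ge> w \<and> \<bar>t2 - b\<bar> \<ge> w"
  proof (rule ccontr)
    assume "\<not> ?thesis"
    then have *: "\<bar>t1 - b\<bar> < w \<or> \<bar>t2 - b\<bar> < w" if "a \<le> b" "b + w \<le> a + 5 * w" for b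
      using that by (meson not_le)
    have "\<bar>t1 - a\<bar> < w \<or> \<bar>t2 - a\<bar> < w" "\<bar>t1 - (a + 2 * w)\<bar> < w \<or> \<bar>t2 - (a + 2 * w)\<bar> < w"
      "\<bar>t1 - (a + 4 * w)\<bar> < w \<or> \<bar>t2 - (a + 4 * w)\<bar> < w"
      using w by (intro *; linarith)+
    then show False by (elim disjE; linarith)
  qed
  then obtain b where b: "a \<le> b" "b + w \<le> a + 5 * w" "\<bar>t1 - b\<bar> \<ge> w" "\<bar>t2 - b\<bar> \<ge> w" by blast
  obtain s where s: "b \<le> s" "s < b + w" "\<forall>l<j. layer l (T (ray s) x) = 0 \<and> layer l (T (ray s) y) = 0"
    using Suc.IH[of b] unfolding w_def by blast
  have "layer j (T (ray s) x) = 0"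
  proof (rule ccontr)
    assume "layer j (T (ray s) x) \<noteq> 0"
    then obtain t where t: "t \<le> s" "s < t + w" "\<phi> j (T (ray t) x) \<noteq> 0"
      using layer_nonzero[OF assms(1)] unfolding w_def by blast
    then have "t = t1" using t1 s b by force
    then show False using t s b(3) by linarith
  qed
  moreover have "layer j (T (ray s) y) = 0"
  proof (rule ccontr)
    assume "layer j (T (ray s) y) \<noteq> 0"
    then obtain t where t: "t \<le> s" "s < t + w" "\<phi> j (T (ray t) y) \<noteq> 0"
      using layer_nonzero[OF assms(2)] unfolding w_def by blast
    then have "t = t2" using t2 s b by force
    then show False using t s b(4) by linarith
  qed
  moreover have "s < a + 5 ^ Suc j" using s b by (simp add: w_def)
  ultimately show ?case using s b by (intro exI[of _ s]) (auto simp: less_Suc_eq)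
qed

text \<open>At a free site the lower layers vanish for both points and the higher ones are
  negligible, so layer \<open>j\<close> decides. The marker of \<open>x\<close> sits at 0 and that
  of \<open>y\<close> at \<open>n \<noteq> 0\<close>; hence \<open>y\<close> has a different height
  there, or height 0.\<close>

lemma code_separates:
  assumes x: "x \<in> X" and y: "y \<in> X" and "\<phi> j x = 1" "\<phi> j (T n y) = 1" "n \<in> int_box (5 ^ j)" "n \<noteq> 0"
  shows "\<exists>m. code (T m x) \<noteq> code (T m y)"
proof -
  obtain s where s: "0 \<le> s" "s < 5 ^ j" "\<And>l. l < j \<Longrightarrow> layer l (T (ray s) x) = 0 \<and> layer l (T (ray s) y) = 0"
    using free_site[OF x y, of 0 j] by auto
  define s0 where "s0 = nat s"
  have s0: "s = int s0" "s0 < 5 ^ j" using s(1,2) by (auto simp: s0_def nat_less_iff)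
  have shift: "T (ray (- int s')) (T (ray s) u) = T (ray (s - int s')) u" if "u \<in> X" for u s'
    using T_add[OF that, of "ray (- int s')" "ray s"] by (simp flip: ray_add)
  have lx: "layer j (T (ray s) x) = (real s0 + 1) / 5 ^ j"
  proof -
    have "(real s' + 1) / 5 ^ j * \<phi> j (T (ray (- int s')) (T (ray s) x)) = (if s' = s0 then (real s0 + 1) / 5 ^ j else 0)"
      if "s' < 5 ^ j" for s'
    proof (cases "s' = s0")
      case True
      then show ?thesis using shift[OF x] s0 T_0[OF x] assms(3) by simp
    next
      case False
      have "\<phi> j (T (ray (s - int s')) x) = 0"
      proof (rule ccontr)
        assume nz: "\<phi> j (T (ray (s - int s')) x) \<noteq> 0"
        have "int s' < 5 ^ j" "int s0 < 5 ^ j" using that s0(2) by (metis of_nat_less_iff of_nat_numeral of_nat_power)+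
        moreover have "int (5 ^ (j + 2)) = 25 * 5 ^ j" by simp
        ultimately have "\<bar>s - int s'\<bar> \<le> int (5 ^ (j + 2))" using s0(1) by linarith
        then have "ray (s - int s') - 0 \<in> (int_box (5 ^ (j + 2)) :: (int^'k) set)"
          unfolding diff_0_right by (rule ray_in_box)
        moreover have "\<phi> j (T 0 x) \<noteq> 0" using assms(3) T_0[OF x] by simp
        ultimately have "ray (s - int s') = (ray 0 :: int^'k)" using marker_separated[OF marker x _ nz] by simp
        then show False using False s0 unfolding ray_inj by simp
      qed
      then show ?thesis using shift[OF x] False by simp
    qed
    then have "layer j (T (ray s) x) = (\<Sum>s'<5 ^ j. if s' = s0 then (real s0 + 1) / 5 ^ j else 0)"
      unfolding layer_def by (intro sum.cong) auto
    also have "\<dots> = (real s0 + 1) / 5 ^ j" using s0 by simp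
    finally show ?thesis .
  qed
  have ly: "layer j (T (ray s) y) = 0 \<or> (\<exists>s1. s1 \<noteq> s0 \<and> layer j (T (ray s) y) = (real s1 + 1) / 5 ^ j)"
  proof -
    have eq: "ray (s - int s') = n" if "s' < 5 ^ j" "\<phi> j (T (ray (s - int s')) y) \<noteq> 0" for s'
    proof -
      have "int s' < 5 ^ j" "int s0 < 5 ^ j" using that(1) s0(2) by (metis of_nat_less_iff of_nat_numeral of_nat_power)+
      moreover have "int (5 ^ j) = 5 ^ j" by simp
      ultimately have "\<bar>s - int s'\<bar> \<le> int (5 ^ j)" using s0(1) by linarith
      then have "ray (s - int s') - n \<in> int_box (5 ^ j + 5 ^ j)" using ray_in_box assms(5) by (intro int_box_diff)
      then have "ray (s - int s') - n \<in> int_box (5 ^ (j + 2))" using int_box_mono[of "5 ^ j + 5 ^ j" "5 ^ (j + 2)"] by auto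
      then show ?thesis using marker_separated[OF marker y _ that(2)] assms(4) by simp
    qed
    show ?thesis
    proof (cases "\<exists>s1<5 ^ j. ray (s - int s1) = n")
      case True
      then obtain s1 where s1: "s1 < 5 ^ j" "ray (s - int s1) = n" by blast
      have "s1 \<noteq> s0" using s1(2) s0 assms(6) by auto
      have "(real s' + 1) / 5 ^ j * \<phi> j (T (ray (- int s')) (T (ray s) y)) = (if s' = s1 then (real s1 + 1) / 5 ^ j else 0)"
        if "s' < 5 ^ j" for s'
      proof (cases "s' = s1")
        case True
        then show ?thesis using shift[OF y] s1 assms(4) by simp
      next
        case False
        then have "ray (s - int s') \<noteq> n" using s1(2) ray_inj by (metis diff_left_imp_eq of_nat_eq_iff)
        then show ?thesis using eq[OF that] shift[OF y] False by auto
      qed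
      then have "layer j (T (ray s) y) = (\<Sum>s'<5 ^ j. if s' = s1 then (real s1 + 1) / 5 ^ j else 0)"
        unfolding layer_def by (intro sum.cong) auto
      also have "\<dots> = (real s1 + 1) / 5 ^ j" using s1 by simp
      finally show ?thesis using \<open>s1 \<noteq> s0\<close> by blast
    next
      case False
      then have "layer j (T (ray s) y) = 0" unfolding layer_def using eq shift[OF y] by (intro sum.neutral) fastforce
      then show ?thesis by simp
    qed
  qed
  have diff: "\<bar>layer j (T (ray s) x) - layer j (T (ray s) y)\<bar> \<ge> 1 / 5 ^ j"
  proof -
    have "\<bar>(real s0 + 1) / 5 ^ j - (real s1 + 1) / 5 ^ j\<bar> \<ge> 1 / 5 ^ j" if "s1 \<noteq> s0" for s1
    proof -
      have "\<bar>real s0 - real s1\<bar> \<ge> 1" using that by linarith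
      moreover have "(real s0 + 1) / 5 ^ j - (real s1 + 1) / 5 ^ j = (real s0 - real s1) / 5 ^ j" by (simp add: diff_divide_distrib add_divide_distrib)
      ultimately show ?thesis by (simp add: divide_right_mono)
    qed
    then show ?thesis using lx ly by (auto simp: divide_right_mono)
  qed
  define c where "c = (\<lambda>l. (1 / 5 :: real) ^ (l * l + l + 1))"
  let ?u = "T (ray s) x" and ?v = "T (ray s) y"
  have uv: "?u \<in> X" "?v \<in> X" using T_in x y by auto
  have "(\<Sum>l. c l * (layer l ?u - layer l ?v)) \<noteq> 0"
  proof (rule suminf_dominant_term_nonzero[where B = "c j / 5 ^ j" and j = j])
    show "c l * (layer l ?u - layer l ?v) = 0" if "l < j" for l using s(3)[OF that] by simp
    show "c j / 5 ^ j \<le> \<bar>c j * (layer j ?u - layer j ?v)\<bar>"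
      using mult_left_mono[OF diff, of "c j"] by (simp add: abs_mult c_def)
    show "0 < c j / 5 ^ j" by (simp add: c_def)
    fix t
    let ?l = "t + Suc j"
    have "\<bar>layer ?l ?u - layer ?l ?v\<bar> \<le> 5 ^ ?l" using layer_bounds[OF uv(1), of ?l] layer_bounds[OF uv(2), of ?l] by linarith
    then have "\<bar>c ?l * (layer ?l ?u - layer ?l ?v)\<bar> \<le> c ?l * 5 ^ ?l" by (simp add: abs_mult c_def)
    also have "\<dots> = (1 / 5) ^ (?l * ?l + 1)" by (simp add: c_def power_add power_divide)
    \<comment> \<open>By \<open>(t + j + 1)^2 + 1 \<ge> (j + 1)^2 + t + 1\<close> the later terms
      fall geometrically below the step of layer \<open>j\<close>.\<close>
    also have "\<dots> \<le> (1 / 5) ^ (j * j + j + 1 + j + Suc t)"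
      by (intro power_decreasing) (auto simp: algebra_simps)
    also have "\<dots> = c j / 5 ^ j * (1 / 5) ^ Suc t" by (simp add: c_def power_add power_divide)
    finally show "\<bar>c ?l * (layer ?l ?u - layer ?l ?v)\<bar> \<le> c j / 5 ^ j * (1 / 5) ^ Suc t" .
  qed
  moreover have "code ?u - code ?v = (\<Sum>l. c l * (layer l ?u - layer l ?v))"
    unfolding code_def c_def right_diff_distrib
    using suminf_diff[OF summable_layers[OF uv(1)] summable_layers[OF uv(2)]] by simp
  ultimately show ?thesis by (intro exI[of _ "ray s"]) auto
qed

text \<open>The given marker need not be a function of the code. It is replaced by a bump
  \<open>\<psi>\<close> around the set \<open>K\<close> where it equals 1, measured in a
  pseudometric \<open>\<rho>\<close> that sees finitely many code values. If \<open>x\<close> and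
  \<open>T n y\<close> lie in \<open>K\<close> for a nonzero \<open>n\<close> in the box, the codes
  of \<open>x\<close> and \<open>y\<close> differ by a definite amount \<open>r\<close>, by
  compactness; a bump of radius \<open>r / 3\<close> therefore inherits the separation.\<close>

lemma marker_from_code:
  "\<exists>M' \<psi>. marker R M' \<psi> \<and> (\<forall>x\<in>X. \<forall>y\<in>X. (\<forall>n. code (T n x) = code (T n y)) \<longrightarrow> \<psi> x = \<psi> y)"
proof -
  define j where "j = R"
  have "R < 5 ^ R" by (induction R) auto
  then have boxR: "int_box R \<subseteq> (int_box (5 ^ j) :: (int^'k) set)" unfolding j_def by (intro int_box_mono) simp
  have cont\<phi>: "continuous_on X (\<phi> j)" using marker unfolding marker_def by blast
  define S where "S = (\<Union>n\<in>int_box R - {0}. {p \<in> X \<times> X. \<phi> j (fst p) = 1 \<and> \<phi> j (T n (snd p)) = 1})"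
  have contf: "continuous_on (X \<times> X) (\<lambda>p. g (fst p))" and conts: "continuous_on (X \<times> X) (\<lambda>p. g (snd p))"
    if "continuous_on X g" for g :: "'a \<Rightarrow> real"
    using that by (auto intro!: continuous_on_compose2[OF that] continuous_intros)
  have "compact S"
    unfolding S_def
  proof (intro compact_UN)
    show "finite (int_box R - {0} :: (int^'k) set)" using finite_int_box by simp
    fix n :: "int^'k"
    have "closedin (top_of_set (X \<times> X)) (X \<times> X \<inter> (\<lambda>p. (\<phi> j (fst p), \<phi> j (T n (snd p)))) -` {(1, 1)})"
      by (intro continuous_closedin_preimage continuous_on_Pair contf conts continuous_on_T_comp cont\<phi>) auto
    moreover have "X \<times> X \<inter> (\<lambda>p. (\<phi> j (fst p), \<phi> j (T n (snd p)))) -` {(1, 1)} =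
        {p \<in> X \<times> X. \<phi> j (fst p) = 1 \<and> \<phi> j (T n (snd p)) = 1}" by auto
    ultimately have "closedin (top_of_set (X \<times> X)) {p \<in> X \<times> X. \<phi> j (fst p) = 1 \<and> \<phi> j (T n (snd p)) = 1}"
      by (simp only:)
    then show "compact {p \<in> X \<times> X. \<phi> j (fst p) = 1 \<and> \<phi> j (T n (snd p)) = 1}"
      by (rule closedin_compact[OF compact_Times[OF compact_X compact_X]])
  qed
  then have "\<exists>q. \<forall>p\<in>S. \<exists>m\<in>int_box q. \<bar>code (T m (fst p)) - code (T m (snd p))\<bar> > 1 / (real q + 1)"
  proof (rule compact_uniformly_positive)
    have "S \<subseteq> X \<times> X" by (auto simp: S_def)
    then show "continuous_on S (\<lambda>p. \<bar>code (T m (fst p)) - code (T m (snd p))\<bar>)" for m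
      by (rule continuous_on_subset[rotated])
         (intro continuous_intros contf conts continuous_on_T_comp continuous_on_code)
    fix p assume "p \<in> S"
    then obtain n where "n \<in> int_box R" "n \<noteq> 0" "fst p \<in> X" "snd p \<in> X" "\<phi> j (fst p) = 1" "\<phi> j (T n (snd p)) = 1"
    proof -
      obtain n where "n \<in> int_box R - {0}" "p \<in> {p \<in> X \<times> X. \<phi> j (fst p) = 1 \<and> \<phi> j (T n (snd p)) = 1}"
        using \<open>p \<in> S\<close> unfolding S_def by (rule UN_E)
      then show thesis by (intro that[of n]) (auto simp: mem_Times_iff)
    qed
    then show "\<exists>m. 0 < \<bar>code (T m (fst p)) - code (T m (snd p))\<bar>"
      using code_separates[of "fst p" "snd p" j n] boxR by auto
  qed
  then obtain q where q: "\<And>x y n. x \<in> X \<Longrightarrow> y \<in> X \<Longrightarrow> n \<in> int_box R \<Longrightarrow> n \<noteq> 0 \<Longrightarrow> \<phi> j x = 1 \<Longrightarrow> \<phi> j (T n y) = 1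
      \<Longrightarrow> \<exists>m\<in>int_box q. \<bar>code (T m x) - code (T m y)\<bar> > 1 / (real q + 1)"
  proof -
    obtain q where *: "\<And>p. p \<in> S \<Longrightarrow> \<exists>m\<in>int_box q. \<bar>code (T m (fst p)) - code (T m (snd p))\<bar> > 1 / (real q + 1)"
      using \<open>\<exists>q. \<forall>p\<in>S. \<exists>m\<in>int_box q. \<bar>code (T m (fst p)) - code (T m (snd p))\<bar> > 1 / (real q + 1)\<close> by blast
    show thesis
    proof (rule that[of q])
      fix x y n assume "x \<in> X" "y \<in> X" "n \<in> int_box R" "n \<noteq> 0" "\<phi> j x = 1" "\<phi> j (T n y) = 1"
      then have "(x, y) \<in> S" by (auto simp: S_def)
      then show "\<exists>m\<in>int_box q. \<bar>code (T m x) - code (T m y)\<bar> > 1 / (real q + 1)" using *[of "(x, y)"] by simp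
    qed
  qed
  define r where "r = 1 / (real q + 1)"
  have r: "r > 0" by (simp add: r_def)
  \<comment> \<open>The extra \<open>R\<close> allows the comparison of \<open>T n x\<close> with
    \<open>z\<close> at the sites \<open>m - n\<close>, for \<open>m\<close> in the box of radius
    \<open>q\<close> and \<open>n\<close> in that of radius \<open>R\<close>.\<close>
  define \<rho> where "\<rho> = (\<lambda>x y. \<Sum>m\<in>int_box (q + R). \<bar>code (T m x) - code (T m y)\<bar>)"
  have \<rho>0: "0 \<le> \<rho> x y" for x y by (auto simp: \<rho>_def intro: sum_nonneg)
  have \<rho>tri: "\<rho> x z \<le> \<rho> x y + \<rho> y z" for x y z
    unfolding \<rho>_def sum.distrib[symmetric] by (intro sum_mono) linarith
  have \<rho>term: "\<bar>code (T m x) - code (T m y)\<bar> \<le> \<rho> x y" if "m \<in> int_box (q + R)" for m x y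
    unfolding \<rho>_def using that finite_int_box by (intro member_le_sum) auto
  define K where "K = {x \<in> X. \<phi> j x = 1}"
  have cover: "\<exists>n\<in>int_box (M j). \<phi> j (T n x) = 1" if "x \<in> X" for x
    using marker[of j] that unfolding marker_def by (elim conjE) (erule bspec)
  have Kne: "K \<noteq> {}"
  proof -
    obtain x where x: "x \<in> X" using nonempty by blast
    then obtain n where "\<phi> j (T n x) = 1" "T n x \<in> X" using cover[OF x] T_in[OF x] by blast
    then show ?thesis by (auto simp: K_def)
  qed
  have bdd: "bdd_below (\<rho> x ` K)" for x using \<rho>0 by (intro bdd_belowI[of _ 0]) auto
  define D where "D = (\<lambda>x. INF y\<in>K. \<rho> x y)"
  have D0: "0 \<le> D x" for x unfolding D_def using \<rho>0 Kne by (intro cINF_greatest)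
  have Dlip: "D x \<le> D x' + \<rho> x x'" for x x'
  proof -
    have "D x - \<rho> x x' \<le> D x'" unfolding D_def
    proof (rule cINF_greatest[OF Kne])
      fix y assume "y \<in> K"
      then have "(INF y\<in>K. \<rho> x y) \<le> \<rho> x y" using bdd by (intro cINF_lower)
      then show "(INF y\<in>K. \<rho> x y) - \<rho> x x' \<le> \<rho> x' y" using \<rho>tri[of x y x'] by linarith
    qed
    then show ?thesis by linarith
  qed
  have \<rho>sym: "\<rho> x y = \<rho> y x" for x y unfolding \<rho>_def by (simp add: abs_minus_commute)
  have contD: "continuous_on X D"
    unfolding continuous_on_def
  proof
    fix x assume x: "x \<in> X"
    have "continuous_on X (\<lambda>y. \<rho> x y)" unfolding \<rho>_def
      by (intro continuous_intros continuous_on_T_comp continuous_on_code)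
    then have "((\<lambda>y. \<rho> x y) \<longlongrightarrow> \<rho> x x) (at x within X)" using x by (simp add: continuous_on_def)
    then have lim: "((\<lambda>y. \<rho> x y) \<longlongrightarrow> 0) (at x within X)" by (simp add: \<rho>_def)
    have "((\<lambda>y. D y - D x) \<longlongrightarrow> 0) (at x within X)"
    proof (rule Lim_null_comparison[OF _ lim])
      have "norm (D y - D x) \<le> \<rho> x y" for y
        using Dlip[of x y] Dlip[of y x] \<rho>sym[of x y] by (auto simp: abs_le_iff)
      then show "\<forall>\<^sub>F y in at x within X. norm (D y - D x) \<le> \<rho> x y" by simp
    qed
    then show "(D \<longlongrightarrow> D x) (at x within X)" by (simp add: LIM_zero_iff)
  qed
  define \<psi> where "\<psi> = (\<lambda>x. max 0 (1 - 3 / r * D x))"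
  have near: "\<exists>y\<in>K. \<rho> x y < r / 3" if "\<psi> x \<noteq> 0" for x
  proof -
    have "D x < r / 3" using that r by (auto simp: \<psi>_def max_def field_simps split: if_splits)
    then obtain d where "d \<in> \<rho> x ` K" "d < r / 3"
      unfolding D_def using cInf_lessD[of "\<rho> x ` K" "r / 3"] Kne by blast
    then show ?thesis by blast
  qed
  have "marker R (M j) \<psi>"
    unfolding marker_def
  proof (intro conjI ballI impI)
    show "continuous_on X \<psi>" unfolding \<psi>_def using contD by (intro continuous_intros continuous_on_max)
    show "0 \<le> \<psi> x" "\<psi> x \<le> 1" for x using D0[of x] r by (auto simp: \<psi>_def)
    show "n = 0" if x: "x \<in> X" and n: "n \<in> int_box R" and nz: "\<psi> x \<noteq> 0" "\<psi> (T n x) \<noteq> 0" for x n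
    proof (rule ccontr)
      assume "n \<noteq> 0"
      obtain y where y: "y \<in> K" "\<rho> x y < r / 3" using near[OF nz(1)] by blast
      obtain z where z: "z \<in> K" "\<rho> (T n x) z < r / 3" using near[OF nz(2)] by blast
      let ?z = "T (- n) z"
      have zX: "z \<in> X" "?z \<in> X" "y \<in> X" "\<phi> j y = 1" using z y T_in by (auto simp: K_def)
      have "\<phi> j (T n ?z) = 1" using z T_inverse by (simp add: K_def)
      then obtain m where m: "m \<in> int_box q" "\<bar>code (T m y) - code (T m ?z)\<bar> > r"
        using q[OF zX(3,2) n \<open>n \<noteq> 0\<close> zX(4)] unfolding r_def by blast
      have mq: "m \<in> int_box (q + R)" using m(1) int_box_mono[of q "q + R"] by auto
      have mn: "m - n \<in> int_box (q + R)" using int_box_diff[OF m(1) n] .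
      have "\<bar>code (T m x) - code (T m y)\<bar> < r / 3" using \<rho>term[OF mq, of x y] y(2) by linarith
      moreover have "T (m - n) (T n x) = T m x" "T (m - n) z = T m ?z"
        using T_add[OF x, of "m - n" n] T_add[OF zX(1), of m "- n"] by simp_all
      then have "\<bar>code (T m x) - code (T m ?z)\<bar> < r / 3"
        using \<rho>term[OF mn, of "T n x" z] z(2) by simp
      ultimately show False using m(2) r by linarith
    qed
    fix x assume x: "x \<in> X"
    obtain n where n: "n \<in> int_box (M j)" "\<phi> j (T n x) = 1" "T n x \<in> X"
      using cover[OF x] T_in[OF x] by blast
    have "T n x \<in> K" using n by (simp add: K_def)
    then have "D (T n x) \<le> \<rho> (T n x) (T n x)" unfolding D_def using bdd by (intro cINF_lower)
    then have "D (T n x) = 0" using D0[of "T n x"] by (simp add: \<rho>_def)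
    then show "\<exists>n\<in>int_box (M j). \<psi> (T n x) = 1" using n by (intro bexI[of _ n]) (simp_all add: \<psi>_def)
  qed
  moreover have "\<psi> x = \<psi> y" if "x \<in> X" "y \<in> X" "\<forall>n. code (T n x) = code (T n y)" for x y
    using that(3) unfolding \<psi>_def D_def \<rho>_def by simp
  ultimately show ?thesis by blast
qed

end

lemma (in zk_system) exists_marker_code:
  assumes "marker_property X T"
  shows "\<exists>h::'a \<Rightarrow> real. continuous_on X h \<and> (\<forall>x\<in>X. 0 \<le> h x \<and> h x \<le> 1) \<and>
    (\<forall>R. \<exists>M \<phi>. marker R M \<phi> \<and> (\<forall>x\<in>X. \<forall>y\<in>X. (\<forall>n. h (T n x) = h (T n y)) \<longrightarrow> \<phi> x = \<phi> y))"
proof -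
  have "\<forall>j. \<exists>M \<phi>. marker (5 ^ (j + 2)) M \<phi>" using exists_marker[OF assms] by blast
  then obtain M \<phi> where "\<And>j. marker (5 ^ (j + 2)) (M j) (\<phi> j)" by metis
  then interpret tower: marker_tower X T \<phi> M by unfold_locales
  show ?thesis
  proof (rule exI[of _ tower.code], intro conjI ballI)
    show "\<forall>R. \<exists>M \<psi>. marker R M \<psi> \<and> (\<forall>x\<in>X. \<forall>y\<in>X. (\<forall>n. tower.code (T n x) = tower.code (T n y)) \<longrightarrow> \<psi> x = \<psi> y)"
      by (rule allI) (rule tower.marker_from_code)
  qed (simp_all add: tower.continuous_on_code tower.code_bounds)
qed

section \<open>Pixels of a power diagram\<close>

definition sqnorm :: "int^'k \<Rightarrow> int" where "sqnorm v = (\<Sum>i\<in>UNIV. (v $ i)\<^sup>2)"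

definition dotprod :: "int^'k \<Rightarrow> int^'k \<Rightarrow> int" where "dotprod u v = (\<Sum>i\<in>UNIV. u $ i * v $ i)"

lemma sqnorm_diff: "sqnorm (u - v) = sqnorm u - 2 * dotprod u v + sqnorm v"
  and sqnorm_add: "sqnorm (u + v) = sqnorm u + 2 * dotprod u v + sqnorm v"
  by (simp_all add: sqnorm_def dotprod_def power2_diff power2_sum sum.distrib sum_subtractf sum_distrib_left algebra_simps)

lemma sqnorm_nonneg: "0 \<le> sqnorm v"
  by (simp add: sqnorm_def sum_nonneg)

lemma sqnorm_minus: "sqnorm (- v) = sqnorm v"
  by (simp add: sqnorm_def)

lemma dotprod_linear: "dotprod (a *s u + b *s v) w = a * dotprod u w + b * dotprod v w"
  by (simp add: dotprod_def sum.distrib sum_distrib_left algebra_simps)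

lemma sqnorm_le_of_box:
  fixes m :: "int^'k"
  assumes "m \<in> int_box r" shows "sqnorm m \<le> int (CARD('k) * r\<^sup>2)"
proof -
  have "(m $ i)\<^sup>2 \<le> (int r)\<^sup>2" for i
    using assms by (intro abs_le_square_iff[THEN iffD1]) (simp add: int_box_def)
  then have "sqnorm m \<le> (\<Sum>i::'k\<in>UNIV. (int r)\<^sup>2)" unfolding sqnorm_def by (intro sum_mono)
  then show ?thesis by simp
qed

text \<open>The factor \<open>CARD('k)\<close> absorbs the passage from the sup norm to the squared
  Euclidean norm. Sites outside this box are farther away than any marker in the box of radius
  \<open>r\<close>, which confines the minimising site in \<open>exists_tiling\<close>.\<close>

lemma sqnorm_gt_of_not_box:
  fixes n :: "int^'k"
  assumes "n \<notin> int_box (CARD('k) * r)" shows "int (CARD('k) * r\<^sup>2) < sqnorm n"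
proof -
  obtain i where i: "int (CARD('k) * r) < \<bar>n $ i\<bar>" using assms by (auto simp: int_box_def not_le)
  have "CARD('k) * r\<^sup>2 \<le> (CARD('k) * r)\<^sup>2" by (simp add: power2_eq_square)
  then have "int (CARD('k) * r\<^sup>2) \<le> (int (CARD('k) * r))\<^sup>2" by (metis of_nat_le_iff of_nat_power)
  also have "\<dots> < \<bar>n $ i\<bar>\<^sup>2" using i by (intro power_strict_mono) auto
  also have "\<dots> = (n $ i)\<^sup>2" by simp
  also have "\<dots> \<le> sqnorm n" unfolding sqnorm_def by (intro member_le_sum) auto
  finally show ?thesis .
qed

text \<open>A quadratic term beats a linear one: if \<open>\<mu>\<close> is the largest absolute
  coordinate of \<open>n\<close>, the product with \<open>e\<close> is at most
  \<open>c * CARD('k) * \<mu>\<close>, while \<open>\<mu>\<close> exceeds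
  \<open>2 * c * CARD('k) + 1\<close>. With \<open>e\<close> the rounding error of a pixel and
  \<open>c = N * L\<close>, this dictates how far apart markers must be in
  \<open>exists_tiling\<close>.\<close>

lemma sqnorm_dominates_dotprod:
  fixes e n :: "int^'k"
  assumes "n \<notin> int_box (2 * c * CARD('k) + 1)" "\<And>i. \<bar>e $ i\<bar> \<le> int c"
  shows "1 \<le> sqnorm n - 2 * dotprod e n"
proof -
  define \<mu> where "\<mu> = Max (range (\<lambda>i. \<bar>n $ i\<bar>))"
  have le: "\<bar>n $ i\<bar> \<le> \<mu>" for i unfolding \<mu>_def by (intro Max_ge) auto
  have "\<mu> \<in> range (\<lambda>i. \<bar>n $ i\<bar>)" unfolding \<mu>_def by (intro Max_in) auto
  then obtain i0 where i0: "\<mu> = \<bar>n $ i0\<bar>" by blast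
  obtain i1 where "int (2 * c * CARD('k) + 1) < \<bar>n $ i1\<bar>" using assms(1) by (auto simp: int_box_def not_le)
  then have \<mu>: "2 * int c * int (CARD('k)) + 1 < \<mu>" using le[of i1] by simp
  have "dotprod e n \<le> (\<Sum>i::'k\<in>UNIV. int c * \<mu>)"
    unfolding dotprod_def
  proof (rule sum_mono)
    fix i
    have "e $ i * n $ i \<le> \<bar>e $ i\<bar> * \<bar>n $ i\<bar>" by (metis abs_ge_self abs_mult)
    also have "\<dots> \<le> int c * \<mu>" using le assms(2) by (intro mult_mono) auto
    finally show "e $ i * n $ i \<le> int c * \<mu>" .
  qed
  then have 1: "dotprod e n \<le> int (CARD('k)) * (int c * \<mu>)" by simp
  have "\<bar>n $ i0\<bar>\<^sup>2 \<le> sqnorm n" unfolding sqnorm_def power2_abs by (intro member_le_sum) auto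
  then have 2: "\<mu> * \<mu> \<le> sqnorm n" unfolding i0[symmetric] power2_eq_square .
  have "0 \<le> 2 * int c * int (CARD('k))" by simp
  then have "1 \<le> \<mu>" "1 \<le> \<mu> - 2 * int c * int (CARD('k))" using \<mu> by linarith+
  then have "1 * 1 \<le> \<mu> * (\<mu> - 2 * int c * int (CARD('k)))" by (intro mult_mono) linarith+
  then show ?thesis using 1 2 by (simp add: algebra_simps)
qed

definition clamp01 :: "real \<Rightarrow> real" where "clamp01 t = max 0 (min 1 t)"

lemma clamp01: "0 \<le> clamp01 t" "clamp01 t \<le> 1" "clamp01 t \<noteq> 0 \<Longrightarrow> 0 < t" "1 \<le> t \<Longrightarrow> clamp01 t = 1"
  by (auto simp: clamp01_def max_def min_def split: if_splits)

lemma scaled_add_cube_in_box: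
  assumes "a \<in> int_box r" "j \<in> cube L"
  shows "int L *s a + j \<in> int_box (L * r + L)"
proof -
  have "\<bar>int L * a $ i + j $ i\<bar> \<le> int L * int r + int L" for i
  proof -
    have "\<bar>int L * a $ i\<bar> \<le> int L * int r" using assms(1) by (auto simp: abs_mult int_box_def intro!: mult_left_mono)
    moreover have "\<bar>j $ i\<bar> \<le> int L" using assms(2) by (auto simp: cube_def less_imp_le)
    ultimately show ?thesis by linarith
  qed
  then show ?thesis by (simp add: int_box_def)
qed

lemma scaled_add_cube_unique:
  assumes "int L *s a + i = int L *s b + j" "i \<in> cube L" "j \<in> cube L"
  shows "a = b" "i = j"
proof -
  have "a $ t = b $ t \<and> i $ t = j $ t" for t
  proof -
    have eq: "int L * a $ t + i $ t = int L * b $ t + j $ t" using assms(1) by (metis vector_add_component vector_smult_component)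
    have it: "0 \<le> i $ t" "i $ t < int L" and jt: "0 \<le> j $ t" "j $ t < int L"
      using assms(2,3) by (auto simp: cube_def)
    have "(int L * a $ t + i $ t) div int L = a $ t" "(int L * b $ t + j $ t) div int L = b $ t"
      using it jt by (simp_all add: div_pos_pos_trivial)
    then show ?thesis using eq by auto
  qed
  then show "a = b" "i = j" by (simp_all add: vec_eq_iff)
qed

context zk_system
begin

text \<open>The tiles are the cells of the power diagram of the marked sites, a site \<open>n\<close> having
  the power \<open>A * (1 - \<phi> (T n x))\<close>.  Pixels are taken from the diagram whose powers are scaled by
  \<open>L / N\<close>: shrinking a cell towards its site by the factor \<open>L / N\<close> moves it well inside the cell of
  the scaled diagram.  The term \<open>1 - 2 * \<phi>\<close> lets a fading site lose its influence continuously.\<close>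

definition pixel_gap :: "nat \<Rightarrow> real \<Rightarrow> ('a \<Rightarrow> real) \<Rightarrow> int^'k \<Rightarrow> int^'k \<Rightarrow> 'a \<Rightarrow> real" where
  "pixel_gap N A \<phi> v n x = real N * of_int (sqnorm (v - n) - sqnorm v) + real (N - 1) * A * (\<phi> x - \<phi> (T n x))"

definition pixel_weight :: "nat \<Rightarrow> real \<Rightarrow> nat \<Rightarrow> ('a \<Rightarrow> real) \<Rightarrow> int^'k \<Rightarrow> 'a \<Rightarrow> real" where
  "pixel_weight N A B \<phi> a x = (\<Prod>n\<in>int_box B - {0}. \<Prod>j\<in>cube (N - 1).
     clamp01 (max (pixel_gap N A \<phi> (int (N - 1) *s a + j) n x) (1 - 2 * \<phi> (T n x))))"

lemma pixel_weight_bounds: "0 \<le> pixel_weight N A B \<phi> a x" "pixel_weight N A B \<phi> a x \<le> 1"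
  unfolding pixel_weight_def by (auto intro!: prod_nonneg prod_le_1 clamp01)

lemma pixel_weight_nonzero:
  assumes "pixel_weight N A B \<phi> a x \<noteq> 0" "n \<in> int_box B" "n \<noteq> 0" "j \<in> cube (N - 1)" "1 / 2 < \<phi> (T n x)"
  shows "0 < pixel_gap N A \<phi> (int (N - 1) *s a + j) n x"
proof -
  define F where "F = (\<lambda>n j. clamp01 (max (pixel_gap N A \<phi> (int (N - 1) *s a + j) n x) (1 - 2 * \<phi> (T n x))))"
  have fin: "finite (int_box B - {0} :: (int^'k) set)" using finite_int_box by blast
  have "(\<Prod>n\<in>int_box B - {0}. \<Prod>j\<in>cube (N - 1). F n j) \<noteq> 0"
    using assms(1) unfolding pixel_weight_def F_def .
  then have "(\<Prod>j\<in>cube (N - 1). F n j) \<noteq> 0"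
    using assms(2,3) prod_zero_iff[OF fin] by (metis (no_types, lifting) DiffI singletonD)
  then have "F n j \<noteq> 0" using assms(4) prod_zero_iff[OF finite_cube] by blast
  then have "clamp01 (max (pixel_gap N A \<phi> (int (N - 1) *s a + j) n x) (1 - 2 * \<phi> (T n x))) \<noteq> 0"
    unfolding F_def .
  from clamp01(3)[OF this] show ?thesis using assms(5) by (auto simp: less_max_iff_disj)
qed

lemma continuous_on_pixel_weight:
  assumes "continuous_on X \<phi>" shows "continuous_on X (pixel_weight N A B \<phi> a)"
  unfolding pixel_weight_def pixel_gap_def clamp01_def
  by (intro continuous_intros continuous_on_prod continuous_on_max continuous_on_min continuous_on_T_comp assms)

text \<open>Pixels of different markers on a common site would require two power comparisons that
  are negatives of each other to be positive. For the last clause the marker of least power at the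
  origin is taken; shrinking by \<open>L / N\<close> turns its weak inequality against the
  competitors into one with room to spare.\<close>

lemma exists_tiling:
  fixes N L :: nat
  defines "L \<equiv> N - 1"
  assumes N: "2 \<le> N" and marker: "marker (2 * (N * L) * CARD('k) + 1) M \<phi>"
  shows "\<exists>P \<alpha>. finite P \<and> (\<forall>a. continuous_on X (\<alpha> a)) \<and> (\<forall>a x. 0 \<le> \<alpha> a x \<and> \<alpha> a x \<le> (1::real)) \<and>
    (\<forall>a. \<forall>x\<in>X. \<forall>y\<in>X. (\<forall>n. \<phi> (T n x) = \<phi> (T n y)) \<longrightarrow> \<alpha> a x = \<alpha> a y) \<and>
    (\<forall>x\<in>X. \<forall>a\<in>P. \<forall>b\<in>P. \<forall>i\<in>cube L. \<forall>j\<in>cube L.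
       \<alpha> a (T (- (int L *s a + i)) x) \<noteq> 0 \<longrightarrow> \<alpha> b (T (- (int L *s b + j)) x) \<noteq> 0 \<longrightarrow> a = b \<and> i = j) \<and>
    (\<forall>x\<in>X. \<exists>n. \<exists>a\<in>P. \<exists>j\<in>cube N. \<alpha> a (T n x) = 1 \<and> j + int N *s a + n = 0)"
proof -
  define k where "k = CARD('k)"
  have k: "1 \<le> k" unfolding k_def by (simp add: Suc_leI)
  \<comment> \<open>A site of value at most 1/2 pays at least \<open>A / 2\<close>, which exceeds
    the squared distance \<open>k * M\<^sup>2\<close> to a marker of value 1 even after the factor
    \<open>N / L \<le> 2\<close>.\<close>
  define A where "A = 4 * real k * (real M)\<^sup>2 + 1"
  define r where "r = k * M"
  \<comment> \<open>Large enough for the difference of two pixel sites and for the way from a pixel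
    site to a marker at distance \<open>M\<close>.\<close>
  define B where "B = 2 * (L * r + L) + M"
  define P where "P = (int_box r :: (int^'k) set)"
  define \<alpha> where "\<alpha> = pixel_weight N A B \<phi>"
  have A: "A > 0" by (simp add: A_def add_nonneg_pos)
  have L: "1 \<le> L" "N = L + 1" using N by (auto simp: L_def)
  have cont: "continuous_on X \<phi>" and bounds: "\<And>x. x \<in> X \<Longrightarrow> 0 \<le> \<phi> x" "\<And>x. x \<in> X \<Longrightarrow> \<phi> x \<le> 1"
    using marker unfolding marker_def by simp_all
  have cover: "\<exists>n\<in>int_box M. \<phi> (T n x) = 1" if "x \<in> X" for x
    using marker that unfolding marker_def by (elim conjE) (erule bspec)
  have gap: "0 < pixel_gap N A \<phi> (int L *s a + j) n x"
    if "\<alpha> a x \<noteq> 0" "n \<in> int_box B" "n \<noteq> 0" "j \<in> cube L" "1 / 2 < \<phi> (T n x)" for a x n j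
    using pixel_weight_nonzero[of N A B \<phi> a x n j] that unfolding \<alpha>_def L_def by blast
  \<comment> \<open>The weight compares only with competitors above 1/2, so exclusion requires that
    every owner of a pixel is itself above 1/2. Otherwise it would lose against a marker of value 1
    near the pixel.\<close>
  have active: "1 / 2 < \<phi> x" if x: "x \<in> X" and a: "a \<in> P" "\<alpha> a x \<noteq> 0" "j \<in> cube L" for x a and j :: "int^'k"
  proof -
    define v where "v = int L *s a + j"
    have v: "v \<in> int_box (L * r + L)" unfolding v_def using a by (intro scaled_add_cube_in_box) (auto simp: P_def)
    obtain m where m: "m \<in> int_box M" "\<phi> (T m (T v x)) = 1" using cover T_in x by blast
    then have nphi: "\<phi> (T (m + v) x) = 1" using T_add[OF x] by simp
    show ?thesis
    proof (cases "m + v = 0")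
      case True
      then show ?thesis using nphi T_0[OF x] by simp
    next
      case False
      have "m - (- v) \<in> int_box (M + (L * r + L))" using m(1) v by (intro int_box_diff) (auto simp: int_box_def)
      then have "m + v \<in> int_box B" using int_box_mono[of "M + (L * r + L)" B] by (auto simp: B_def)
      then have "0 < pixel_gap N A \<phi> v (m + v) x" using gap[OF a(2) _ False a(3)] nphi by (simp add: v_def)
      then have g: "real L * A * (1 - \<phi> x) < real N * of_int (sqnorm (v - (m + v)) - sqnorm v)"
        unfolding pixel_gap_def nphi L_def by (simp add: algebra_simps)
      have "v - (m + v) = - m" by simp
      then have "sqnorm (v - (m + v)) - sqnorm v \<le> int (k * M\<^sup>2)"
        using sqnorm_le_of_box[OF m(1)] sqnorm_nonneg[of v] sqnorm_minus[of m] unfolding k_def by simp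
      then have "real_of_int (sqnorm (v - (m + v)) - sqnorm v) \<le> real k * (real M)\<^sup>2"
        by (metis of_int_le_iff of_int_of_nat_eq of_nat_mult of_nat_power)
      then have "real N * of_int (sqnorm (v - (m + v)) - sqnorm v) \<le> real N * (real k * (real M)\<^sup>2)"
        by (intro mult_left_mono) auto
      also have "\<dots> \<le> (2 * real L) * (real k * (real M)\<^sup>2)" using L by (intro mult_right_mono) auto
      also have "\<dots> \<le> (2 * real L) * (A / 4)" by (intro mult_left_mono) (auto simp: A_def)
      also have "\<dots> = (real L * A) * (1 / 2)" by simp
      finally have "(real L * A) * (1 - \<phi> x) < (real L * A) * (1 / 2)" using g by linarith
      then have "1 - \<phi> x < 1 / 2" using L A by (simp only: mult_less_cancel_left_pos mult_pos_pos of_nat_0_less_iff less_eq_Suc_le One_nat_def)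
      then show ?thesis by simp
    qed
  qed
  have disj: "a = b \<and> i = j"
    if x: "x \<in> X" and ab: "a \<in> P" "b \<in> P" "i \<in> cube L" "j \<in> cube L"
      and nz: "\<alpha> a (T (- (int L *s a + i)) x) \<noteq> 0" "\<alpha> b (T (- (int L *s b + j)) x) \<noteq> 0" for x a b and i j :: "int^'k"
  proof -
    define v where "v = int L *s a + i"
    define w where "w = int L *s b + j"
    have vw: "v \<in> int_box (L * r + L)" "w \<in> int_box (L * r + L)"
      unfolding v_def w_def using ab by (auto simp: P_def intro: scaled_add_cube_in_box)
    have "v = w"
    proof (rule ccontr)
      assume "v \<noteq> w"
      have act: "1 / 2 < \<phi> (T (- v) x)" "1 / 2 < \<phi> (T (- w) x)"
        using active[OF T_in[OF x] ab(1) nz(1) ab(3)] active[OF T_in[OF x] ab(2) nz(2) ab(4)] by (simp_all add: v_def w_def)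
      have Tvw: "T (v - w) (T (- v) x) = T (- w) x" "T (w - v) (T (- w) x) = T (- v) x"
        using T_add[OF x, of "v - w" "- v"] T_add[OF x, of "w - v" "- w"] by simp_all
      have "v - w \<in> int_box B" "w - v \<in> int_box B"
        using int_box_diff[OF vw] int_box_diff[OF vw(2,1)] int_box_mono[of "(L * r + L) + (L * r + L)" B]
        by (auto simp: B_def)
      then have "0 < pixel_gap N A \<phi> v (v - w) (T (- v) x)" "0 < pixel_gap N A \<phi> w (w - v) (T (- w) x)"
        using gap[OF nz(1) _ _ ab(3)] gap[OF nz(2) _ _ ab(4)] \<open>v \<noteq> w\<close> act unfolding v_def[symmetric] w_def[symmetric] Tvw
        by (simp_all add: Tvw)
      \<comment> \<open>The gaps are negatives of each other: they compare the powers of the same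
        two sites with the roles exchanged.\<close>
      then show False unfolding pixel_gap_def Tvw by (simp add: algebra_simps)
    qed
    then show ?thesis using scaled_add_cube_unique ab(3,4) unfolding v_def w_def by blast
  qed
  have full: "\<exists>n. \<exists>a\<in>P. \<exists>j\<in>cube N. \<alpha> a (T n x) = 1 \<and> j + int N *s a + n = 0" if x: "x \<in> X" for x
  proof -
    \<comment> \<open>The power of the origin with respect to the site \<open>n\<close> in the
      unscaled diagram; a site of least power owns the origin.\<close>
    define val where "val = (\<lambda>n. of_int (sqnorm n) + A * (1 - \<phi> (T n x)))"
    define C where "C = {n \<in> int_box r. \<phi> (T n x) \<noteq> 0}"
    obtain m where m: "m \<in> int_box M" "\<phi> (T m x) = 1" using cover[OF x] by blast
    have "M \<le> r" using k by (simp add: r_def)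
    then have mC: "m \<in> C" using m int_box_mono[of M r] by (auto simp: C_def)
    have "finite C" unfolding C_def by (rule finite_subset[OF _ finite_int_box[of r]]) auto
    then obtain n where n: "n \<in> C" "\<And>n'. n' \<in> C \<Longrightarrow> val n \<le> val n'"
    proof -
      have "C \<noteq> {}" using mC by blast
      then obtain n where "n \<in> C" "\<not> (\<exists>y. y \<in> C \<and> val y < val n)"
        using ex_is_arg_min_if_finite[OF \<open>finite C\<close>, of val] unfolding is_arg_min_def by blast
      then show thesis by (intro that[of n]) (auto simp: not_less)
    qed
    have min: "val n \<le> val n'" if "\<phi> (T n' x) \<noteq> 0" for n'
    proof (cases "n' \<in> int_box r")
      case True
      then show ?thesis using n(2) that by (simp add: C_def)
    next
      case False
      have "val n \<le> val m" using n(2) mC by simp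
      also have "val m = of_int (sqnorm m)" using m by (simp add: val_def)
      also have "\<dots> \<le> of_int (sqnorm n')"
        using sqnorm_le_of_box[OF m(1)] sqnorm_gt_of_not_box[of n' M] False unfolding r_def k_def of_int_le_iff by linarith
      also have "\<dots> \<le> val n'" using A bounds[OF T_in[OF x]] by (simp add: val_def)
      finally show ?thesis .
    qed
    \<comment> \<open>Seen from the site \<open>n\<close> the origin is at \<open>- n\<close>, and
      the quotient by \<open>N\<close> names the window that contains it.\<close>
    define a where "a = (\<chi> i. (- n $ i) div int N)"
    define j where "j = (\<chi> i. (- n $ i) mod int N)"
    have jN: "j \<in> cube N" using N by (auto simp: j_def cube_def)
    have njN: "j + int N *s a + n = 0" by (simp add: vec_eq_iff a_def j_def)
    have "\<bar>(- n $ i) div int N\<bar> \<le> \<bar>n $ i\<bar>" for i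
    proof -
      have "\<bar>m div int N\<bar> \<le> \<bar>m\<bar>" for m
      proof (cases "0 \<le> m")
        case True
        then show ?thesis using zdiv_mono2[of m 1 "int N"] N by (simp add: pos_imp_zdiv_nonneg_iff)
      next
        case False
        have "m \<le> m div int N" using False N zdiv_mono2_neg[of m 1 "int N"] by simp
        moreover have "m div int N < 0" using False N by (simp add: div_neg_pos_less0)
        ultimately show ?thesis by linarith
      qed
      from this[of "- n $ i"] show ?thesis by simp
    qed
    moreover have "\<bar>n $ i\<bar> \<le> int r" for i using n(1) by (simp add: C_def int_box_def)
    ultimately have aP: "a \<in> P" unfolding P_def int_box_def a_def using order_trans by fastforce
    define y where "y = T n x"
    have y: "y \<in> X" "\<phi> y \<noteq> 0" using n(1) T_in[OF x] by (simp_all add: y_def C_def)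
    have "clamp01 (max (pixel_gap N A \<phi> (int L *s a + i) n' y) (1 - 2 * \<phi> (T n' y))) = 1"
      if n': "n' \<noteq> 0" and i: "i \<in> cube L" for n' i
    proof (cases "\<phi> (T n' y) = 0")
      case True
      then show ?thesis by (intro clamp01(4)) simp
    next
      case False
      have out: "n' \<notin> int_box (2 * (N * L) * CARD('k) + 1)"
      proof
        assume b: "n' \<in> int_box (2 * (N * L) * CARD('k) + 1)"
        have "\<phi> (T 0 y) \<noteq> 0" using y T_0 by simp
        then have "n' = 0" using marker_separated[OF marker y(1) _ False] b by simp
        then show False using n' by simp
      qed
      have Tn: "T n' y = T (n' + n) x" using T_add[OF x] by (simp add: y_def)
      then have "val n \<le> val (n' + n)" using min False by simp
      then have 1: "of_int (sqnorm n) - of_int (sqnorm (n' + n)) \<le> A * (\<phi> y - \<phi> (T n' y))"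
        by (simp add: val_def Tn y_def[symmetric] algebra_simps)
      define v where "v = int L *s a + i"
      \<comment> \<open>Shrinking towards the site sends the origin, at \<open>- n\<close>, to
        \<open>- n * L / N\<close>. So \<open>e / N\<close> is the rounding error of the pixel site
        \<open>v\<close>, bounded independently of \<open>a\<close>.\<close>
      define e where "e = int N *s v + int L *s n"
      have ei: "e $ t = int N * i $ t - int L * j $ t" for t
      proof -
        have "n $ t = - (j $ t + int N * a $ t)" using arg_cong[OF njN, of "\<lambda>v. v $ t"] by simp
        then have n: "n $ t = - (j $ t + int N * a $ t)" .
        show ?thesis unfolding e_def v_def vector_add_component vector_smult_component n by algebra
      qed
      have "\<bar>e $ t\<bar> \<le> int (N * L)" for t
      proof -
        have it: "0 \<le> i $ t" "i $ t \<le> int L" and jt: "0 \<le> j $ t" "j $ t \<le> int N"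
          using i jN by (auto simp: cube_def less_imp_le)
        have "0 \<le> int N * i $ t" "int N * i $ t \<le> int N * int L" "0 \<le> int L * j $ t" "int L * j $ t \<le> int L * int N"
          using it jt by (auto intro!: mult_left_mono)
        then show ?thesis unfolding ei by (simp add: mult.commute abs_le_iff)
      qed
      then have 2: "1 \<le> sqnorm n' - 2 * dotprod e n'" using sqnorm_dominates_dotprod[OF out] by blast
      have "dotprod e n' = int N * dotprod v n' + int L * dotprod n n'" unfolding e_def by (rule dotprod_linear)
      \<comment> \<open>Here \<open>N - L = 1\<close> leaves one full copy of
        \<open>sqnorm n'\<close>. This is the room gained by scaling, and it outweighs the rounding
        error because competing markers are far away.\<close>
      then have id: "int N * (sqnorm (v - n') - sqnorm v) + int L * (sqnorm n - sqnorm (n' + n)) = sqnorm n' - 2 * dotprod e n'"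
      proof -
        have "int N = int L + 1" "n' + n = n + n'" using L(2) by simp_all
        then show ?thesis unfolding \<open>dotprod e n' = _\<close> sqnorm_diff \<open>n' + n = n + n'\<close> sqnorm_add by algebra
      qed
      have "1 \<le> real_of_int (int N * (sqnorm (v - n') - sqnorm v) + int L * (sqnorm n - sqnorm (n' + n)))"
        using 2 unfolding id by linarith
      also have "\<dots> = real N * of_int (sqnorm (v - n') - sqnorm v) + real L * (of_int (sqnorm n) - of_int (sqnorm (n' + n)))" by simp
      also have "\<dots> \<le> real N * of_int (sqnorm (v - n') - sqnorm v) + real L * (A * (\<phi> y - \<phi> (T n' y)))"
        using 1 by (intro add_left_mono mult_left_mono) auto
      also have "\<dots> = pixel_gap N A \<phi> v n' y" by (simp add: pixel_gap_def L_def)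
      finally show ?thesis unfolding v_def by (intro clamp01(4)) simp
    qed
    then have "\<alpha> a y = 1" unfolding \<alpha>_def pixel_weight_def L_def by (intro prod.neutral ballI) auto
    then show ?thesis using aP jN njN unfolding y_def by blast
  qed
  have det: "\<alpha> a x = \<alpha> a y" if "x \<in> X" "y \<in> X" "\<forall>n. \<phi> (T n x) = \<phi> (T n y)" for a x y
  proof -
    have "\<phi> x = \<phi> y" using that T_0 by metis
    then show ?thesis using that(3) by (simp add: \<alpha>_def pixel_weight_def pixel_gap_def)
  qed
  show ?thesis
  proof (rule exI[of _ P], rule exI[of _ \<alpha>], intro conjI)
    show "finite P" unfolding P_def by (rule finite_int_box)
    show "\<forall>a. continuous_on X (\<alpha> a)" unfolding \<alpha>_def using continuous_on_pixel_weight[OF cont] by blast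
    show "\<forall>a x. 0 \<le> \<alpha> a x \<and> \<alpha> a x \<le> 1" unfolding \<alpha>_def using pixel_weight_bounds by blast
    show "\<forall>a. \<forall>x\<in>X. \<forall>y\<in>X. (\<forall>n. \<phi> (T n x) = \<phi> (T n y)) \<longrightarrow> \<alpha> a x = \<alpha> a y"
      by (intro allI ballI impI) (rule det)
    show "\<forall>x\<in>X. \<forall>a\<in>P. \<forall>b\<in>P. \<forall>i\<in>cube L. \<forall>j\<in>cube L.
       \<alpha> a (T (- (int L *s a + i)) x) \<noteq> 0 \<longrightarrow> \<alpha> b (T (- (int L *s b + j)) x) \<noteq> 0 \<longrightarrow> a = b \<and> i = j"
      by (intro ballI impI) (rule disj)
    show "\<forall>x\<in>X. \<exists>n. \<exists>a\<in>P. \<exists>j\<in>cube N. \<alpha> a (T n x) = 1 \<and> j + int N *s a + n = 0"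
      by (intro ballI) (rule full)
  qed
qed

end

section \<open>Embedding\<close>

lemma convex_combination_near:
  fixes p a :: "'v \<Rightarrow> real"
  assumes "finite V" "\<And>v. v \<in> V \<Longrightarrow> 0 \<le> p v" "sum p V = 1"
    and "\<And>v. v \<in> V \<Longrightarrow> p v \<noteq> 0 \<Longrightarrow> \<bar>a v - c\<bar> \<le> r"
  shows "\<bar>(\<Sum>v\<in>V. p v * a v) - c\<bar> \<le> r"
proof -
  have "(\<Sum>v\<in>V. p v * a v) - c = (\<Sum>v\<in>V. p v * (a v - c))"
    using assms(3) by (simp add: right_diff_distrib sum_subtractf flip: sum_distrib_right)
  also have "\<bar>\<dots>\<bar> \<le> (\<Sum>v\<in>V. \<bar>p v * (a v - c)\<bar>)" by (rule sum_abs)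
  also have "\<dots> \<le> (\<Sum>v\<in>V. p v * r)"
  proof (rule sum_mono)
    fix v assume v: "v \<in> V"
    show "\<bar>p v * (a v - c)\<bar> \<le> p v * r"
      using assms(2)[OF v] assms(4)[OF v] by (cases "p v = 0") (auto simp: abs_mult intro!: mult_left_mono)
  qed
  also have "\<dots> = r" using assms(3) by (simp flip: sum_distrib_right)
  finally show ?thesis .
qed

lemma sum_at_most_one:
  fixes t :: "'q \<Rightarrow> real"
  assumes "finite Q" "\<And>q q'. q \<in> Q \<Longrightarrow> q' \<in> Q \<Longrightarrow> t q \<noteq> 0 \<Longrightarrow> t q' \<noteq> 0 \<Longrightarrow> q = q'"
  shows "sum t Q = 0 \<or> (\<exists>q\<in>Q. sum t Q = t q)"
proof (cases "\<exists>q\<in>Q. t q \<noteq> 0")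
  case True
  then obtain q where q: "q \<in> Q" "t q \<noteq> 0" by blast
  have "sum t Q = sum t {q}" using assms(2) q by (intro sum.mono_neutral_right[OF assms(1)]) blast+
  then show ?thesis using q(1) by auto
qed (auto intro: sum.neutral)

context zk_system
begin

text \<open>Small fibres of \<open>f\<close> do not make preimages of stars small. By compactness,
  points that are \<open>\<epsilon>\<close> apart on the window have images a definite distance
  apart, so in a fine edgewise subdivision no star contains both images; and no point acquires more
  support vertices than it had in \<open>K\<close>.\<close>

lemma fine_partition_of_unity:
  assumes N: "1 \<le> N" and \<epsilon>: "\<epsilon> > 0"
  shows "\<exists>(V :: (nat \<Rightarrow> int) set) \<pi>. finite V \<and> (\<forall>v. continuous_on X (\<pi> v)) \<and> (\<forall>v x. 0 \<le> \<pi> v x) \<and>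
    (\<forall>x\<in>X. (\<Sum>v\<in>V. \<pi> v x) = (1::real)) \<and> (\<forall>x\<in>X. card {v \<in> V. \<pi> v x \<noteq> 0} \<le> widim X T N \<epsilon> + 1) \<and>
    (\<forall>v\<in>V. \<forall>x\<in>X. \<forall>y\<in>X. \<pi> v x \<noteq> 0 \<longrightarrow> \<pi> v y \<noteq> 0 \<longrightarrow> (\<forall>n\<in>cube N. dist (T n x) (T n y) < \<epsilon>))"
proof -
  obtain K f where K: "simplicial_cx K" "\<And>\<sigma>. \<sigma> \<in> K \<Longrightarrow> card \<sigma> \<le> widim X T N \<epsilon> + 1"
     "\<And>v. continuous_on X (\<lambda>x. f x v)" "\<And>x. x \<in> X \<Longrightarrow> f x \<in> realization K"
     and fib: "\<And>z. z \<in> X \<Longrightarrow> \<exists>e<\<epsilon>. \<forall>x\<in>X. \<forall>y\<in>X. f x = f z \<longrightarrow> f y = f z \<longrightarrow> (\<forall>n\<in>cube N. dist (T n x) (T n y) \<le> e)"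
    using window_embedding_widim[OF assms] unfolding window_embedding_def by blast
  obtain m where m: "\<And>p. p \<in> realization K \<Longrightarrow> simplex_point m p"
    using realization_simplex_point[OF K(1)] by blast
  have sp: "simplex_point m (f x)" if "x \<in> X" for x using m K(4) that by blast
  define S where "S = (\<Union>n\<in>cube N. {p \<in> X \<times> X. \<epsilon> \<le> dist (T n (fst p)) (T n (snd p))})"
  define G where "G = (\<lambda>p. \<Sum>v<m. \<bar>f (fst p) v - f (snd p) v\<bar>)"
  have comp: "continuous_on (X \<times> X) (\<lambda>p. g (fst p))" "continuous_on (X \<times> X) (\<lambda>p. g (snd p))"
    if "continuous_on X g" for g :: "'a \<Rightarrow> 'b::topological_space"
    using that by (auto intro!: continuous_on_compose2[OF that] continuous_intros)
  have "compact S"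
    unfolding S_def
  proof (intro compact_UN)
    show "finite (cube N :: (int^'k) set)" by (rule finite_cube)
    fix n :: "int^'k"
    have "closedin (top_of_set (X \<times> X)) (X \<times> X \<inter> (\<lambda>p. dist (T n (fst p)) (T n (snd p))) -` {\<epsilon>..})"
      by (intro continuous_closedin_preimage continuous_on_dist comp continuous_on_T) auto
    moreover have "X \<times> X \<inter> (\<lambda>p. dist (T n (fst p)) (T n (snd p))) -` {\<epsilon>..} =
        {p \<in> X \<times> X. \<epsilon> \<le> dist (T n (fst p)) (T n (snd p))}" by auto
    ultimately have "closedin (top_of_set (X \<times> X)) {p \<in> X \<times> X. \<epsilon> \<le> dist (T n (fst p)) (T n (snd p))}"
      by (simp only:)
    then show "compact {p \<in> X \<times> X. \<epsilon> \<le> dist (T n (fst p)) (T n (snd p))}"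
      by (rule closedin_compact[OF compact_Times[OF compact_X compact_X]])
  qed
  have SX: "S \<subseteq> X \<times> X" by (auto simp: S_def)
  \<comment> \<open>The family is constant in \<open>n\<close>: only the uniform lower bound is
    wanted.\<close>
  have "\<exists>q. \<forall>p\<in>S. \<exists>n\<in>int_box q. (\<lambda>_::int^'k. G) n p > 1 / (real q + 1)"
  proof (rule compact_uniformly_positive[OF \<open>compact S\<close>])
    have "continuous_on (X \<times> X) G"
      unfolding G_def by (intro continuous_intros comp K(3))
    then show "continuous_on S G" using SX continuous_on_subset by blast
    fix p assume p: "p \<in> S"
    obtain x y where xy: "p = (x, y)" "x \<in> X" "y \<in> X" using p SX by blast
    obtain n where n: "n \<in> cube N" "\<epsilon> \<le> dist (T n x) (T n y)" using p xy unfolding S_def by auto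
    have "G p \<noteq> 0"
    proof
      assume "G p = 0"
      then have "\<forall>v<m. f x v = f y v" unfolding G_def xy(1) by (simp add: sum_nonneg_eq_0_iff)
      moreover have "\<forall>v. \<not> v < m \<longrightarrow> f x v = f y v" using sp[OF xy(2)] sp[OF xy(3)] unfolding simplex_point_def by metis
      ultimately have "f x = f y" by (intro ext) blast
      then show False using fib[OF xy(2)] xy n by (metis not_le order_le_less_trans)
    qed
    moreover have "0 \<le> G p" by (simp add: G_def sum_nonneg)
    ultimately show "\<exists>n::int^'k. 0 < G p" by simp
  qed
  then obtain q :: nat where q: "\<And>p. p \<in> S \<Longrightarrow> G p > 1 / (real q + 1)" by blast
  \<comment> \<open>The star bound \<open>4 / r\<close>, summed over \<open>m\<close> coordinates,
    must be at most \<open>1 / (q + 1)\<close>; the final 1 keeps \<open>r\<close> positive.\<close>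
  define r where "r = 4 * m * (q + 1) + 1"
  define V where "V = edge_vertices m r"
  define \<pi> where "\<pi> = (\<lambda>v x. edge_weight m r v (f x))"
  have "dist (T n x) (T n y) < \<epsilon>" if "v \<in> V" "x \<in> X" "y \<in> X" "\<pi> v x \<noteq> 0" "\<pi> v y \<noteq> 0" "n \<in> cube N" for v x y n
  proof (rule ccontr)
    assume "\<not> dist (T n x) (T n y) < \<epsilon>"
    then have "\<epsilon> \<le> dist (T n x) (T n y)" by (rule leI)
    then have "(x, y) \<in> S" using that unfolding S_def by (intro UN_I[of n]) auto
    then have "1 / (real q + 1) < (\<Sum>u<m. \<bar>f x u - f y u\<bar>)" using q[of "(x, y)"] by (simp add: G_def)
    also have "\<dots> \<le> (\<Sum>u<m. 4 / real r)"
      using that unfolding \<pi>_def by (intro sum_mono edge_weight_star_small[of m r v]) (auto simp: r_def)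
    also have "\<dots> = 4 * real m / real r" by simp
    also have "\<dots> \<le> 1 / (real q + 1)"
    proof -
      have "4 * real m * (real q + 1) \<le> real r" unfolding r_def by (simp add: algebra_simps)
      moreover have "0 < real r" unfolding r_def by (simp only: of_nat_0_less_iff)
      ultimately show ?thesis by (simp add: field_simps)
    qed
    finally show False by simp
  qed
  moreover have "card {v \<in> V. \<pi> v x \<noteq> 0} \<le> widim X T N \<epsilon> + 1" if "x \<in> X" for x
  proof -
    have "{v. f x v \<noteq> 0} \<in> K" using K(4)[OF that] unfolding realization_def by simp
    then show ?thesis using edge_weight_support_card[OF sp[OF that], of r] K(2) unfolding V_def \<pi>_def by force
  qed
  moreover have "continuous_on X (\<pi> v)" for v unfolding \<pi>_def by (intro continuous_on_edge_weight K(3))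
  moreover have "(\<Sum>v\<in>V. \<pi> v x) = 1" if "x \<in> X" for x unfolding V_def \<pi>_def by (rule edge_weight_sum[OF sp[OF that]])
  moreover have "0 \<le> \<pi> v x" for v x by (simp add: \<pi>_def edge_weight_def)
  moreover have "finite V" unfolding V_def by (rule finite_edge_vertices)
  ultimately show ?thesis by (intro exI[of _ V] exI[of _ \<pi>] conjI) blast+
qed

lemma uniform_modulus:
  fixes f :: "nat \<Rightarrow> 'a \<Rightarrow> real"
  assumes "\<And>i. i < D \<Longrightarrow> continuous_on X (f i)" "e > 0"
  shows "\<exists>\<delta>>0. \<forall>i<D. \<forall>x\<in>X. \<forall>y\<in>X. dist x y < \<delta> \<longrightarrow> \<bar>f i x - f i y\<bar> < e"
  using assms(1)
proof (induction D)
  case 0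
  then show ?case by (intro exI[of _ 1]) auto
next
  case (Suc D)
  then obtain \<delta> where \<delta>: "\<delta> > 0" "\<forall>i<D. \<forall>x\<in>X. \<forall>y\<in>X. dist x y < \<delta> \<longrightarrow> \<bar>f i x - f i y\<bar> < e" by auto
  have "uniformly_continuous_on X (f D)"
    using compact_uniformly_continuous Suc.prems compact_X by blast
  then obtain \<delta>' where \<delta>': "\<delta>' > 0" "\<And>x y. x \<in> X \<Longrightarrow> y \<in> X \<Longrightarrow> dist y x < \<delta>' \<Longrightarrow> dist (f D y) (f D x) < e"
    using uniformly_continuous_onE[of X "f D" e] assms(2) by metis
  have "\<forall>x\<in>X. \<forall>y\<in>X. dist x y < \<delta>' \<longrightarrow> \<bar>f D x - f D y\<bar> < e"
    using \<delta>'(2) by (auto simp: dist_real_def)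
  then show ?case using \<delta> \<delta>'(1) by (intro exI[of _ "min \<delta> \<delta>'"]) (auto simp: less_Suc_eq)
qed

text \<open>The density half of the category argument, with \<open>h\<close> held fixed. Equal codes
  give equal markers, hence equal pixel weights, so on a full pixel both points show the same linear
  combination of vertex vectors. General position forces equal coefficients, and points sharing a
  vertex at the window are less than \<open>\<epsilon>\<close> apart on it.\<close>

lemma perturbation:
  fixes h :: "'a \<Rightarrow> real" and f :: "nat \<Rightarrow> 'a \<Rightarrow> real"
  assumes code: "\<And>R. \<exists>M \<phi>. marker R M \<phi> \<and> (\<forall>x\<in>X. \<forall>y\<in>X. (\<forall>n. h (T n x) = h (T n y)) \<longrightarrow> \<phi> x = \<phi> y)"
    and mdim: "mdim X T < ereal (real D / 4)"
    and f: "\<And>i. i < D \<Longrightarrow> continuous_on X (f i)" "\<And>i x. i < D \<Longrightarrow> x \<in> X \<Longrightarrow> 0 \<le> f i x \<and> f i x \<le> 1"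
    and \<eta>: "0 < \<eta>" "\<eta> \<le> 1" and \<delta>: "0 < \<delta>"
  shows "\<exists>g. (\<forall>i<D. continuous_on X (g i) \<and> (\<forall>x\<in>X. 0 \<le> g i x \<and> g i x \<le> 1 \<and> \<bar>g i x - f i x\<bar> < \<eta>)) \<and>
    (\<forall>x\<in>X. \<forall>y\<in>X. (\<forall>n. h (T n x) = h (T n y)) \<longrightarrow> (\<forall>n. \<forall>i<D. g i (T n x) = g i (T n y)) \<longrightarrow> dist x y < \<delta>)"
proof -
  \<comment> \<open>Error budget: \<open>e\<close> for the modulus of continuity, \<open>e\<close>
    for clamping, \<open>e / 2\<close> for general position and \<open>e / 2\<close> for the window
    sum, together \<open>3 * e < \<eta>\<close>.\<close>
  define e where "e = \<eta> / 4"
  have e: "0 < e" "e \<le> 1 / 4" "3 * e < \<eta>" using \<eta> by (auto simp: e_def)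
  obtain \<epsilon>1 where \<epsilon>1: "\<epsilon>1 > 0" "\<And>i x y. i < D \<Longrightarrow> x \<in> X \<Longrightarrow> y \<in> X \<Longrightarrow> dist x y < \<epsilon>1 \<Longrightarrow> \<bar>f i x - f i y\<bar> < e"
  proof -
    have "\<exists>\<delta>>0. \<forall>i<D. \<forall>x\<in>X. \<forall>y\<in>X. dist x y < \<delta> \<longrightarrow> \<bar>f i x - f i y\<bar> < e"
      by (rule uniform_modulus[OF _ e(1)]) (rule f(1))
    then obtain d where d: "d > 0" "\<forall>i<D. \<forall>x\<in>X. \<forall>y\<in>X. dist x y < d \<longrightarrow> \<bar>f i x - f i y\<bar> < e" by blast
    show thesis using d(2) by (intro that[OF d(1)]) blast
  qed
  define \<epsilon> where "\<epsilon> = min \<epsilon>1 \<delta>"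
  have \<epsilon>: "\<epsilon> > 0" "\<epsilon> \<le> \<epsilon>1" "\<epsilon> \<le> \<delta>" using \<epsilon>1 \<delta> by (auto simp: \<epsilon>_def)
  obtain N where N: "2 \<le> N" "4 * (widim X T N \<epsilon> + 1) \<le> D * (N - 1) ^ CARD('k)"
    using widim_small[OF mdim \<epsilon>(1)] by blast
  define L where "L = N - 1"
  have N1: "1 \<le> N" using N(1) by simp
  obtain V :: "(nat \<Rightarrow> int) set" and \<pi> :: "(nat \<Rightarrow> int) \<Rightarrow> 'a \<Rightarrow> real"
    where V: "finite V" and *: "\<forall>v. continuous_on X (\<pi> v)" "\<forall>v x. 0 \<le> \<pi> v x" "\<forall>x\<in>X. (\<Sum>v\<in>V. \<pi> v x) = 1"
      "\<forall>x\<in>X. card {v \<in> V. \<pi> v x \<noteq> 0} \<le> widim X T N \<epsilon> + 1"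
      "\<forall>v\<in>V. \<forall>x\<in>X. \<forall>y\<in>X. \<pi> v x \<noteq> 0 \<longrightarrow> \<pi> v y \<noteq> 0 \<longrightarrow> (\<forall>n\<in>cube N. dist (T n x) (T n y) < \<epsilon>)"
    using fine_partition_of_unity[OF N1 \<epsilon>(1)] by (elim exE conjE) (rule that; assumption)
  have cont\<pi>: "\<And>v. continuous_on X (\<pi> v)"
    and \<pi>0: "\<And>v x. 0 \<le> \<pi> v x" and \<pi>1: "\<And>x. x \<in> X \<Longrightarrow> (\<Sum>v\<in>V. \<pi> v x) = 1"
    and \<pi>card: "\<And>x. x \<in> X \<Longrightarrow> card {v \<in> V. \<pi> v x \<noteq> 0} \<le> widim X T N \<epsilon> + 1"
    using * by blast+
  have \<pi>star: "dist (T n x) (T n y) < \<epsilon>"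
    if "v \<in> V" "x \<in> X" "y \<in> X" "\<pi> v x \<noteq> 0" "\<pi> v y \<noteq> 0" "n \<in> cube N" for v x y n
    using *(5) that by blast
  obtain M \<phi> where \<phi>: "marker (2 * (N * L) * CARD('k) + 1) M \<phi>"
     "\<And>x y. x \<in> X \<Longrightarrow> y \<in> X \<Longrightarrow> (\<forall>n. h (T n x) = h (T n y)) \<Longrightarrow> \<phi> x = \<phi> y"
    using code by blast
  obtain P :: "(int^'k) set" and \<alpha> :: "int^'k \<Rightarrow> 'a \<Rightarrow> real"
    where P: "finite P" and *: "\<forall>a. continuous_on X (\<alpha> a)" "\<forall>a x. 0 \<le> \<alpha> a x \<and> \<alpha> a x \<le> 1"
      "\<forall>a. \<forall>x\<in>X. \<forall>y\<in>X. (\<forall>n. \<phi> (T n x) = \<phi> (T n y)) \<longrightarrow> \<alpha> a x = \<alpha> a y"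
      "\<forall>x\<in>X. \<forall>a\<in>P. \<forall>b\<in>P. \<forall>i\<in>cube L. \<forall>j\<in>cube L.
         \<alpha> a (T (- (int L *s a + i)) x) \<noteq> 0 \<longrightarrow> \<alpha> b (T (- (int L *s b + j)) x) \<noteq> 0 \<longrightarrow> a = b \<and> i = j"
      "\<forall>x\<in>X. \<exists>n. \<exists>a\<in>P. \<exists>j\<in>cube N. \<alpha> a (T n x) = 1 \<and> j + int N *s a + n = 0"
    using exists_tiling[OF N(1) \<phi>(1)[unfolded L_def]] unfolding L_def[symmetric]
    by (elim exE conjE) (rule that; assumption)
  have cont\<alpha>: "\<And>a. continuous_on X (\<alpha> a)"
    and \<alpha>01: "\<And>a x. 0 \<le> \<alpha> a x" "\<And>a x. \<alpha> a x \<le> 1"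
    and \<alpha>cover: "\<And>x. x \<in> X \<Longrightarrow> \<exists>n. \<exists>a\<in>P. \<exists>j\<in>cube N. \<alpha> a (T n x) = 1 \<and> j + int N *s a + n = 0"
    using *(1,2,5) by simp_all
  have \<alpha>det: "\<alpha> a x = \<alpha> a y" if "x \<in> X" "y \<in> X" "\<forall>n. \<phi> (T n x) = \<phi> (T n y)" for a x y
    using *(3) that by blast
  have \<alpha>disj: "a = b \<and> i = j" if "x \<in> X" "a \<in> P" "b \<in> P" "i \<in> cube L" "j \<in> cube L"
      "\<alpha> a (T (- (int L *s a + i)) x) \<noteq> 0" "\<alpha> b (T (- (int L *s b + j)) x) \<noteq> 0" for x a b i j
    using *(4) that by blast
  define I where "I = {..<D} \<times> (cube L :: (int^'k) set)"
  have I: "finite I" "card I = D * L ^ CARD('k)" unfolding I_def by (simp_all add: finite_cube card_cube)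
  define pt where "pt = (\<lambda>v. SOME x. x \<in> X \<and> \<pi> v x \<noteq> 0)"
  have pt: "pt v \<in> X" "\<pi> v (pt v) \<noteq> 0" if "x \<in> X" "\<pi> v x \<noteq> 0" for v x
    using someI_ex[of "\<lambda>x. x \<in> X \<and> \<pi> v x \<noteq> 0"] that unfolding pt_def by blast+
  \<comment> \<open>The tag \<open>False\<close> belongs to the pixel: values of \<open>f\<close> at
    a representative of the vertex, clamped so that the perturbation and the window sum cannot leave
    the unit interval. The tag \<open>True\<close> belongs to the window: its target 0 barely
    disturbs the approximation, yet after perturbation these vectors are as generic as the
    others.\<close>
  define b where "b = (\<lambda>(v, t) (i, j). if t then 0 else max e (min (1 - e) (f i (T j (pt v)))))"
  obtain A :: "(nat \<Rightarrow> int) \<times> bool \<Rightarrow> nat \<times> (int^'k) \<Rightarrow> real"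
    where A: "\<And>w ij. w \<in> V \<times> UNIV \<Longrightarrow> ij \<in> I \<Longrightarrow> \<bar>A w ij - b w ij\<bar> < e / 2"
      and indep: "\<And>c S. S \<subseteq> V \<times> UNIV \<Longrightarrow> card S \<le> card I \<Longrightarrow> (\<forall>ij\<in>I. (\<Sum>w\<in>S. c w * A w ij) = 0) \<Longrightarrow> \<forall>w\<in>S. c w = 0"
    using general_position[of "V \<times> (UNIV :: bool set)" I "e / 2" b] V I(1) e(1) by auto
  define \<pi>' where "\<pi>' = (\<lambda>(v, t) a z. \<pi> v (T ((if t then int N else int L) *s a) z))"
  define F where "F = (\<lambda>i j a z. \<Sum>w\<in>V \<times> UNIV. \<pi>' w a z * A w (i, j))"
  have Fsplit: "F i j a z = (\<Sum>v\<in>V. \<pi> v (T (int L *s a) z) * A (v, False) (i, j)) + (\<Sum>v\<in>V. \<pi> v (T (int N *s a) z) * A (v, True) (i, j))" for i j a z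
  proof -
    have "F i j a z = (\<Sum>v\<in>V. \<Sum>t\<in>UNIV. \<pi>' (v, t) a z * A (v, t) (i, j))"
      unfolding F_def sum.cartesian_product by (simp add: split_def)
    also have "\<dots> = (\<Sum>v\<in>V. \<pi>' (v, False) a z * A (v, False) (i, j) + \<pi>' (v, True) a z * A (v, True) (i, j))"
      by (simp add: UNIV_bool)
    finally show ?thesis by (simp add: \<pi>'_def sum.distrib)
  qed
  have F: "0 \<le> F i j a z \<and> F i j a z \<le> 1 \<and> \<bar>F i j a z - f i (T (int L *s a + j) z)\<bar> \<le> 3 * e"
    if i: "i < D" and j: "j \<in> cube L" and z: "z \<in> X" for i j a z
  proof -
    have ij: "(i, j) \<in> I" using i j by (simp add: I_def)
    let ?y = "T (int L *s a) z"
    have y: "?y \<in> X" using T_in[OF z] .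
    have "int L \<le> int N" by (simp add: L_def)
    then have jN: "j \<in> cube N" using j unfolding cube_def by (blast intro: less_le_trans)
    have Ty: "T (int L *s a + j) z = T j ?y" using T_add[OF z, of j "int L *s a"] by (simp add: add.commute)
    have "\<bar>(\<Sum>v\<in>V. \<pi> v ?y * A (v, False) (i, j)) - 1 / 2\<bar> \<le> 1 / 2 - e / 2"
    proof (rule convex_combination_near[OF V])
      fix v assume v: "v \<in> V"
      have "e \<le> b (v, False) (i, j)" "b (v, False) (i, j) \<le> 1 - e" using e by (auto simp: b_def)
      moreover have "\<bar>A (v, False) (i, j) - b (v, False) (i, j)\<bar> < e / 2" using A v ij by blast
      ultimately show "\<bar>A (v, False) (i, j) - 1 / 2\<bar> \<le> 1 / 2 - e / 2" by linarith
    qed (use \<pi>0 \<pi>1 y in auto)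
    moreover have B: "\<bar>(\<Sum>v\<in>V. \<pi> v (T (int N *s a) z) * A (v, True) (i, j)) - 0\<bar> \<le> e / 2"
    proof (rule convex_combination_near[OF V])
      fix v assume v: "v \<in> V"
      have "b (v, True) (i, j) = 0" by (simp add: b_def)
      then show "\<bar>A (v, True) (i, j) - 0\<bar> \<le> e / 2" using A[of "(v, True)" "(i, j)"] v ij by auto
    qed (use \<pi>0 \<pi>1[OF T_in[OF z]] in auto)
    moreover have "\<bar>(\<Sum>v\<in>V. \<pi> v ?y * A (v, False) (i, j)) - f i (T j ?y)\<bar> \<le> 5 / 2 * e"
    proof (rule convex_combination_near[OF V])
      fix v assume v: "v \<in> V" and nz: "\<pi> v ?y \<noteq> 0"
      have p: "pt v \<in> X" "\<pi> v (pt v) \<noteq> 0" using pt[OF y nz] .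
      have "dist (T j (pt v)) (T j ?y) < \<epsilon>1" using \<pi>star[OF v p(1) y p(2) nz jN] \<epsilon>(2) by simp
      then have "\<bar>f i (T j (pt v)) - f i (T j ?y)\<bar> < e" using \<epsilon>1(2)[OF i T_in T_in] p y by blast
      moreover have "\<bar>b (v, False) (i, j) - f i (T j (pt v))\<bar> \<le> e"
        using f(2)[OF i T_in[OF p(1)], of j] e by (auto simp: b_def)
      moreover have "\<bar>A (v, False) (i, j) - b (v, False) (i, j)\<bar> < e / 2" using A v ij by blast
      ultimately show "\<bar>A (v, False) (i, j) - f i (T j ?y)\<bar> \<le> 5 / 2 * e" by linarith
    qed (use \<pi>0 \<pi>1 y in auto)
    ultimately show ?thesis unfolding Fsplit Ty by linarith
  qed
  \<comment> \<open>If \<open>x\<close> is site \<open>j\<close> of pixel \<open>a\<close>, the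
    translate \<open>T (- (int L *s a + j)) x\<close> is the point that owns the pixel, and
    \<open>f\<close> is moved towards \<open>F\<close> with the weight \<open>\<alpha>\<close>
    there. At most one pair has nonzero weight, so the sum over \<open>Q\<close> is a continuous way
    of selecting it.\<close>
  define tm where "tm = (\<lambda>i x (a, j). \<alpha> a (T (- (int L *s a + j)) x) * (F i j a (T (- (int L *s a + j)) x) - f i x))"
  define Q where "Q = P \<times> (cube L :: (int^'k) set)"
  have finQ: "finite Q" unfolding Q_def by (intro finite_cartesian_product P finite_cube)
  define g where "g = (\<lambda>i x. f i x + (\<Sum>q\<in>Q. tm i x q))"
  have one: "q = q'" if "x \<in> X" "q \<in> Q" "q' \<in> Q" "\<alpha> (fst q) (T (- (int L *s fst q + snd q)) x) \<noteq> 0"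
     "\<alpha> (fst q') (T (- (int L *s fst q' + snd q')) x) \<noteq> 0" for x q q'
    using \<alpha>disj[OF that(1) _ _ _ _ that(4,5)] that(2,3) by (auto simp: Q_def prod_eq_iff)
  have tm_nz: "\<alpha> (fst q) (T (- (int L *s fst q + snd q)) x) \<noteq> 0" if "tm i x q \<noteq> 0" for i x q
    using that by (auto simp: tm_def case_prod_beta)
  have gprop: "0 \<le> g i x \<and> g i x \<le> 1 \<and> \<bar>g i x - f i x\<bar> < \<eta>" if i: "i < D" and x: "x \<in> X" for i x
  proof -
    have "sum (tm i x) Q = 0 \<or> (\<exists>q\<in>Q. sum (tm i x) Q = tm i x q)"
      using one[OF x] tm_nz by (intro sum_at_most_one finQ) blast
    then show ?thesis
    proof
      assume "sum (tm i x) Q = 0"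
      then show ?thesis using f(2)[OF i x] \<eta>(1) by (simp add: g_def)
    next
      assume "\<exists>q\<in>Q. sum (tm i x) Q = tm i x q"
      then obtain a j where aj: "(a, j) \<in> Q" "sum (tm i x) Q = tm i x (a, j)" by auto
      let ?z = "T (- (int L *s a + j)) x"
      have j: "j \<in> cube L" using aj(1) by (simp add: Q_def)
      have zX: "?z \<in> X" by (rule T_in[OF x])
      have eq: "T (int L *s a + j) ?z = x" using T_inverse(1)[OF x] .
      have Fz: "0 \<le> F i j a ?z" "F i j a ?z \<le> 1" "\<bar>F i j a ?z - f i x\<bar> \<le> 3 * e"
        using F[OF i j zX, of a] unfolding eq by blast+
      define c where "c = \<alpha> a ?z"
      have c: "0 \<le> c" "c \<le> 1" using \<alpha>01 by (auto simp: c_def)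
      have g: "g i x = f i x + c * (F i j a ?z - f i x)" using aj(2) by (simp add: g_def tm_def c_def)
      then have "g i x = (1 - c) * f i x + c * F i j a ?z" by (simp add: algebra_simps)
      then have "0 \<le> g i x" "g i x \<le> 1" using c Fz f(2)[OF i x]
        by (simp, metis add.commute convex_bound_le diff_add_cancel diff_ge_0_iff_ge)
      moreover have "\<bar>g i x - f i x\<bar> \<le> 1 * (3 * e)"       proof -
        have "\<bar>g i x - f i x\<bar> = c * \<bar>F i j a ?z - f i x\<bar>" unfolding g using c by (simp add: abs_mult)
        also have "\<dots> \<le> 1 * (3 * e)" using c Fz(3) by (intro mult_mono) auto
        finally show ?thesis .
      qed
      ultimately show ?thesis using e(3) by simp
    qed
  qed
  have gcont: "continuous_on X (g i)" if i: "i < D" for i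
  proof -
    have "continuous_on X (\<lambda>z. F i j a z)" for j a
      unfolding F_def \<pi>'_def case_prod_beta by (intro continuous_intros continuous_on_T_comp cont\<pi>)
    then show ?thesis unfolding g_def tm_def case_prod_beta
      by (intro continuous_intros continuous_on_T_comp cont\<alpha> f(1)[OF i])
  qed
  have read: "g i (T (int L *s a + j) z) = F i j a z" if i: "i < D" and z: "z \<in> X" and a: "a \<in> P" "j \<in> cube L" "\<alpha> a z = 1" for i a j z
  proof -
    let ?u = "T (int L *s a + j) z"
    have u: "?u \<in> X" using T_in[OF z] .
    have uz: "T (- (int L *s a + j)) ?u = z" using T_inverse(2)[OF z] .
    have ajQ: "(a, j) \<in> Q" using a by (simp add: Q_def)
    have "tm i ?u q = 0" if "q \<in> Q - {(a, j)}" for q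
      using one[OF u _ ajQ, of q] tm_nz[of i ?u q] that a(3) uz by auto
    then have "sum (tm i ?u) Q = sum (tm i ?u) {(a, j)}"
      using ajQ finQ by (intro sum.mono_neutral_right) auto
    then show ?thesis using a(3) uz by (simp add: g_def tm_def)
  qed
  have sep: "dist x y < \<delta>" if x: "x \<in> X" and y: "y \<in> X" and hh: "\<forall>n. h (T n x) = h (T n y)"
      and gg: "\<forall>n. \<forall>i<D. g i (T n x) = g i (T n y)" for x y
  proof -
    obtain n a j0 where n: "a \<in> P" "j0 \<in> cube N" "\<alpha> a (T n x) = 1" "j0 + int N *s a + n = 0"
      using \<alpha>cover[OF x] by blast
    let ?z = "T n x" and ?z' = "T n y"
    have z: "?z \<in> X" "?z' \<in> X" using T_in x y by auto
    have "\<phi> (T m ?z) = \<phi> (T m ?z')" for m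
    proof (rule \<phi>(2))
      show "\<forall>n'. h (T n' (T m ?z)) = h (T n' (T m ?z'))"
        using hh T_add[OF x] T_add[OF y] T_add[OF z(1)] T_add[OF z(2)] by metis
    qed (use T_in z in auto)
    then have \<alpha>1: "\<alpha> a ?z' = 1" using \<alpha>det[OF z] n(3) by metis
    have FF: "F i j a ?z = F i j a ?z'" if "(i, j) \<in> I" for i j
    proof -
      have ij: "i < D" "j \<in> cube L" using that by (auto simp: I_def)
      have "F i j a ?z = g i (T (int L *s a + j) ?z)" using read[OF ij(1) z(1) n(1) ij(2) n(3)] by simp
      also have "\<dots> = g i (T (int L *s a + j) ?z')" using gg ij(1) T_add[OF x] T_add[OF y] by metis
      also have "\<dots> = F i j a ?z'" by (rule read[OF ij(1) z(2) n(1) ij(2) \<alpha>1])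
      finally show ?thesis .
    qed
    define c where "c = (\<lambda>w. \<pi>' w a ?z - \<pi>' w a ?z')"
    define S where "S = {w \<in> V \<times> UNIV. c w \<noteq> 0}"
    have "\<forall>ij\<in>I. (\<Sum>w\<in>S. c w * A w ij) = 0"
    proof
      fix ij assume ij: "ij \<in> I"
      obtain i j where e: "ij = (i, j)" by force
      have "(\<Sum>w\<in>S. c w * A w ij) = (\<Sum>w\<in>V \<times> UNIV. c w * A w ij)"
        unfolding S_def using V by (intro sum.mono_neutral_left) auto
      also have "\<dots> = F i j a ?z - F i j a ?z'"
        by (simp add: F_def c_def e left_diff_distrib sum_subtractf)
      finally show "(\<Sum>w\<in>S. c w * A w ij) = 0" using FF ij e by simp
    qed
    moreover have "card S \<le> card I"
    proof -
      define Z where "Z = (\<lambda>u. {v \<in> V. \<pi> v u \<noteq> 0})"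
      have Z: "finite (Z u)" "u \<in> X \<Longrightarrow> card (Z u) \<le> widim X T N \<epsilon> + 1" for u
        using V \<pi>card by (auto simp: Z_def)
      let ?u1 = "T (int L *s a) ?z" and ?u2 = "T (int L *s a) ?z'" and ?u3 = "T (int N *s a) ?z" and ?u4 = "T (int N *s a) ?z'"
      \<comment> \<open>Nonzero coefficients occur only on four supports, those of two points at the
        pixel and at the window.\<close>
      have "S \<subseteq> (Z ?u1 \<union> Z ?u2) \<times> {False} \<union> (Z ?u3 \<union> Z ?u4) \<times> {True}"
        by (auto simp: S_def c_def \<pi>'_def Z_def split: if_splits)
      then have "card S \<le> card ((Z ?u1 \<union> Z ?u2) \<times> {False} \<union> (Z ?u3 \<union> Z ?u4) \<times> {True})"
        using Z(1) by (intro card_mono) auto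
      also have "\<dots> \<le> card ((Z ?u1 \<union> Z ?u2) \<times> {False}) + card ((Z ?u3 \<union> Z ?u4) \<times> {True})" by (rule card_Un_le)
      also have "\<dots> = card (Z ?u1 \<union> Z ?u2) + card (Z ?u3 \<union> Z ?u4)" by (simp add: card_cartesian_product)
      also have "\<dots> \<le> (card (Z ?u1) + card (Z ?u2)) + (card (Z ?u3) + card (Z ?u4))" by (intro add_mono card_Un_le)
      also have "\<dots> \<le> 4 * (widim X T N \<epsilon> + 1)"
        using Z(2)[of ?u1] Z(2)[of ?u2] Z(2)[of ?u3] Z(2)[of ?u4] T_in z by simp
      also have "\<dots> \<le> card I" using N(2) I(2) by (simp add: L_def)
      finally show ?thesis .
    qed
    ultimately have "\<forall>w\<in>S. c w = 0" by (intro indep) (auto simp: S_def)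
    then have c0: "c w = 0" if "w \<in> V \<times> UNIV" for w using that by (auto simp: S_def)
    let ?u = "T (int N *s a) ?z" and ?u' = "T (int N *s a) ?z'"
    have u: "?u \<in> X" "?u' \<in> X" using T_in z by auto
    \<comment> \<open>The tag \<open>True\<close> now pays off: a vertex of nonzero weight at the
      window of \<open>x\<close> has the same weight at that of \<open>y\<close>.\<close>
    obtain v where v: "v \<in> V" "\<pi> v ?u \<noteq> 0" using \<pi>1[OF u(1)] by (metis sum.neutral zero_neq_one)
    have "\<pi> v ?u' \<noteq> 0" using c0[of "(v, True)"] v by (simp add: c_def \<pi>'_def)
    then have "dist (T j0 ?u) (T j0 ?u') < \<epsilon>" by (rule \<pi>star[OF v(1) u v(2) _ n(2)])
    \<comment> \<open>The window was chosen to contain the origin, so translating by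
      \<open>j0\<close> inside it leads back to the point itself.\<close>
    moreover have "T j0 (T (int N *s a) (T n w)) = w" if w: "w \<in> X" for w
      using T_add[OF w, of "j0 + int N *s a" n] T_add[OF T_in[OF w], of j0 "int N *s a" n] n(4) T_0[OF w] by simp
    ultimately show ?thesis using x y \<epsilon>(3) by simp
  qed
  show ?thesis using gcont gprop sep by (intro exI[of _ g]) blast
qed

section \<open>Separation up to a given precision is an open and dense condition\<close>

definition separates :: "('a \<Rightarrow> real) \<Rightarrow> nat \<Rightarrow> real \<Rightarrow> (nat \<Rightarrow> 'a \<Rightarrow> real) \<Rightarrow> bool" where
  "separates h D \<delta> g \<longleftrightarrow> (\<forall>x\<in>X. \<forall>y\<in>X. (\<forall>n. h (T n x) = h (T n y)) \<longrightarrow>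
     (\<forall>n. \<forall>i<D. g i (T n x) = g i (T n y)) \<longrightarrow> dist x y < \<delta>)"

text \<open>Pairs at distance at least \<open>\<delta>\<close> form a compact set, on which the
  orbits of \<open>(h, g)\<close> differ in one fixed box by a definite amount. Small uniform
  changes of \<open>g\<close> cannot undo this.\<close>

lemma separates_open:
  assumes h: "continuous_on X h" and g: "\<And>i. i < D \<Longrightarrow> continuous_on X (g i)" and sep: "separates h D \<delta> g"
  shows "\<exists>\<rho>>0. \<forall>g'. (\<forall>i<D. \<forall>x\<in>X. \<bar>g' i x - g i x\<bar> \<le> \<rho>) \<longrightarrow> separates h D \<delta> g'"
proof -
  define S where "S = {p \<in> X \<times> X. \<delta> \<le> dist (fst p) (snd p)}"
  define G where "G = (\<lambda>n p. \<bar>h (T n (fst p)) - h (T n (snd p))\<bar> + (\<Sum>i<D. \<bar>g i (T n (fst p)) - g i (T n (snd p))\<bar>))"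
  have comp: "continuous_on (X \<times> X) (\<lambda>p. f (fst p))" "continuous_on (X \<times> X) (\<lambda>p. f (snd p))"
    if "continuous_on X f" for f :: "'a \<Rightarrow> real"
    using that by (auto intro!: continuous_on_compose2[OF that] continuous_intros)
  have "closedin (top_of_set (X \<times> X)) (X \<times> X \<inter> (\<lambda>p. dist (fst p) (snd p)) -` {\<delta>..})"
    by (intro continuous_closedin_preimage continuous_intros)
  moreover have "X \<times> X \<inter> (\<lambda>p. dist (fst p) (snd p)) -` {\<delta>..} = S" by (auto simp: S_def)
  ultimately have "closedin (top_of_set (X \<times> X)) S" by (simp only:)
  then have "compact S" by (rule closedin_compact[OF compact_Times[OF compact_X compact_X]])
  then have "\<exists>q. \<forall>p\<in>S. \<exists>n\<in>int_box q. G n p > 1 / (real q + 1)"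
  proof (rule compact_uniformly_positive)
    fix n :: "int^'k"
    have "continuous_on (X \<times> X) (G n)"
      unfolding G_def by (intro continuous_intros comp continuous_on_T_comp h g) auto
    then show "continuous_on S (G n)" by (rule continuous_on_subset) (auto simp: S_def)
  next
    fix p assume "p \<in> S"
    then obtain x y where xy: "p = (x, y)" "x \<in> X" "y \<in> X" "\<not> dist x y < \<delta>" by (cases p) (auto simp: S_def)
    have G0: "0 \<le> G n p" for n by (auto simp: G_def intro!: add_nonneg_nonneg sum_nonneg)
    show "\<exists>n. 0 < G n p"
    proof (rule ccontr)
      assume "\<not> ?thesis"
      then have "G n p = 0" for n using G0[of n] by (metis antisym_conv2)
      then have "\<bar>h (T n x) - h (T n y)\<bar> = 0 \<and> (\<Sum>i<D. \<bar>g i (T n x) - g i (T n y)\<bar>) = 0" for n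
        unfolding G_def xy(1) fst_conv snd_conv
        by (subst (asm) add_nonneg_eq_0_iff) (auto simp: sum_nonneg)
      then have "\<forall>n. h (T n x) = h (T n y)" "\<forall>n. \<forall>i<D. g i (T n x) = g i (T n y)"
        by (simp_all add: sum_nonneg_eq_0_iff)
      then show False using sep xy unfolding separates_def by blast
    qed
  qed
  then obtain q where q: "\<And>p. p \<in> S \<Longrightarrow> \<exists>n\<in>int_box q. G n p > 1 / (real q + 1)" by blast
  \<comment> \<open>Changing each of the \<open>D\<close> functions by \<open>\<rho>\<close> changes
    the sum of differences by at most \<open>D * (2 * \<rho>)\<close>.\<close>
  define \<rho> where "\<rho> = 1 / ((real D + 1) * (real q + 1)) / 2"
  have \<rho>: "0 < \<rho>" by (simp add: \<rho>_def)
  have D\<rho>: "real D * (2 * \<rho>) \<le> 1 / (real q + 1)"   proof -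
    have "real D * (2 * \<rho>) = (real D / (real D + 1)) * (1 / (real q + 1))" by (simp add: \<rho>_def)
    also have "\<dots> \<le> 1 * (1 / (real q + 1))" by (intro mult_right_mono) auto
    finally show ?thesis by simp
  qed
  have "separates h D \<delta> g'" if g': "\<forall>i<D. \<forall>x\<in>X. \<bar>g' i x - g i x\<bar> \<le> \<rho>" for g'
    unfolding separates_def
  proof (intro ballI impI, rule ccontr)
    fix x y assume x: "x \<in> X" and y: "y \<in> X" and hh: "\<forall>n. h (T n x) = h (T n y)"
      and gg: "\<forall>n. \<forall>i<D. g' i (T n x) = g' i (T n y)" and d: "\<not> dist x y < \<delta>"
    have "(x, y) \<in> S" using x y d by (simp add: S_def)
    then obtain n where n: "G n (x, y) > 1 / (real q + 1)" using q by blast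
    have "G n (x, y) = (\<Sum>i<D. \<bar>g i (T n x) - g i (T n y)\<bar>)" using hh by (simp add: G_def)
    also have "\<dots> \<le> (\<Sum>i<D. 2 * \<rho>)"
    proof (rule sum_mono)
      fix i assume "i \<in> {..<D}"
      then have i: "i < D" by simp
      have "\<bar>g' i (T n x) - g i (T n x)\<bar> \<le> \<rho>" "\<bar>g' i (T n y) - g i (T n y)\<bar> \<le> \<rho>"
        using g' i T_in[OF x] T_in[OF y] by blast+
      moreover have "g' i (T n x) = g' i (T n y)" using gg i by blast
      ultimately show "\<bar>g i (T n x) - g i (T n y)\<bar> \<le> 2 * \<rho>" by linarith
    qed
    also have "\<dots> = real D * (2 * \<rho>)" by simp
    finally show False using n D\<rho> by linarith
  qed
  then show ?thesis using \<rho> by blast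
qed

text \<open>Baire's argument by hand: approximations that separate with precision
  \<open>1 / (n + 1)\<close>, each with a radius \<open>\<rho> n\<close> in which this survives,
  nested so that the uniform limit lies within all the radii.\<close>

lemma exists_separating_functions:
  fixes h :: "'a \<Rightarrow> real"
  assumes h: "continuous_on X h"
    and code: "\<And>R. \<exists>M \<phi>. marker R M \<phi> \<and> (\<forall>x\<in>X. \<forall>y\<in>X. (\<forall>n. h (T n x) = h (T n y)) \<longrightarrow> \<phi> x = \<phi> y)"
    and mdim: "mdim X T < ereal (real D / 4)"
  shows "\<exists>g. (\<forall>i<D. continuous_on X (g i) \<and> (\<forall>x\<in>X. 0 \<le> g i x \<and> g i x \<le> (1::real))) \<and>
    (\<forall>x\<in>X. \<forall>y\<in>X. (\<forall>n. h (T n x) = h (T n y)) \<longrightarrow> (\<forall>n. \<forall>i<D. g i (T n x) = g i (T n y)) \<longrightarrow> x = y)"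
proof -
  define admissible where "admissible = (\<lambda>g :: nat \<Rightarrow> 'a \<Rightarrow> real.
    (\<forall>i<D. continuous_on X (g i)) \<and> (\<forall>i<D. \<forall>x\<in>X. 0 \<le> g i x \<and> g i x \<le> 1))"
  define stable where "stable = (\<lambda>n g \<rho>. \<forall>g'. (\<forall>i<D. \<forall>x\<in>X. \<bar>g' i x - g i x\<bar> \<le> \<rho>) \<longrightarrow> separates h D (1 / (real n + 1)) g')"
  have step: "\<exists>g' \<rho>'. admissible g' \<and> 0 < \<rho>' \<and> \<rho>' \<le> \<rho> / 2 \<and> stable n g' \<rho>' \<and> (\<forall>i<D. \<forall>x\<in>X. \<bar>g' i x - g i x\<bar> \<le> \<rho> / 2)"
    if g: "admissible g" and \<rho>: "0 < \<rho>" "\<rho> \<le> 1" for g \<rho> n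
  proof -
    have "\<exists>g'. (\<forall>i<D. continuous_on X (g' i) \<and> (\<forall>x\<in>X. 0 \<le> g' i x \<and> g' i x \<le> 1 \<and> \<bar>g' i x - g i x\<bar> < \<rho> / 2)) \<and>
      (\<forall>x\<in>X. \<forall>y\<in>X. (\<forall>n. h (T n x) = h (T n y)) \<longrightarrow> (\<forall>n. \<forall>i<D. g' i (T n x) = g' i (T n y)) \<longrightarrow> dist x y < 1 / (real n + 1))"
      by (rule perturbation[OF code mdim]) (use g \<rho> in \<open>auto simp: admissible_def\<close>)
    then obtain g' where g': "\<forall>i<D. continuous_on X (g' i) \<and> (\<forall>x\<in>X. 0 \<le> g' i x \<and> g' i x \<le> 1 \<and> \<bar>g' i x - g i x\<bar> < \<rho> / 2)"
      and sep: "separates h D (1 / (real n + 1)) g'"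
      unfolding separates_def by blast
    have adm: "admissible g'" using g' by (simp add: admissible_def)
    obtain \<rho>1 where \<rho>1: "\<rho>1 > 0" "stable n g' \<rho>1"
      using separates_open[OF h _ sep] g' unfolding stable_def by blast
    have "stable n g' (min \<rho>1 (\<rho> / 2))" using \<rho>1(2) unfolding stable_def by (meson min.boundedE)
    moreover have "\<forall>i<D. \<forall>x\<in>X. \<bar>g' i x - g i x\<bar> \<le> \<rho> / 2" using g' by (simp add: less_imp_le)
    ultimately show ?thesis using adm \<rho>1(1) \<rho>(1) by (intro exI[of _ g'] exI[of _ "min \<rho>1 (\<rho> / 2)"]) simp
  qed
  define Pr where "Pr = (\<lambda>n s. admissible (fst s) \<and> 0 < snd s \<and> snd s \<le> 1 \<and> stable n (fst s) (snd s))"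
  define Qr where "Qr = (\<lambda>(n::nat) s s'. snd s' \<le> snd s / 2 \<and> (\<forall>i<D. \<forall>x\<in>X. \<bar>fst s' i x - fst s i x\<bar> \<le> snd s / (2::real)))"
  have "\<exists>s. \<forall>n. Pr n (s n) \<and> Qr n (s n) (s (Suc n))"
  proof (rule dependent_nat_choice)
    have "admissible (\<lambda>_ _. 0)" by (simp add: admissible_def)
    from step[OF this, of 1 0] obtain g' \<rho>' where "admissible g'" "0 < \<rho>'" "\<rho>' \<le> 1 / 2" "stable 0 g' \<rho>'" by auto
    then show "\<exists>s. Pr 0 s" unfolding Pr_def by (intro exI[of _ "(g', \<rho>')"]) simp
    fix s n assume s: "Pr n s"
    then have s': "admissible (fst s)" "0 < snd s" "snd s \<le> 1" by (simp_all add: Pr_def)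
    from step[OF this, of "Suc n"] obtain g' \<rho>' where "admissible g'" "0 < \<rho>'" "\<rho>' \<le> snd s / 2" "stable (Suc n) g' \<rho>'"
      "\<forall>i<D. \<forall>x\<in>X. \<bar>g' i x - fst s i x\<bar> \<le> snd s / 2" by blast
    then show "\<exists>s'. Pr (Suc n) s' \<and> Qr n s s'" using s' unfolding Pr_def Qr_def by (intro exI[of _ "(g', \<rho>')"]) simp
  qed
  then obtain s where s: "\<And>n. Pr n (s n)" "\<And>n. Qr n (s n) (s (Suc n))" by blast
  define G where "G = (\<lambda>n. fst (s n))"
  define \<rho> where "\<rho> = (\<lambda>n. snd (s n))"
  have G: "\<And>n. admissible (G n)" "\<And>n. 0 < \<rho> n" "\<And>n. \<rho> n \<le> 1" "\<And>n. stable n (G n) (\<rho> n)"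
    using s(1) by (simp_all add: Pr_def G_def \<rho>_def)
  have \<rho>half: "\<rho> (Suc n) \<le> \<rho> n / 2" for n using s(2)[of n] by (simp add: Qr_def \<rho>_def)
  have Gstep: "\<bar>G (Suc n) i x - G n i x\<bar> \<le> \<rho> n / 2" if "i < D" "x \<in> X" for n i x
    using s(2)[of n] that by (simp add: Qr_def \<rho>_def G_def)
  \<comment> \<open>The radii at least halve, so a step of size \<open>\<rho> n / 2\<close> is at
    most \<open>\<rho> n - \<rho> (Suc n)\<close>, and the steps telescope.\<close>
  have Gdist: "\<bar>G (n + t) i x - G n i x\<bar> \<le> \<rho> n - \<rho> (n + t)" if "i < D" "x \<in> X" for n t i x
  proof (induction t)
    case (Suc t)
    then show ?case using Gstep[OF that, of "n + t"] \<rho>half[of "n + t"] unfolding add_Suc_right by linarith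
  qed simp
  have \<rho>pow: "\<rho> n \<le> (1 / 2) ^ n" for n
  proof (induction n)
    case (Suc n)
    then show ?case using \<rho>half[of n] by simp
  qed (use G(3) in simp)
  have \<rho>lim: "\<rho> \<longlonglongrightarrow> 0"
    by (rule tendsto_sandwich[of "\<lambda>_. 0" _ _ "\<lambda>n. (1 / 2) ^ n"])
       (use G(2) \<rho>pow in \<open>auto intro!: always_eventually less_imp_le LIMSEQ_power_zero\<close>)
  define g where "g = (\<lambda>i x. lim (\<lambda>n. G n i x))"
  have conv: "(\<lambda>n. G n i x) \<longlonglongrightarrow> g i x" if ix: "i < D" "x \<in> X" for i x
  proof -
    have "Cauchy (\<lambda>n. G n i x)"
    proof (rule metric_CauchyI)
      fix e :: real assume "0 < e"
      then obtain n where n: "\<rho> n < e / 2" using order_tendstoD(2)[OF \<rho>lim, of "e / 2"] by (auto simp: eventually_sequentially)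
      have "dist (G a i x) (G n i x) < e / 2" if "n \<le> a" for a
        using Gdist[OF ix, of n "a - n"] G(2)[of a] n that by (simp add: dist_real_def)
      then show "\<exists>M. \<forall>m\<ge>M. \<forall>n\<ge>M. dist (G m i x) (G n i x) < e"
        by (intro exI[of _ n]) (meson dist_triangle_half_l)
    qed
    then show ?thesis unfolding g_def by (simp add: Cauchy_convergent convergent_LIMSEQ_iff[symmetric])
  qed
  have near: "\<bar>g i x - G n i x\<bar> \<le> \<rho> n" if ix: "i < D" "x \<in> X" for i x n
  proof (rule tendsto_upperbound)
    show "(\<lambda>t. \<bar>G t i x - G n i x\<bar>) \<longlonglongrightarrow> \<bar>g i x - G n i x\<bar>" by (intro tendsto_intros conv ix)
    show "\<forall>\<^sub>F t in sequentially. \<bar>G t i x - G n i x\<bar> \<le> \<rho> n"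
    proof (rule eventually_sequentiallyI)
      fix t assume "n \<le> t"
      then show "\<bar>G t i x - G n i x\<bar> \<le> \<rho> n" using Gdist[OF ix, of n "t - n"] G(2)[of t] by simp
    qed
  qed simp
  have "continuous_on X (g i)" if i: "i < D" for i
  proof (rule uniform_limit_theorem)
    show "uniform_limit X (\<lambda>n. G n i) (g i) sequentially"
      unfolding uniform_limit_iff
    proof (intro allI impI)
      fix e :: real assume "0 < e"
      then have "\<forall>\<^sub>F n in sequentially. \<rho> n < e" using order_tendstoD(2)[OF \<rho>lim] by blast
      then show "\<forall>\<^sub>F n in sequentially. \<forall>x\<in>X. dist (G n i x) (g i x) < e"
      proof eventually_elim
        fix n assume "\<rho> n < e"
        then show "\<forall>x\<in>X. dist (G n i x) (g i x) < e"
          using near[OF i] by (auto simp: dist_real_def abs_minus_commute intro: le_less_trans)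
      qed
    qed
    show "\<forall>\<^sub>F n in sequentially. continuous_on X (G n i)"
      using G(1) i by (auto simp: admissible_def)
  qed simp
  moreover have "0 \<le> g i x \<and> g i x \<le> 1" if ix: "i < D" "x \<in> X" for i x
  proof -
    have "0 \<le> G n i x" "G n i x \<le> 1" for n using G(1)[of n] ix by (auto simp: admissible_def)
    then show ?thesis using conv[OF ix] by (meson LIMSEQ_le_const LIMSEQ_le_const2)
  qed
  moreover have "x = y" if "x \<in> X" "y \<in> X" "\<forall>n. h (T n x) = h (T n y)" "\<forall>n. \<forall>i<D. g i (T n x) = g i (T n y)" for x y
  proof (rule ccontr)
    assume "x \<noteq> y"
    then obtain n :: nat where n: "1 / dist x y < real n" using reals_Archimedean2 by blast
    have "separates h D (1 / (real n + 1)) g" using G(4)[of n] near unfolding stable_def by blast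
    then have "dist x y < 1 / (real n + 1)" using that unfolding separates_def by blast
    moreover have "1 / (real n + 1) \<le> dist x y" using n \<open>x \<noteq> y\<close> zero_le_dist[of x y]
      by (simp add: field_simps del: zero_le_dist)
    ultimately show False by linarith
  qed
  ultimately show ?thesis by (intro exI[of _ g]) blast
qed

end

text \<open>A continuous map from a compact to a Hausdorff space is closed, so an injective one is
  an embedding; orbit values separate points by assumption.\<close>

lemma embedding_into_shift:
  fixes X :: "'a::metric_space set" and T :: "int^'k \<Rightarrow> 'a \<Rightarrow> 'a"
  assumes system: "Zk_system X T" and D: "D > 0"
    and h: "continuous_on X h" "\<And>x. x \<in> X \<Longrightarrow> 0 \<le> h x \<and> h x \<le> (1::real)"
    and g: "\<And>i. i < D \<Longrightarrow> continuous_on X (g i)" "\<And>i x. i < D \<Longrightarrow> x \<in> X \<Longrightarrow> 0 \<le> g i x \<and> g i x \<le> (1::real)"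
    and inj: "\<And>x y. x \<in> X \<Longrightarrow> y \<in> X \<Longrightarrow> \<forall>n. h (T n x) = h (T n y) \<Longrightarrow> \<forall>n. \<forall>i<D. g i (T n x) = g i (T n y) \<Longrightarrow> x = y"
  shows "\<exists>f. embedding_map (top_of_set X) (shift_top (2 * D)) f \<and> (\<forall>n. \<forall>x\<in>X. f (T n x) = shift n (f x))"
proof -
  have compact: "compact X" and cont: "\<And>n. continuous_on X (T n)" and T_in: "\<And>n x. x \<in> X \<Longrightarrow> T n x \<in> X"
    and T_add: "\<And>m n x. x \<in> X \<Longrightarrow> T (m + n) x = T m (T n x)"
    using system unfolding Zk_system_def by blast+
  \<comment> \<open>Coordinate 0 is \<open>h\<close>, coordinates 1 to \<open>D\<close> are the
    functions \<open>g\<close>, the others are 0. They fit because \<open>D > 0\<close> gives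
    \<open>D + 1 \<le> 2 * D\<close>.\<close>
  define u where "u = (\<lambda>i x. if i = 0 then h x else if i \<le> D then g (i - 1) x else 0)"
  define f where "f = (\<lambda>x (n::int^'k). \<lambda>i\<in>{..<2 * D}. u i (T n x))"
  have ucont: "continuous_on X (u i)" for i
    using h(1) g(1)[of "i - 1"] by (cases "i = 0"; cases "i \<le> D") (auto simp: u_def)
  have u01: "0 \<le> u i x \<and> u i x \<le> 1" if "x \<in> X" for i x
    using h(2)[OF that] g(2)[OF _ that, of "i - 1"] by (cases "i = 0"; cases "i \<le> D") (auto simp: u_def)
  have "continuous_map (top_of_set X) (shift_top (2 * D)) f"
    unfolding shift_top_def continuous_map_componentwise_UNIV
  proof
    fix n
    have "continuous_map (top_of_set X) (top_of_set {0..1}) (\<lambda>x. u i (T n x))" for i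
      using u01 T_in continuous_on_compose2[OF ucont[of i] cont[of n]]
      by (auto simp: continuous_map_in_subtopology continuous_map_iff_continuous)
    then have "continuous_map (top_of_set X) (top_of_set {0..1}) (\<lambda>x. f x n i)" if "i < 2 * D" for i
      using that by (simp add: f_def)
    then show "continuous_map (top_of_set X) (product_topology (\<lambda>_. top_of_set {0..1}) {..<2 * D}) (\<lambda>x. f x n)"
      unfolding continuous_map_componentwise by (auto simp: f_def)
  qed
  moreover have "compact_space (top_of_set X)" using compact by (simp add: compact_space_subtopology)
  moreover have "Hausdorff_space (shift_top (2 * D))"
    unfolding shift_top_def by (auto simp: Hausdorff_space_product_topology Hausdorff_space_subtopology)
  moreover have "inj_on f X"
  proof (rule inj_onI)
    fix x y assume xy: "x \<in> X" "y \<in> X" "f x = f y"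
    have ueq: "u i (T n x) = u i (T n y)" if "i < 2 * D" for i n
      using fun_cong[OF fun_cong[OF xy(3), of n], of i] that by (simp add: f_def)
    have "h (T n x) = h (T n y)" for n using ueq[of 0 n] D by (simp add: u_def)
    moreover have "g i (T n x) = g i (T n y)" if "i < D" for i n using ueq[of "Suc i" n] that by (simp add: u_def)
    ultimately show "x = y" using inj xy by blast
  qed
  ultimately have "embedding_map (top_of_set X) (shift_top (2 * D)) f"
    by (intro injective_closed_imp_embedding_map continuous_imp_closed_map) auto
  moreover have "f (T n x) = shift n (f x)" if "x \<in> X" for n x
    using T_add[OF that] by (simp add: f_def shift_def fun_eq_iff)
  ultimately show ?thesis by blast
qed

theorem theorem1p5:
  fixes X :: "'a::metric_space set" and T :: "int^'k \<Rightarrow> 'a \<Rightarrow> 'a" and D :: nat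
  assumes "D > 0"
    and "Zk_system X T"
    and "marker_property X T"
    and "mdim X T < ereal (real D / 2 ^ (CARD('k) + 1))"
  shows "\<exists>f. embedding_map (top_of_set X) (shift_top (2 * D)) f \<and>
             (\<forall>n. \<forall>x\<in>X. f (T n x) = shift n (f x))"
proof (cases "X = {}")
  case True
  show ?thesis
    by (rule embedding_into_shift[OF assms(2,1), of "\<lambda>_. 0" "\<lambda>_ _. 0"]) (use True in auto)
next
  case False
  interpret zk_system X T using assms(2) False by unfold_locales
  \<comment> \<open>The rank is at least 1, so the assumed bound implies the bound
    \<open>D / 4\<close> of the construction.\<close>
  have "(2::real) ^ 2 \<le> 2 ^ (CARD('k) + 1)" by (intro power_increasing) (auto simp: Suc_leI)
  then have "real D / 2 ^ (CARD('k) + 1) \<le> real D / 4" by (intro divide_left_mono) auto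
  then have mdim: "mdim X T < ereal (real D / 4)" using assms(4) by (meson ereal_less_eq(3) order_less_le_trans)
  obtain h :: "'a \<Rightarrow> real" where h: "continuous_on X h" "\<forall>x\<in>X. 0 \<le> h x \<and> h x \<le> 1"
    and code: "\<forall>R. \<exists>M \<phi>. marker R M \<phi> \<and> (\<forall>x\<in>X. \<forall>y\<in>X. (\<forall>n. h (T n x) = h (T n y)) \<longrightarrow> \<phi> x = \<phi> y)"
    using exists_marker_code[OF assms(3)] by (elim exE conjE)
  obtain g where g: "\<forall>i<D. continuous_on X (g i) \<and> (\<forall>x\<in>X. 0 \<le> g i x \<and> g i x \<le> (1::real))"
    and inj: "\<forall>x\<in>X. \<forall>y\<in>X. (\<forall>n. h (T n x) = h (T n y)) \<longrightarrow> (\<forall>n. \<forall>i<D. g i (T n x) = g i (T n y)) \<longrightarrow> x = y"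
    using exists_separating_functions[OF h(1) code[rule_format] mdim] by (elim exE conjE)
  show ?thesis
    by (rule embedding_into_shift[OF assms(2,1) h(1), of g]) (use h(2) g inj in blast)+
qed

end
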